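(* Let $f,g\in M^!_{k,\rho}$. Then $\langle f,g\rangle_\varphi$ is independent of $\varphi\in(\pi/2,3\pi/2)\setminus\{\pi\}$; writing $\langle f,g\rangle$ for this common value, one has $\langle f,g\rangle=\overline{\langle g,f\rangle}$, and in particular $\langle f,f\rangle\in\mathbb{R}$.
   Context: Let $k\in\frac12\mathbb{Z}$. $\mathrm{Mp}_2(\mathbb{Z})$ is the group of pairs $(M,\phi)$ with $M=\left(\begin{smallmatrix}a&b\\c&d\end{smallmatrix}\right)\in\mathrm{SL}_2(\mathbb{Z})$ and $\phi$ holomorphic on $\mathbb{H}$ with $\phi(\tau)^2=c\tau+d$. Let $\rho:\mathrm{Mp}_2(\mathbb{Z})\to\mathrm{Aut}(V)$ be a unitary representation on a finite-dimensional complex space $V$ with hermitian product $(\cdot,\cdot)_V$, factoring through a finite quotient; write $v_1\cdot\overline{v_2}:=(v_1,v_2)_V$. The slash operator is $(f|_{k,\rho}(M,\phi))(\tau)=\phi(\tau)^{-2k}\rho((M,\phi))^{-1}f(M\tau)$. $M^!_{k,\rho}$ is the space of holomorphic $f:\mathbb{H}\to V$ with $f|_{k,\rho}\gamma=f$ for all $\gamma\in\mathrm{Mp}_2(\mathbb{Z})$ and $f(\tau)=O(e^{Cv})$ as $v\to\infty$ for some $C$; such $f$ has a Fourier expansion $f(\tau)=\sum_{n\in\mathbb{Q}}c_f(n)q^n$ ($\tau=u+iv$, $q=e^{2\pi i\tau}$, $c_f(n)\in V$, only finitely many $n<0$ with $c_f(n)\ne0$). Let $\mathcal F_t=\{\tau\in\mathbb{H}:|u|\le\frac12,|\tau|\ge1,v\le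 t\}$. For $r\in\mathbb{C}$ let $E_r(z)=\int_1^\infty e^{-zt}t^{-r}dt$ ($\Re z>0$) and, for $\varphi\in(\pi/2,3\pi/2)\setminus\{\pi\}$, let $E_{r,\varphi}$ be its analytic continuation to $\mathbb{C}\setminus\{xe^{i\varphi}:x\ge0\}$. For $s\in\mathbb{C}$ put \[ I_\varphi(f,g;0,s):=\lim_{t\to\infty}\Big(\int_{\mathcal F_t}f(\tau)\cdot\overline{g(\tau)}v^{k-s}\frac{du\,dv}{v^2}-\sum_{n\ge0}c_f(-n)\cdot\overline{c_g(-n)}\int_1^tv^{k-2-s}e^{4\pi nv}dv\Big)+\sum_{n>0}c_f(-n)\cdot\overline{c_g(-n)}E_{2-k+s,\varphi}(-4\pi n)+\frac{c_f(0)\cdot\overline{c_g(0)}}{1-k+s} \] (sums over rational $n$, all finite; the limit exists for all $s$ and is entire in $s$, so $I_\varphi(f,g;0,s)$ is meromorphic in $s$), and \[ \langle f,g\rangle_\varphi:=\mathrm{CT}_{s=0}\,I_\varphi(f,g;0,s)-i\sum_{n>0}c_f(-n)\cdot\overline{c_g(-n)}\,\Im\big(E_{2-k,\varphi}(-4\pi n)\big), \] where $\mathrm{CT}_{s=0}$ is the constant term of the Laurent expansion at $s=0$. *)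

theory Defs
  imports
    "HOL-Complex_Analysis.Complex_Analysis"
    "HOL-Algebra.Coset"
    "HOL-Library.Landau_Symbols"
begin

no_notation fps_nth (infixl \<open>$\<close> 75)

section \<open>Finite-dimensional hermitian spaces\<close>

text \<open>
  The norm is the one induced by the hermitian product and real scaling is the restriction of
  complex scaling, so the structure of a normed space adds no data: every finite-dimensional
  complex vector space with a positive definite hermitian product is an instance in exactly
  one way (with its usual topology). The product is linear in its first argument. Positive definiteness is contained in \<open>herm_self\<close>.
\<close>

class hermitian_space = real_normed_vector +
  fixes scaleC :: "complex \<Rightarrow> 'a \<Rightarrow> 'a"  (infixr \<open>*\<^sub>C\<close> 75)
    and herm :: "'a \<Rightarrow> 'a \<Rightarrow> complex"
  assumes scaleC_add_right: "a *\<^sub>C (x + y) = a *\<^sub>C x + a *\<^sub>C y"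
    and scaleC_add_left: "(a + b) *\<^sub>C x = a *\<^sub>C x + b *\<^sub>C x"
    and scaleC_scaleC: "a *\<^sub>C b *\<^sub>C x = (a * b) *\<^sub>C x"
    and scaleC_of_real: "complex_of_real r *\<^sub>C x = r *\<^sub>R x"
    and herm_add_left: "herm (x + y) z = herm x z + herm y z"
    and herm_scaleC_left: "herm (a *\<^sub>C x) y = a * herm x y"
    and herm_commute: "herm y x = cnj (herm x y)"
    and herm_self: "herm x x = complex_of_real ((norm x)\<^sup>2)"
    and finite_dimensional: "\<exists>B. finite B \<and> (\<forall>x. \<exists>c. x = (\<Sum>b\<in>B. c b *\<^sub>C b))"

lemma vector_space_scaleC: "vector_space (scaleC :: complex \<Rightarrow> 'v \<Rightarrow> 'v::hermitian_space)"
proof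
  show "1 *\<^sub>C x = x" for x :: 'v
    using scaleC_of_real[of 1 x] by simp
qed (simp_all add: scaleC_add_right scaleC_add_left scaleC_scaleC)

definition Aut :: "('v::hermitian_space \<Rightarrow> 'v) monoid" where
  "Aut = \<lparr>carrier = {A. Vector_Spaces.linear scaleC scaleC A \<and> bij A}, mult = (\<circ>), one = id\<rparr>"


section \<open>The metaplectic group\<close>

definition upper_half_plane :: "complex set"  (\<open>\<bbbH>\<close>) where
  "\<bbbH> = {\<tau>. Im \<tau> > 0}"

definition moebius_map :: "int^2^2 \<Rightarrow> complex \<Rightarrow> complex" where
  "moebius_map M \<tau> = (of_int (M$1$1) * \<tau> + of_int (M$1$2)) / (of_int (M$2$1) * \<tau> + of_int (M$2$2))"

definition automorphy :: "int^2^2 \<Rightarrow> complex \<Rightarrow> complex" where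
  "automorphy M \<tau> = of_int (M$2$1) * \<tau> + of_int (M$2$2)"

text \<open>
  Functions on the upper half plane occurring in group elements are normalised to be
  undefined elsewhere, so that equality of pairs is equality of functions on it.
\<close>

definition Mp2Z :: "((int^2^2) \<times> (complex \<Rightarrow> complex)) monoid" where
  "Mp2Z =
    \<lparr>carrier = {(M, \<phi>). det M = 1 \<and> \<phi> \<in> extensional \<bbbH> \<and> \<phi> holomorphic_on \<bbbH>
                  \<and> (\<forall>\<tau>\<in>\<bbbH>. (\<phi> \<tau>)\<^sup>2 = automorphy M \<tau>)},
     mult = (\<lambda>(M, \<phi>) (N, \<psi>). (M ** N, \<lambda>\<tau>\<in>\<bbbH>. \<phi> (moebius_map N \<tau>) * \<psi> \<tau>)),
     one = (mat 1, \<lambda>\<tau>\<in>\<bbbH>. 1)\<rparr>"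

lemma automorphy_nonzero:
  assumes "det M = 1" "\<tau> \<in> \<bbbH>"
  shows "automorphy M \<tau> \<noteq> 0"
proof
  assume "automorphy M \<tau> = 0"
  then have "of_int (M$2$1) * Im \<tau> = 0" "of_int (M$2$1) * Re \<tau> + of_int (M$2$2) = 0"
    by (simp_all add: automorphy_def complex_eq_iff)
  with assms show False by (auto simp: upper_half_plane_def det_2)
qed

lemma moebius_in_upper_half_plane:
  assumes "det M = 1" "\<tau> \<in> \<bbbH>"
  shows "moebius_map M \<tau> \<in> \<bbbH>"
proof -
  have "real_of_int (M$1$1 * M$2$2 - M$1$2 * M$2$1) = 1"
    using assms(1) by (simp add: det_2)
  then have d: "real_of_int (M$1$1) * of_int (M$2$2) - of_int (M$1$2) * of_int (M$2$1) = 1"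
    by simp
  let ?D = "automorphy M \<tau>"
  have "Im (moebius_map M \<tau>) =
      (real_of_int (M$1$1) * of_int (M$2$2) - of_int (M$1$2) * of_int (M$2$1)) * Im \<tau>
        / ((Re ?D)\<^sup>2 + (Im ?D)\<^sup>2)"
    by (simp add: moebius_map_def automorphy_def Im_divide field_simps)
  also have "\<dots> = Im \<tau> / ((Re ?D)\<^sup>2 + (Im ?D)\<^sup>2)"
    by (simp only: d mult_1_left)
  also have "\<dots> > 0"
    using assms automorphy_nonzero[OF assms]
    by (intro divide_pos_pos) (auto simp: upper_half_plane_def complex_eq_iff sum_power2_gt_zero_iff)
  finally show ?thesis by (simp add: upper_half_plane_def)
qed

lemma moebius_mat_1 [simp]: "moebius_map (mat 1) \<tau> = \<tau>"
  by (simp add: moebius_map_def mat_def)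

lemma matrix_mult_components_2:
  fixes M N :: "int^2^2"
  shows "(M ** N)$i$j = M$i$1 * N$1$j + M$i$2 * N$2$j"
  by (simp add: matrix_matrix_mult_def sum_2)

lemma automorphy_mult:
  assumes "det N = 1" "\<tau> \<in> \<bbbH>"
  shows "automorphy (M ** N) \<tau> = automorphy M (moebius_map N \<tau>) * automorphy N \<tau>"
  using automorphy_nonzero[OF assms]
  by (simp add: automorphy_def moebius_map_def matrix_mult_components_2 field_simps)

lemma moebius_mult:
  assumes "det M = 1" "det N = 1" "\<tau> \<in> \<bbbH>"
  shows "moebius_map (M ** N) \<tau> = moebius_map M (moebius_map N \<tau>)"
proof -
  let ?n = "automorphy N \<tau>"
  have n: "?n \<noteq> 0" using assms automorphy_nonzero by blast
  have num: "of_int ((M ** N)$1$1) * \<tau> + of_int ((M ** N)$1$2)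
      = (of_int (M$1$1) * moebius_map N \<tau> + of_int (M$1$2)) * ?n"
    using n by (simp add: automorphy_def moebius_map_def matrix_mult_components_2 field_simps)
  have "moebius_map (M ** N) \<tau> =
      ((of_int (M$1$1) * moebius_map N \<tau> + of_int (M$1$2)) * ?n) / automorphy (M ** N) \<tau>"
    by (subst moebius_map_def) (simp only: num automorphy_def)
  also have "\<dots> = moebius_map M (moebius_map N \<tau>)"
    using n by (simp add: automorphy_mult[OF assms(2,3)] moebius_map_def[of M] automorphy_def[of M])
  finally show ?thesis .
qed

lemma moebius_holomorphic:
  assumes "det M = 1"
  shows "moebius_map M holomorphic_on \<bbbH>"
  unfolding moebius_map_def[abs_def]
  using automorphy_nonzero[OF assms] by (intro holomorphic_intros) (simp add: automorphy_def)

lemma group_Mp2Z: "group Mp2Z"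
proof (rule groupI)
  fix x y assume "x \<in> carrier Mp2Z" "y \<in> carrier Mp2Z"
  then obtain M \<phi> N \<psi> where xy: "x = (M, \<phi>)" "y = (N, \<psi>)"
    and *: "det M = 1" "\<phi> holomorphic_on \<bbbH>" "\<And>\<tau>. \<tau> \<in> \<bbbH> \<Longrightarrow> (\<phi> \<tau>)\<^sup>2 = automorphy M \<tau>"
           "det N = 1" "\<psi> holomorphic_on \<bbbH>" "\<And>\<tau>. \<tau> \<in> \<bbbH> \<Longrightarrow> (\<psi> \<tau>)\<^sup>2 = automorphy N \<tau>"
    by (auto simp: Mp2Z_def)
  have "(\<lambda>\<tau>. \<phi> (moebius_map N \<tau>)) holomorphic_on \<bbbH>"
    using holomorphic_on_compose_gen[OF moebius_holomorphic *(2), of N]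
      moebius_in_upper_half_plane[of N] * by (auto simp: o_def)
  then have "(\<lambda>\<tau>\<in>\<bbbH>. \<phi> (moebius_map N \<tau>) * \<psi> \<tau>) holomorphic_on \<bbbH>"
    using * by (subst holomorphic_cong[OF refl, where g = "\<lambda>\<tau>. \<phi> (moebius_map N \<tau>) * \<psi> \<tau>"])
      (auto intro!: holomorphic_intros)
  then show "x \<otimes>\<^bsub>Mp2Z\<^esub> y \<in> carrier Mp2Z"
    using * xy
    by (auto simp: Mp2Z_def det_mul power_mult_distrib automorphy_mult moebius_in_upper_half_plane)
next
  show "\<one>\<^bsub>Mp2Z\<^esub> \<in> carrier Mp2Z"
    by (auto simp: Mp2Z_def automorphy_def mat_def det_2 cong: holomorphic_cong)
next
  fix x y z assume "x \<in> carrier Mp2Z" "y \<in> carrier Mp2Z" "z \<in> carrier Mp2Z"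
  then show "x \<otimes>\<^bsub>Mp2Z\<^esub> y \<otimes>\<^bsub>Mp2Z\<^esub> z = x \<otimes>\<^bsub>Mp2Z\<^esub> (y \<otimes>\<^bsub>Mp2Z\<^esub> z)"
    by (auto simp: Mp2Z_def matrix_mul_assoc moebius_mult moebius_in_upper_half_plane
        intro!: restrict_ext)
next
  fix x assume "x \<in> carrier Mp2Z"
  then show "\<one>\<^bsub>Mp2Z\<^esub> \<otimes>\<^bsub>Mp2Z\<^esub> x = x"
    by (auto simp: Mp2Z_def moebius_in_upper_half_plane extensional_def fun_eq_iff)
next
  fix x assume "x \<in> carrier Mp2Z"
  then obtain M \<phi> where x: "x = (M, \<phi>)"
    and *: "det M = 1" "\<phi> holomorphic_on \<bbbH>" "\<And>\<tau>. \<tau> \<in> \<bbbH> \<Longrightarrow> (\<phi> \<tau>)\<^sup>2 = automorphy M \<tau>"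
    by (auto simp: Mp2Z_def)
  define N :: "int^2^2" where
    "N = vector [vector [M$2$2, - M$1$2], vector [- M$2$1, M$1$1]]"
  have N: "det N = 1" and NM: "N ** M = mat 1" and MN: "M ** N = mat 1"
    using *(1) by (simp_all add: N_def det_2 vec_eq_iff forall_2 mat_def matrix_mult_components_2
        algebra_simps)
  have nz: "\<phi> \<tau> \<noteq> 0" if "\<tau> \<in> \<bbbH>" for \<tau>
    using *(3)[OF that] automorphy_nonzero[OF *(1) that] by auto
  define \<psi> where "\<psi> = (\<lambda>\<tau>\<in>\<bbbH>. 1 / \<phi> (moebius_map N \<tau>))"
  have "(\<lambda>\<tau>. \<phi> (moebius_map N \<tau>)) holomorphic_on \<bbbH>"
    using holomorphic_on_compose_gen[OF moebius_holomorphic *(2), of N]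
      moebius_in_upper_half_plane[of N] N by (auto simp: o_def)
  then have "\<psi> holomorphic_on \<bbbH>"
    unfolding \<psi>_def
    using nz moebius_in_upper_half_plane[OF N]
    by (subst holomorphic_cong[OF refl, where g = "\<lambda>\<tau>. 1 / \<phi> (moebius_map N \<tau>)"])
      (simp, rule holomorphic_on_divide, auto)
  moreover have "(\<psi> \<tau>)\<^sup>2 = automorphy N \<tau>" if "\<tau> \<in> \<bbbH>" for \<tau>
  proof -
    have "automorphy M (moebius_map N \<tau>) * automorphy N \<tau> = 1"
      using automorphy_mult[OF N that, of M] by (simp add: MN automorphy_def mat_def)
    then show ?thesis
      using that *(3)[OF moebius_in_upper_half_plane[OF N that]]
      by (auto simp: \<psi>_def power_divide divide_simps mult.commute)
  qed
  ultimately have "(N, \<psi>) \<in> carrier Mp2Z"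
    using N by (auto simp: Mp2Z_def \<psi>_def)
  moreover have "moebius_map N (moebius_map M \<tau>) = \<tau>" if "\<tau> \<in> \<bbbH>" for \<tau>
    using moebius_mult[OF N *(1) that] by (simp add: NM)
  then have "(N, \<psi>) \<otimes>\<^bsub>Mp2Z\<^esub> x = \<one>\<^bsub>Mp2Z\<^esub>"
    using nz * by (auto simp: Mp2Z_def x NM \<psi>_def moebius_in_upper_half_plane intro!: restrict_ext)
  ultimately show "\<exists>y\<in>carrier Mp2Z. y \<otimes>\<^bsub>Mp2Z\<^esub> x = \<one>\<^bsub>Mp2Z\<^esub>" by blast
qed

definition unitary_representation ::
    "((int^2^2) \<times> (complex \<Rightarrow> complex) \<Rightarrow> 'v::hermitian_space \<Rightarrow> 'v) \<Rightarrow> bool" where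
  "unitary_representation \<rho> \<longleftrightarrow> \<rho> \<in> hom Mp2Z Aut
     \<and> (\<forall>\<gamma>\<in>carrier Mp2Z. \<forall>v w. herm (\<rho> \<gamma> v) (\<rho> \<gamma> w) = herm v w)"

definition factors_through_finite_quotient ::
    "((int^2^2) \<times> (complex \<Rightarrow> complex) \<Rightarrow> 'v::hermitian_space \<Rightarrow> 'v) \<Rightarrow> bool" where
  "factors_through_finite_quotient \<rho> \<longleftrightarrow>
     (\<exists>N. N \<lhd> Mp2Z \<and> finite (carrier (Mp2Z Mod N)) \<and> (\<forall>\<gamma>\<in>N. \<rho> \<gamma> = id))"


section \<open>Weakly holomorphic modular forms\<close>

definition vector_holomorphic_on :: "(complex \<Rightarrow> 'v::hermitian_space) \<Rightarrow> complex set \<Rightarrow> bool" where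
  "vector_holomorphic_on f S \<longleftrightarrow> (\<forall>z\<in>S. \<exists>D. (f has_derivative (\<lambda>h. h *\<^sub>C D)) (at z within S))"

text \<open>For \<open>k\<close> in \<open>1/2 \<int>\<close> the exponent \<open>-2k\<close> is an integer, so the floor below is exact.\<close>

definition slash ::
    "real \<Rightarrow> ((int^2^2) \<times> (complex \<Rightarrow> complex) \<Rightarrow> 'v::hermitian_space \<Rightarrow> 'v) \<Rightarrow>
     (complex \<Rightarrow> 'v) \<Rightarrow> (int^2^2) \<times> (complex \<Rightarrow> complex) \<Rightarrow> complex \<Rightarrow> 'v" where
  "slash k \<rho> f = (\<lambda>(M, \<phi>) \<tau>. (\<phi> \<tau> powi \<lfloor>- 2 * k\<rfloor>) *\<^sub>C inv_into UNIV (\<rho> (M, \<phi>)) (f (moebius_map M \<tau>)))"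

text \<open>Forms are total functions, but only their values on the upper half plane matter.\<close>

definition weakly_holomorphic_forms ::
    "real \<Rightarrow> ((int^2^2) \<times> (complex \<Rightarrow> complex) \<Rightarrow> 'v::hermitian_space \<Rightarrow> 'v) \<Rightarrow>
     (complex \<Rightarrow> 'v) set" where
  "weakly_holomorphic_forms k \<rho> =
     {f. vector_holomorphic_on f \<bbbH>
       \<and> (\<forall>\<gamma>\<in>carrier Mp2Z. \<forall>\<tau>\<in>\<bbbH>. slash k \<rho> f \<gamma> \<tau> = f \<tau>)
       \<and> (\<exists>C::real. (\<lambda>\<tau>. norm (f \<tau>)) \<in> O[filtercomap Im at_top](\<lambda>\<tau>. exp (C * Im \<tau>)))}"

definition fourier_coeff :: "(complex \<Rightarrow> 'v::hermitian_space) \<Rightarrow> rat \<Rightarrow> 'v" where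
  "fourier_coeff f = (THE c. finite {n. n < 0 \<and> c n \<noteq> 0}
     \<and> (\<forall>\<tau>\<in>\<bbbH>. ((\<lambda>n. exp (2 * pi * \<i> * of_rat n * \<tau>) *\<^sub>C c n) has_sum f \<tau>) UNIV))"


section \<open>The generalised exponential integral\<close>

definition E_int :: "complex \<Rightarrow> complex \<Rightarrow> complex" where
  "E_int r z = integral {1..} (\<lambda>t. exp (- z * of_real t) * of_real t powr (- r))"

definition slit_plane :: "real \<Rightarrow> complex set" where
  "slit_plane \<phi> = - {of_real x * cis \<phi> | x. x \<ge> 0}"

text \<open>The value at a point of the slit plane of the analytic continuation.\<close>

definition E_cont :: "real \<Rightarrow> complex \<Rightarrow> complex \<Rightarrow> complex" where
  "E_cont \<phi> r z = (THE w. \<exists>F. F holomorphic_on slit_plane \<phi>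
     \<and> (\<forall>z'. Re z' > 0 \<longrightarrow> F z' = E_int r z') \<and> w = F z)"


section \<open>The regularised pairing\<close>

definition admissible_angles :: "real set" where
  "admissible_angles = {pi/2<..<3*pi/2} - {pi}"

definition truncated_domain :: "real \<Rightarrow> complex set" where
  "truncated_domain t = {\<tau>\<in>\<bbbH>. \<bar>Re \<tau>\<bar> \<le> 1/2 \<and> cmod \<tau> \<ge> 1 \<and> Im \<tau> \<le> t}"

definition polar_product ::
    "(complex \<Rightarrow> 'v::hermitian_space) \<Rightarrow> (complex \<Rightarrow> 'v) \<Rightarrow> rat \<Rightarrow> complex" where
  "polar_product f g n = herm (fourier_coeff f (- n)) (fourier_coeff g (- n))"

text \<open>
  Lebesgue measure on \<open>complex\<close> is \<open>du dv\<close>. The sums over rational \<open>n\<close> have only finitely many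
  nonzero terms.
\<close>

definition I_reg ::
    "real \<Rightarrow> real \<Rightarrow> (complex \<Rightarrow> 'v::hermitian_space) \<Rightarrow> (complex \<Rightarrow> 'v) \<Rightarrow> complex \<Rightarrow> complex" where
  "I_reg k \<phi> f g s =
     Lim at_top (\<lambda>t::real.
       integral (truncated_domain t)
         (\<lambda>\<tau>. herm (f \<tau>) (g \<tau>) * of_real (Im \<tau>) powr (of_real k - s) / of_real ((Im \<tau>)\<^sup>2))
       - (\<Sum>\<^sub>\<infinity>n\<in>{0..}. polar_product f g n *
            integral {1..t} (\<lambda>v. of_real v powr (of_real k - 2 - s) * exp (4 * pi * of_rat n * v))))
     + (\<Sum>\<^sub>\<infinity>n\<in>{0<..}. polar_product f g n * E_cont \<phi> (2 - of_real k + s) (- 4 * pi * of_rat n))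
     + polar_product f g 0 / (1 - of_real k + s)"

definition pairing_angle ::
    "real \<Rightarrow> real \<Rightarrow> (complex \<Rightarrow> 'v::hermitian_space) \<Rightarrow> (complex \<Rightarrow> 'v) \<Rightarrow> complex" where
  "pairing_angle k \<phi> f g =
     fls_nth (laurent_expansion (I_reg k \<phi> f g) 0) 0
     - \<i> * (\<Sum>\<^sub>\<infinity>n\<in>{0<..}. polar_product f g n *
              of_real (Im (E_cont \<phi> (2 - of_real k) (- 4 * pi * of_rat n))))"

definition pairing ::
    "real \<Rightarrow> (complex \<Rightarrow> 'v::hermitian_space) \<Rightarrow> (complex \<Rightarrow> 'v) \<Rightarrow> complex" where
  "pairing k f g = (THE w. \<forall>\<phi>\<in>admissible_angles. w = pairing_angle k \<phi> f g)"

end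

(*
  Write r = 2 - k. For z < 0 the values of E_{r,phi}(z) on the two sides of the negative axis are
  complex conjugates, because r is real, and on one side they do not depend on phi; so Re E_{r,phi}(z)
  does not depend on phi. After taking the constant term at s = 0, the correction term in the
  definition of the pairing replaces E_{r,phi} by its real part, and the pairing is L(0) plus a
  hermitian sum, where L(s) is the limit in the definition of I_phi. It remains to see that L exists and
  is holomorphic near 0. Above height 1 the fundamental domain is a strip, and by Parseval the mean of
  (f, g) over a horizontal segment at height v is the sum of (c_f(n), c_g(n)) exp(-4 pi n v) over all
  rational n. The terms with n <= 0 are exactly the subtracted ones and the rest decays exponentially
  in v. Every integral that depends on s, including E_r itself, has the shape of the integral of
  w exp(-s l) with w exp(R |l|) integrable, which is holomorphic by expanding the exponential.
*)
theory Submission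
  imports Defs "HOL-Real_Asymp.Real_Asymp"
begin

section \<open>The exponential integral\<close>

text \<open>\<open>E_cont\<close> and \<open>fourier_coeff\<close> are definite descriptions, so a
  continuation and an expansion have to be built and shown unique before anything can be computed.
  The continuation must also be holomorphic in the order r, because of the constant term at s = 0.
  It is therefore solved for explicitly: z E_r'(z) = (r - 1) E_r(z) - exp(-z) is linear of first
  order, and its solution by variation of constants, started at a point of the right half-plane,
  depends on r only through powers, one value of the convergent integral, and an integral over a
  compact segment. The coefficients are indexed by all rationals, and a competing family need not
  have bounded denominators, so uniqueness cannot be read off by integrating over a period; an
  average over multiples of an irrational step replaces that. The forms themselves do have a common
  period, since rho factors through a finite quotient, and an orthonormal basis reduces their
  expansions to scalar ones. The only possible pole at s = 0 comes from the zeroth coefficients when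
  k = 1.\<close>

lemma norm_exp_partial_sum_le:
  fixes z :: complex
  shows "norm (\<Sum>i<n. z ^ i / fact i) \<le> exp (norm z)"
proof -
  have "norm (\<Sum>i<n. z ^ i / fact i) \<le> (\<Sum>i<n. norm z ^ i / fact i)"
    by (rule order_trans[OF norm_sum]) (simp add: norm_divide norm_power)
  also have "\<dots> \<le> (\<Sum>i. norm z ^ i / fact i)"
    using summable_exp_generic[of "norm z"]
    by (intro sum_le_suminf) (auto simp: divide_inverse mult.commute)
  also have "\<dots> = exp (norm z)"
    by (simp add: exp_def divide_inverse mult.commute)
  finally show ?thesis .
qed

text \<open>For |s| < R all partial sums of the series of exp(-s l) are bounded by exp(R |l|), so
  dominated convergence turns the integral into a power series in s with coefficients
  \<open>a n\<close>. The first conclusion serves for powers of a real variable, with l a logarithm;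
  the second, with l the variable itself, differentiates E_r in z.\<close>

lemma
  fixes w l :: "'a \<Rightarrow> complex"
  assumes [measurable]: "w \<in> borel_measurable M" "l \<in> borel_measurable M"
    and int: "integrable M (\<lambda>x. norm (w x) * exp (R * norm (l x)))"
    and "R > 0"
  shows exp_integral_holomorphic:
      "(\<lambda>s. LINT x|M. w x * exp (- s * l x)) holomorphic_on ball 0 R" (is ?hol)
    and exp_integral_deriv_0:
      "((\<lambda>s. LINT x|M. w x * exp (- s * l x)) has_field_derivative (LINT x|M. - (w x * l x))) (at 0)"
      (is ?der)
proof -
  define a where "a n = (LINT x|M. w x * ((- l x) ^ n / fact n))" for n
  have intp: "integrable M (\<lambda>x. w x * ((- l x) ^ n / fact n))" for n
  proof (rule Bochner_Integration.integrable_bound)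
    show "integrable M (\<lambda>x. (norm (w x) * exp (R * norm (l x))) / R ^ n)"
      using int by simp
    \<comment> \<open>A single term of the nonnegative series of exp(R |l|) is at most the whole
      sum.\<close>
    have "(R * norm (l x)) ^ n / fact n \<le> exp (R * norm (l x))" for x
    proof -
      have "(\<Sum>i\<in>{n}. (R * norm (l x)) ^ i / fact i) \<le> (\<Sum>i. (R * norm (l x)) ^ i / fact i)"
        using summable_exp_generic[of "R * norm (l x)"] \<open>R > 0\<close>
        by (intro sum_le_suminf) (auto simp: divide_inverse mult.commute)
      then show ?thesis by (simp add: exp_def divide_inverse mult.commute)
    qed
    then have "norm (w x) * ((R * norm (l x)) ^ n / fact n) / R ^ n
        \<le> norm (w x) * exp (R * norm (l x)) / R ^ n" for x
      using \<open>R > 0\<close> by (intro divide_right_mono mult_left_mono) auto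
    then show "AE x in M. norm (w x * ((- l x) ^ n / fact n))
        \<le> norm (norm (w x) * exp (R * norm (l x)) / R ^ n)"
      using \<open>R > 0\<close> by (auto simp: norm_mult norm_divide norm_power power_mult_distrib field_simps)
  qed measurable
  have sums: "(\<lambda>n. a n * (s - 0) ^ n) sums (LINT x|M. w x * exp (- s * l x))"
    if s: "s \<in> ball 0 R" for s
  proof -
    have "(\<Sum>i<n. a i * (s - 0) ^ i) = (LINT x|M. w x * (\<Sum>i<n. (- s * l x) ^ i / fact i))" for n
    proof -
      have "(\<Sum>i<n. a i * (s - 0) ^ i) = (\<Sum>i<n. LINT x|M. w x * ((- l x) ^ i / fact i) * s ^ i)"
        by (simp add: a_def)
      also have "\<dots> = (LINT x|M. (\<Sum>i<n. w x * ((- l x) ^ i / fact i) * s ^ i))"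
        by (subst Bochner_Integration.integral_sum) (intro integrable_mult_left intp, rule refl)
      also have "\<dots> = (LINT x|M. w x * (\<Sum>i<n. (- s * l x) ^ i / fact i))"
        by (intro Bochner_Integration.integral_cong refl)
          (auto simp: sum_distrib_left power_mult_distrib power_minus[of "_ * _"] power_minus[of "l _"]
            intro!: sum.cong)
      finally show ?thesis .
    qed
    moreover have "(\<lambda>n. LINT x|M. w x * (\<Sum>i<n. (- s * l x) ^ i / fact i))
        \<longlonglongrightarrow> (LINT x|M. w x * exp (- s * l x))"
    proof (rule integral_dominated_convergence)
      show "integrable M (\<lambda>x. norm (w x) * exp (R * norm (l x)))" by (fact int)
      have "(\<lambda>i. (- s * l x) ^ i / fact i) sums exp (- s * l x)" for x
        using exp_converges[of "- s * l x"] by (simp add: scaleR_conv_of_real divide_inverse mult.commute)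
      then show "AE x in M. (\<lambda>n. w x * (\<Sum>i<n. (- s * l x) ^ i / fact i)) \<longlonglongrightarrow> w x * exp (- s * l x)"
        by (auto simp: sums_def intro!: tendsto_mult)
      show "AE x in M. norm (w x * (\<Sum>i<n. (- s * l x) ^ i / fact i)) \<le> norm (w x) * exp (R * norm (l x))" for n
      proof (rule AE_I2)
        fix x
        have "norm (\<Sum>i<n. (- s * l x) ^ i / fact i) \<le> exp (norm (- s * l x))"
          by (rule norm_exp_partial_sum_le)
        also have "\<dots> \<le> exp (R * norm (l x))"
          using s by (auto simp: norm_mult intro!: mult_right_mono)
        finally show "norm (w x * (\<Sum>i<n. (- s * l x) ^ i / fact i)) \<le> norm (w x) * exp (R * norm (l x))"
          unfolding norm_mult by (intro mult_left_mono) auto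
      qed
    qed measurable
    ultimately show ?thesis by (simp add: sums_def)
  qed
  show ?hol
    by (rule power_series_holomorphic) (rule sums)
  have "((\<lambda>s. \<Sum>n. a n * s ^ n) has_field_derivative (\<Sum>n. diffs a n * 0 ^ n)) (at 0)"
  proof (rule termdiffs_strong)
    have "of_real (R / 2) \<in> ball (0::complex) R" using \<open>R > 0\<close> by simp
    from sums[OF this] show "summable (\<lambda>n. a n * (of_real (R / 2)) ^ n)"
      by (auto simp: sums_iff)
  qed (use \<open>R > 0\<close> in auto)
  also have "(\<Sum>n. diffs a n * 0 ^ n) = a 1"
    by (simp add: diffs_def)
  also have "a 1 = (LINT x|M. - (w x * l x))"
    by (simp add: a_def)
  finally show ?der
  proof (rule has_field_derivative_transform_within_open)
    show "(\<Sum>n. a n * s ^ n) = (LINT x|M. w x * exp (- s * l x))" if "s \<in> ball 0 R" for s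
      using sums[OF that] by (auto simp: sums_iff)
  qed (use \<open>R > 0\<close> in auto)
qed

section \<open>The integral E_r in the right half-plane\<close>

lemma powr_exp_set_integrable:
  fixes p e :: real
  assumes "e > 0"
  shows "set_integrable lborel {1..} (\<lambda>t. t powr p * exp (- e * t))"
proof -
  \<comment> \<open>The Gamma integrand is integrable down to 0 only for exponents above -1. On t
    \<ge> 1, raising the exponent to a nonnegative one merely enlarges the function.\<close>
  define q where "q = max p 0"
  have "(\<lambda>t. complex_of_real t powr (of_real (q + 1) - 1) / of_real (exp (e * t)))
      absolutely_integrable_on {0<..}"
    using assms by (intro absolutely_integrable_Gamma_integral) (auto simp: q_def)
  then have "set_integrable lebesgue {1..} (\<lambda>t. complex_of_real t powr (of_real (q + 1) - 1) / of_real (exp (e * t)))"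
    by (rule set_integrable_subset) auto
  then have *: "set_integrable lborel {1..} (\<lambda>t. complex_of_real t powr (of_real (q + 1) - 1) / of_real (exp (e * t)))"
    unfolding set_integrable_def by (subst (asm) integrable_completion) measurable
  show ?thesis
  proof (rule set_integrable_bound[OF *])
    show "AE t in lborel. t \<in> {1..} \<longrightarrow> norm (t powr p * exp (- e * t))
      \<le> norm (complex_of_real t powr (of_real (q + 1) - 1) / of_real (exp (e * t)))"
      by (intro AE_I2) (auto simp: norm_divide norm_mult norm_inverse norm_powr_real_powr exp_minus divide_inverse q_def
          intro!: mult_right_mono powr_mono)
  qed (simp add: set_borel_measurable_def)
qed

lemma norm_E_int_integrand:
  assumes "t > 0"
  shows "norm (exp (- z * of_real t) * of_real t powr (- r)) = t powr (- Re r) * exp (- Re z * t)"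
  using assms by (simp add: norm_mult norm_powr_real_powr)

lemma E_int_set_integrable:
  assumes "Re z > 0"
  shows "set_integrable lborel {1..} (\<lambda>t. exp (- z * of_real t) * of_real t powr (- r))"
proof (rule set_integrable_bound[OF powr_exp_set_integrable[OF assms, of "- Re r"]])
  show "AE t in lborel. t \<in> {1..} \<longrightarrow> norm (exp (- z * of_real t) * of_real t powr (- r))
      \<le> norm (t powr - Re r * exp (- Re z * t))"
    by (intro AE_I2 impI) (subst norm_E_int_integrand, auto)
qed (simp add: set_borel_measurable_def)

lemma E_int_eq_lebesgue:
  assumes "Re z > 0"
  shows "E_int r z = (LINT t|lborel. indicator {1..} t *\<^sub>R (exp (- z * of_real t) * of_real t powr (- r)))"
  using set_borel_integral_eq_integral(2)[OF E_int_set_integrable[OF assms]]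
  by (simp add: E_int_def set_lebesgue_integral_def)

text \<open>Since t^(-s) = exp(-s ln t), this is an integral of the general shape with R = 1. On t
  \<ge> 1 the dominating factor exp(|ln t|) is t itself, which only shifts the exponent by
  one.\<close>

lemma E_int_holomorphic_order:
  assumes "Re z > 0"
  shows "(\<lambda>s. E_int (r + s) z) holomorphic_on ball 0 1"
proof -
  let ?w = "\<lambda>t. indicator {1..} t *\<^sub>R (exp (- z * of_real t) * of_real t powr (- r))"
  have "(\<lambda>s. LINT t|lborel. ?w t * exp (- s * of_real (ln t))) holomorphic_on ball 0 1"
  proof (rule exp_integral_holomorphic)
    have "integrable lborel (\<lambda>t. indicator {1..} t *\<^sub>R (t powr (1 - Re r) * exp (- Re z * t)))"
      using powr_exp_set_integrable[OF assms] by (simp add: set_integrable_def)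
    also have "(\<lambda>t. indicator {1..} t *\<^sub>R (t powr (1 - Re r) * exp (- Re z * t)))
        = (\<lambda>t. norm (?w t) * exp (1 * norm (complex_of_real (ln t))))"
    proof
      fix t :: real
      show "indicator {1..} t *\<^sub>R (t powr (1 - Re r) * exp (- Re z * t))
          = norm (?w t) * exp (1 * norm (complex_of_real (ln t)))"
      proof (cases "t \<ge> 1")
        case True
        then show ?thesis
          using norm_E_int_integrand[of t z r]
          by (simp add: powr_diff powr_minus divide_inverse mult_ac)
      qed auto
    qed
    finally show "integrable lborel \<dots>" .
  qed auto
  also have "?this \<longleftrightarrow> ?thesis"
  proof (rule holomorphic_cong[OF refl])
    fix s
    show "(LINT t|lborel. ?w t * exp (- s * of_real (ln t))) = E_int (r + s) z"
      unfolding E_int_eq_lebesgue[OF assms]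
      by (intro Bochner_Integration.integral_cong refl)
        (auto simp: indicator_def powr_def Ln_of_real exp_diff exp_minus exp_add algebra_simps field_simps)
  qed
  finally show ?thesis .
qed

lemma E_int_has_field_derivative:
  assumes "Re z > 0"
  shows "(E_int r has_field_derivative - E_int (r - 1) z) (at z)"
proof -
  let ?w = "\<lambda>t. indicator {1..} t *\<^sub>R (exp (- z * of_real t) * of_real t powr (- r))"
  \<comment> \<open>Any radius strictly between 0 and Re z would do: the factor exp(R t) must leave
    some of the decay exp(-Re z t).\<close>
  define R where "R = Re z / 2"
  have R: "R > 0" "R < Re z" using assms by (auto simp: R_def)
  have "((\<lambda>s. LINT t|lborel. ?w t * exp (- s * of_real t)) has_field_derivative
      (LINT t|lborel. - (?w t * of_real t))) (at 0)"
  proof (rule exp_integral_deriv_0)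
    have "integrable lborel (\<lambda>t. indicator {1..} t *\<^sub>R (t powr (- Re r) * exp (- (Re z - R) * t)))"
      using powr_exp_set_integrable[of "Re z - R"] R by (simp add: set_integrable_def)
    also have "(\<lambda>t. indicator {1..} t *\<^sub>R (t powr (- Re r) * exp (- (Re z - R) * t)))
        = (\<lambda>t. norm (?w t) * exp (R * norm (complex_of_real t)))"
    proof
      fix t :: real
      show "indicator {1..} t *\<^sub>R (t powr (- Re r) * exp (- (Re z - R) * t))
          = norm (?w t) * exp (R * norm (complex_of_real t))"
      proof (cases "t \<ge> 1")
        case True
        then show ?thesis
          using norm_E_int_integrand[of t z r]
          by (simp add: left_diff_distrib exp_diff exp_add exp_minus divide_inverse mult_ac right_diff_distrib)
      qed auto
    qed
    finally show "integrable lborel \<dots>" .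
  qed (use R in auto)
  also have "(LINT t|lborel. - (?w t * of_real t))
      = (LINT t|lborel. - (indicator {1..} t *\<^sub>R (exp (- z * of_real t) * of_real t powr (- (r - 1)))))"
    by (intro Bochner_Integration.integral_cong refl) (auto simp: indicator_def powr_diff powr_minus field_simps)
  also have "\<dots> = - E_int (r - 1) z"
    unfolding E_int_eq_lebesgue[OF assms] by simp
  finally have "((\<lambda>s. LINT t|lborel. ?w t * exp (- s * of_real t)) has_field_derivative - E_int (r - 1) z) (at 0)" .
  then have "((\<lambda>s. E_int r (s + z)) has_field_derivative - E_int (r - 1) z) (at 0)"
  proof (rule has_field_derivative_transform_within_open)
    fix s :: complex assume "s \<in> ball 0 (Re z)"
    then have "Re (s + z) > 0"
      using abs_Re_le_cmod[of s] by (auto)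
    then show "(LINT t|lborel. ?w t * exp (- s * of_real t)) = E_int r (s + z)"
      by (subst E_int_eq_lebesgue)
        (auto intro!: Bochner_Integration.integral_cong simp: indicator_def exp_add[symmetric] algebra_simps)
  qed (use assms in auto)
  then show ?thesis
    using DERIV_shift[of "E_int r" "- E_int (r - 1) z" 0 z] by simp
qed

text \<open>Integration by parts: exp(-z t) t^(1-r) has derivative
  \<open>(1 - r) * e r t - z * e (r - 1) t\<close> and drops from exp(-z) at t = 1 to 0 at infinity.
  With the derivative formula above it gives the differential equation z E_r' = (r - 1) E_r -
  exp(-z).\<close>

lemma E_int_recurrence:
  assumes "Re z > 0"
  shows "z * E_int (r - 1) z = exp (- z) + (1 - r) * E_int r z"
proof -
  define e where "e r t = exp (- z * of_real t) * of_real t powr (- r)" for r :: complex and t :: real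
  have int: "set_integrable lborel {1..} (e r)" for r
    using E_int_set_integrable[OF assms] by (simp add: e_def[abs_def])
  let ?f = "\<lambda>t. (1 - r) * e r t - z * e (r - 1) t"
  have intf: "set_integrable lborel {1..} ?f"
    using int by (intro set_integral_diff set_integrable_mult_right) auto
  have eq: "einterval 1 \<infinity> = {1<..}"
    by (auto simp: einterval_def one_ereal_def)
  have "(LBINT t=1..\<infinity>. ?f t) = 0 - exp (- z)"
  proof (rule interval_integral_FTC_integrable[where F = "e (r - 1)"])
    fix t assume "1 < ereal t"
    then have t: "t > 0" by (simp add: one_ereal_def)
    have "((\<lambda>t. e (r - 1) (of_real t)) has_vector_derivative ?f t) (at t)"
      unfolding e_def using t
      by (auto intro!: derivative_eq_intros has_vector_derivative_real_field
          simp: powr_diff powr_minus field_simps)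
    then show "(e (r - 1) has_vector_derivative ?f t) (at t)" by simp
    show "isCont ?f t"
      unfolding e_def using t by (intro continuous_intros) auto
  next
    show "set_integrable lborel (einterval 1 \<infinity>) ?f"
      unfolding eq by (rule set_integrable_subset[OF intf]) auto
    have "isCont (e (r - 1)) 1"
      unfolding e_def by (intro continuous_intros) auto
    then have "(e (r - 1) \<longlongrightarrow> exp (- z)) (at_right 1)"
      by (auto simp: isCont_def e_def filterlim_at_split)
    then show "((e (r - 1) \<circ> real_of_ereal) \<longlongrightarrow> exp (- z)) (at_right 1)"
      by (simp add: one_ereal_def ereal_tendsto_simps)
    have "((\<lambda>t. t powr (1 - Re r) * exp (- Re z * t)) \<longlongrightarrow> 0) at_top"
      using assms by real_asymp
    then have "(e (r - 1) \<longlongrightarrow> 0) at_top"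
    proof (rule Lim_null_comparison[rotated])
      show "\<forall>\<^sub>F t in at_top. norm (e (r - 1) t) \<le> t powr (1 - Re r) * exp (- Re z * t)"
        using eventually_gt_at_top[of 0]
        by eventually_elim (auto simp: e_def norm_mult norm_powr_real_powr)
    qed
    then show "((e (r - 1) \<circ> real_of_ereal) \<longlongrightarrow> 0) (at_left \<infinity>)"
      by (simp add: ereal_tendsto_simps)
  qed (auto simp: one_ereal_def)
  \<comment> \<open>The fundamental theorem is stated on the open interval, \<open>E_int\<close> on
    the closed ray; they differ by a null set.\<close>
  moreover have "(LBINT t:{1<..}. ?f t) = (LBINT t:{1..}. ?f t)"
  proof (rule set_integral_cong_set)
    show "AE t::real in lborel. (t \<in> {1..}) = (t \<in> {1<..})"
      by (rule AE_mp[OF AE_lborel_singleton[of 1]]) (auto intro!: AE_I2)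
  qed (auto simp: set_borel_measurable_def e_def)
  then have "(LBINT t=1..\<infinity>. ?f t) = (LBINT t:{1..}. ?f t)"
    unfolding interval_lebesgue_integral_def eq by (simp add: one_ereal_def)
  moreover have "E_int r z = (LBINT t:{1..}. e r t)" for r
    unfolding E_int_eq_lebesgue[OF assms] e_def set_lebesgue_integral_def ..
  then have "(LBINT t:{1..}. ?f t) = (1 - r) * E_int r z - z * E_int (r - 1) z"
    by (subst set_integral_diff(2)) (auto intro: set_integrable_mult_right int)
  ultimately have "(1 - r) * E_int r z - z * E_int (r - 1) z = - exp (- z)"
    by (simp only: diff_0)
  then show ?thesis by algebra
qed

section \<open>Analytic continuation to a slit plane\<close>

text \<open>A branch of the logarithm on the slit plane: the rotation carries the slit onto the
  negative real axis, where \<open>Ln\<close> has its cut, and the added constant undoes the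
  rotation.\<close>

definition slit_log :: "real \<Rightarrow> complex \<Rightarrow> complex" where
  "slit_log \<phi> z = Ln (z * cis (pi - \<phi>)) + \<i> * of_real (\<phi> - pi)"

text \<open>Any point of the slit plane sees the base point \<open>- cis \<phi>\<close>, on the ray opposite to the slit.\<close>

definition E_path :: "real \<Rightarrow> complex \<Rightarrow> complex \<Rightarrow> complex" where
  "E_path \<phi> r z = exp ((r - 1) * slit_log \<phi> z) *
     (exp ((1 - r) * slit_log \<phi> (- cis \<phi>)) * E_int r (- cis \<phi>)
      - contour_integral (linepath (- cis \<phi>) z) (\<lambda>\<zeta>. exp (- \<zeta> - r * slit_log \<phi> \<zeta>)))"

lemma mem_slit_plane_iff: "z \<in> slit_plane \<phi> \<longleftrightarrow> z * cis (pi - \<phi>) \<notin> \<real>\<^sub>\<le>\<^sub>0"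
proof -
  have c: "cis (pi - \<phi>) = - cis (- \<phi>)"
    by (simp add: complex_eq_iff)
  have "(\<exists>x\<ge>0. z = of_real x * cis \<phi>) \<longleftrightarrow> z * cis (pi - \<phi>) \<in> \<real>\<^sub>\<le>\<^sub>0"
  proof
    assume "\<exists>x\<ge>0. z = of_real x * cis \<phi>"
    then obtain x where "x \<ge> 0" "z = of_real x * cis \<phi>" by blast
    then have "z * cis (pi - \<phi>) = of_real (- x)"
      unfolding c by (simp add: cis_mult mult.assoc)
    then show "z * cis (pi - \<phi>) \<in> \<real>\<^sub>\<le>\<^sub>0" using \<open>x \<ge> 0\<close>
      by (metis neg_le_0_iff_le nonpos_Reals_of_real_iff)
  next
    assume "z * cis (pi - \<phi>) \<in> \<real>\<^sub>\<le>\<^sub>0"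
    then obtain y where y: "y \<le> 0" "z * cis (pi - \<phi>) = of_real y"
      by (auto elim!: nonpos_Reals_cases)
    have "z = z * (cis (- \<phi>) * cis \<phi>)" by (simp add: cis_mult)
    also have "\<dots> = - (z * cis (pi - \<phi>)) * cis \<phi>" unfolding c by simp
    also have "\<dots> = of_real (- y) * cis \<phi>" using y by simp
    finally show "\<exists>x\<ge>0. z = of_real x * cis \<phi>" using y by (intro exI[of _ "- y"]) auto
  qed
  then show ?thesis by (auto simp: slit_plane_def)
qed

lemma open_slit_plane: "open (slit_plane \<phi>)"
proof -
  have "slit_plane \<phi> = (\<lambda>z. z * cis (pi - \<phi>)) -` (- \<real>\<^sub>\<le>\<^sub>0)"
    by (auto simp: mem_slit_plane_iff)
  then show ?thesis
    by (auto intro!: open_vimage continuous_intros)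
qed

text \<open>After the rotation the base point is 1, and a segment starting at 1 meets the
  nonpositive real axis only if its other end already lies there.\<close>

lemma closed_segment_subset_slit_plane:
  assumes "z \<in> slit_plane \<phi>"
  shows "closed_segment (- cis \<phi>) z \<subseteq> slit_plane \<phi>"
proof
  fix w assume "w \<in> closed_segment (- cis \<phi>) z"
  then obtain u where u: "0 \<le> u" "u \<le> 1" "w = (1 - u) *\<^sub>R (- cis \<phi>) + u *\<^sub>R z"
    by (auto simp: closed_segment_def)
  define y where "y = z * cis (pi - \<phi>)"
  have y: "y \<notin> \<real>\<^sub>\<le>\<^sub>0" using assms by (simp add: y_def mem_slit_plane_iff)
  have "- cis \<phi> * cis (pi - \<phi>) = 1" by (simp add: cis_mult complex_eq_iff)
  moreover have "w * cis (pi - \<phi>) = of_real (1 - u) * (- cis \<phi> * cis (pi - \<phi>)) + of_real u * y"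
    by (simp add: u(3) y_def scaleR_conv_of_real algebra_simps)
  ultimately have "w * cis (pi - \<phi>) = of_real (1 - u) + of_real u * y"
    by simp
  moreover have "of_real (1 - u) + of_real u * y \<notin> \<real>\<^sub>\<le>\<^sub>0"
  proof
    assume "of_real (1 - u) + of_real u * y \<in> \<real>\<^sub>\<le>\<^sub>0"
    then have *: "1 - u + u * Re y \<le> 0" "u * Im y = 0"
      by (auto simp: complex_nonpos_Reals_iff)
    then have "u \<noteq> 0" by auto
    with * u have "Im y = 0" "u * Re y \<le> 0" by auto
    then have "Im y = 0" "Re y \<le> 0" using u \<open>u \<noteq> 0\<close> by (auto simp: mult_le_0_iff)
    with y show False by (simp add: complex_nonpos_Reals_iff)
  qed
  ultimately show "w \<in> slit_plane \<phi>" by (simp add: mem_slit_plane_iff)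
qed

lemma starlike_slit_plane: "starlike (slit_plane \<phi>)"
  unfolding starlike_def
proof (rule bexI)
  show "\<forall>z\<in>slit_plane \<phi>. closed_segment (- cis \<phi>) z \<subseteq> slit_plane \<phi>"
    by (simp add: closed_segment_subset_slit_plane)
  have "- cis \<phi> * cis (pi - \<phi>) = 1" by (simp add: cis_mult complex_eq_iff)
  then show "- cis \<phi> \<in> slit_plane \<phi>" by (simp add: mem_slit_plane_iff)
qed

lemma right_half_plane_subset_slit_plane:
  assumes "cos \<phi> < 0"
  shows "{z. Re z > 0} \<subseteq> slit_plane \<phi>"
  using assms by (auto simp: slit_plane_def mult_less_0_iff zero_less_mult_iff)

lemma slit_log_has_field_derivative:
  assumes "z \<in> slit_plane \<phi>"
  shows "(slit_log \<phi> has_field_derivative 1 / z) (at z)"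
proof -
  have "z * cis (pi - \<phi>) \<noteq> 0" using assms unfolding mem_slit_plane_iff by force
  then show ?thesis
    unfolding slit_log_def[abs_def] using assms
    by (auto intro!: derivative_eq_intros simp: mem_slit_plane_iff field_simps)
qed

lemma slit_log_holomorphic: "slit_log \<phi> holomorphic_on slit_plane \<phi>"
  by (meson field_differentiable_at_within field_differentiable_def holomorphic_on_def
      slit_log_has_field_derivative)

lemma exp_slit_log:
  assumes "z \<noteq> 0"
  shows "exp (slit_log \<phi> z) = z"
proof -
  have "exp (slit_log \<phi> z) = z * cis (pi - \<phi>) * cis (\<phi> - pi)"
    using assms by (simp add: slit_log_def exp_add cis_conv_exp)
  also have "\<dots> = z" by (simp add: cis_mult mult.assoc)
  finally show ?thesis .
qed

text \<open>The integrand is exp(-z) z^(-r) for the chosen branch; it has a primitive because the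
  slit plane is starlike. Holomorphy in the end point z is then visible, which it is not from the
  path integral.\<close>

lemma slit_plane_integrand_primitive:
  obtains G where "\<And>z. z \<in> slit_plane \<phi> \<Longrightarrow>
      (G has_field_derivative exp (- z - r * slit_log \<phi> z)) (at z)"
    and "\<And>z. z \<in> slit_plane \<phi> \<Longrightarrow> contour_integral (linepath (- cis \<phi>) z)
      (\<lambda>\<zeta>. exp (- \<zeta> - r * slit_log \<phi> \<zeta>)) = G z - G (- cis \<phi>)"
proof -
  let ?k = "\<lambda>\<zeta>. exp (- \<zeta> - r * slit_log \<phi> \<zeta>)"
  have hol: "?k holomorphic_on slit_plane \<phi>"
    by (intro holomorphic_intros slit_log_holomorphic)
  have "\<exists>G. \<forall>z\<in>slit_plane \<phi>. (G has_field_derivative ?k z) (at z)"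
    using hol open_slit_plane
    by (intro holomorphic_starlike_primitive[where k = "{}"] starlike_slit_plane)
      (auto intro!: holomorphic_on_imp_continuous_on simp: holomorphic_on_open field_differentiable_def)
  then obtain G where G: "\<And>z. z \<in> slit_plane \<phi> \<Longrightarrow> (G has_field_derivative ?k z) (at z)"
    by blast
  have "contour_integral (linepath (- cis \<phi>) z) ?k = G z - G (- cis \<phi>)"
    if "z \<in> slit_plane \<phi>" for z
  proof -
    have "(?k has_contour_integral (G (pathfinish (linepath (- cis \<phi>) z))
        - G (pathstart (linepath (- cis \<phi>) z)))) (linepath (- cis \<phi>) z)"
      using G closed_segment_subset_slit_plane[OF that]
      by (intro contour_integral_primitive[where S = "slit_plane \<phi>"])
        (auto intro: has_field_derivative_at_within)
    then show ?thesis by (simp add: contour_integral_unique)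
  qed
  with G show ?thesis using that by blast
qed

lemma E_path_holomorphic: "E_path \<phi> r holomorphic_on slit_plane \<phi>"
proof -
  obtain G where G: "\<And>z. z \<in> slit_plane \<phi> \<Longrightarrow>
      (G has_field_derivative exp (- z - r * slit_log \<phi> z)) (at z)"
    "\<And>z. z \<in> slit_plane \<phi> \<Longrightarrow> contour_integral (linepath (- cis \<phi>) z)
      (\<lambda>\<zeta>. exp (- \<zeta> - r * slit_log \<phi> \<zeta>)) = G z - G (- cis \<phi>)"
    by (rule slit_plane_integrand_primitive[of \<phi> r]) blast
  have "G holomorphic_on slit_plane \<phi>"
    using G(1) by (auto simp: holomorphic_on_open[OF open_slit_plane])
  then have "(\<lambda>z. exp ((r - 1) * slit_log \<phi> z) *
     (exp ((1 - r) * slit_log \<phi> (- cis \<phi>)) * E_int r (- cis \<phi>) - (G z - G (- cis \<phi>))))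
     holomorphic_on slit_plane \<phi>"
    by (intro holomorphic_intros slit_log_holomorphic)
  then show ?thesis
    by (rule holomorphic_transform) (simp add: E_path_def G(2))
qed

text \<open>The differential equation says that z^(1-r) E_r(z) has derivative -z^(-r) exp(-z), so
  adding the primitive G gives a constant \<open>h\<close> on the right half-plane.
  \<open>E_path\<close> is this relation solved for E_r(z); its base point
  \<open>- cis \<phi>\<close> is in that half-plane because cos \<phi> < 0.\<close>

lemma E_path_eq_E_int:
  assumes "cos \<phi> < 0" "Re z > 0"
  shows "E_path \<phi> r z = E_int r z"
proof -
  obtain G where G: "\<And>z. z \<in> slit_plane \<phi> \<Longrightarrow>
      (G has_field_derivative exp (- z - r * slit_log \<phi> z)) (at z)"
    "\<And>z. z \<in> slit_plane \<phi> \<Longrightarrow> contour_integral (linepath (- cis \<phi>) z)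
      (\<lambda>\<zeta>. exp (- \<zeta> - r * slit_log \<phi> \<zeta>)) = G z - G (- cis \<phi>)"
    by (rule slit_plane_integrand_primitive[of \<phi> r]) blast
  define h where "h z = exp ((1 - r) * slit_log \<phi> z) * E_int r z + G z" for z
  have slit: "z \<in> slit_plane \<phi>" if "Re z > 0" for z
    using right_half_plane_subset_slit_plane[OF assms(1)] that by auto
  have "(h has_field_derivative 0) (at z)" if z: "Re z > 0" for z
  proof -
    have nz: "z \<noteq> 0" using z by auto
    have e: "exp ((1 - r) * slit_log \<phi> z) = z * exp (- r * slit_log \<phi> z)"
      using exp_slit_log[OF nz, of \<phi>] by (simp add: left_diff_distrib exp_diff exp_minus field_simps)
    have "(h has_field_derivative exp ((1 - r) * slit_log \<phi> z) * ((1 - r) * (1 / z)) * E_int r z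
        + - E_int (r - 1) z * exp ((1 - r) * slit_log \<phi> z) + exp (- z - r * slit_log \<phi> z)) (at z)"
      unfolding h_def[abs_def]
      by (intro DERIV_add DERIV_mult DERIV_fun_exp DERIV_cmult slit_log_has_field_derivative slit
          E_int_has_field_derivative G z)
    also have "exp ((1 - r) * slit_log \<phi> z) * ((1 - r) * (1 / z)) * E_int r z
        + - E_int (r - 1) z * exp ((1 - r) * slit_log \<phi> z) + exp (- z - r * slit_log \<phi> z)
        = exp (- r * slit_log \<phi> z) * ((1 - r) * E_int r z - z * E_int (r - 1) z + exp (- z))"
      using nz unfolding e by (simp add: field_simps exp_diff exp_minus)
    also have "\<dots> = 0"
      using E_int_recurrence[OF z, of r] by (simp add: algebra_simps)
    finally show ?thesis .
  qed
  then have "h constant_on {z. Re z > 0}"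
    by (intro has_field_derivative_0_imp_constant_on)
      (auto intro: convex_connected convex_halfspace_Re_gt open_halfspace_Re_gt)
  then have "h z = h (- cis \<phi>)"
    using assms by (auto simp: constant_on_def)
  then have "exp ((1 - r) * slit_log \<phi> (- cis \<phi>)) * E_int r (- cis \<phi>) - (G z - G (- cis \<phi>))
      = exp ((1 - r) * slit_log \<phi> z) * E_int r z"
    by (simp add: h_def algebra_simps)
  then have "E_path \<phi> r z = exp ((r - 1) * slit_log \<phi> z) * (exp ((1 - r) * slit_log \<phi> z) * E_int r z)"
    using G(2)[OF slit[OF assms(2)]] by (simp add: E_path_def)
  also have "\<dots> = exp ((r - 1) * slit_log \<phi> z + (1 - r) * slit_log \<phi> z) * E_int r z"
    by (simp add: exp_add)
  finally show ?thesis by (simp add: algebra_simps)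
qed

text \<open>By the identity theorem the description in \<open>E_cont\<close> determines its value:
  the slit plane is connected, and cos \<phi> < 0 puts the right half-plane inside it.\<close>

lemma E_cont_eqI:
  assumes "cos \<phi> < 0" "F holomorphic_on slit_plane \<phi>"
    "\<And>z. Re z > 0 \<Longrightarrow> F z = E_int r z" "z \<in> slit_plane \<phi>"
  shows "E_cont \<phi> r z = F z"
  unfolding E_cont_def
proof (rule the_equality)
  fix w assume "\<exists>G. G holomorphic_on slit_plane \<phi> \<and> (\<forall>z'. 0 < Re z' \<longrightarrow> G z' = E_int r z') \<and> w = G z"
  then obtain G where G: "G holomorphic_on slit_plane \<phi>" "\<And>z'. 0 < Re z' \<Longrightarrow> G z' = E_int r z'" "w = G z"
    by blast
  have "G z = F z"
  proof (rule analytic_continuation_open[of "{z. Re z > 0}" "slit_plane \<phi>" G F])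
    show "{z. Re z > 0} \<noteq> {}" by (auto intro: exI[of _ 1])
  qed (use assms G right_half_plane_subset_slit_plane[of \<phi>] in
      \<open>auto simp: open_slit_plane open_halfspace_Re_gt starlike_slit_plane starlike_imp_connected\<close>)
  with G show "w = F z" by simp
qed (use assms in blast)

lemma E_cont_eq_E_path:
  assumes "cos \<phi> < 0" "z \<in> slit_plane \<phi>"
  shows "E_cont \<phi> r z = E_path \<phi> r z"
  using assms by (intro E_cont_eqI E_path_holomorphic E_path_eq_E_int)

lemma E_cont_holomorphic:
  assumes "cos \<phi> < 0"
  shows "E_cont \<phi> r holomorphic_on slit_plane \<phi>"
  using E_path_holomorphic by (rule holomorphic_transform) (simp add: E_cont_eq_E_path assms)

lemma E_cont_eq_E_int:
  assumes "cos \<phi> < 0" "Re z > 0"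
  shows "E_cont \<phi> r z = E_int r z"
  using assms right_half_plane_subset_slit_plane[of \<phi>]
  by (subst E_cont_eq_E_path) (auto simp: E_path_eq_E_int)

text \<open>For fixed z the order enters \<open>E_path\<close> through exponentials, through
  \<open>E_int\<close> at the base point, where the convergent integral is already known to be
  holomorphic in the order, and through an integral over a fixed segment, to which the Leibniz rule
  applies.\<close>

lemma E_cont_holomorphic_order:
  assumes "cos \<phi> < 0" "z \<in> slit_plane \<phi>"
  shows "(\<lambda>s. E_cont \<phi> (r + s) z) holomorphic_on ball 0 1"
proof -
  let ?p = "- cis \<phi>"
  let ?g = "\<lambda>s t. exp (- linepath ?p z t - (r + s) * slit_log \<phi> (linepath ?p z t)) * (z - ?p)"
  let ?g' = "\<lambda>s t. - slit_log \<phi> (linepath ?p z t) * ?g s t"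
  \<comment> \<open>The parameter is composed with an arbitrary map h so that the same fact covers
    functions of t alone and of the pair (s, t).\<close>
  have cont: "continuous_on A (\<lambda>x. slit_log \<phi> (linepath ?p z (h x)))"
    if "continuous_on A h" "h ` A \<subseteq> {0..1}" for A :: "'a::topological_space set" and h
  proof (rule continuous_on_compose2[OF holomorphic_on_imp_continuous_on[OF slit_log_holomorphic]])
    show "(\<lambda>x. linepath ?p z (h x)) ` A \<subseteq> slit_plane \<phi>"
      using closed_segment_subset_slit_plane[OF assms(2)] that(2)
      by (auto simp: image_subset_iff linepath_in_path)
  qed (use that in \<open>auto simp: linepath_def intro!: continuous_intros\<close>)
  have "(\<lambda>s. integral (cbox 0 1) (?g s)) holomorphic_on ball 0 1"
  proof (rule leibniz_rule_holomorphic)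
    show "((\<lambda>s. ?g s t) has_field_derivative ?g' s t) (at s within ball 0 1)" for s t
      by (auto intro!: derivative_eq_intros)
    show "?g s integrable_on cbox 0 1" for s
      by (intro integrable_continuous continuous_intros cont) (auto simp: linepath_def intro!: continuous_intros)
    show "continuous_on (ball 0 1 \<times> cbox 0 1) (\<lambda>(s, t). ?g' s t)"
      unfolding split_def
      by (intro continuous_intros cont) (auto simp: linepath_def intro!: continuous_intros)
  qed auto
  then have "(\<lambda>s. exp ((r + s - 1) * slit_log \<phi> z) *
     (exp ((1 - (r + s)) * slit_log \<phi> ?p) * E_int (r + s) ?p - integral (cbox 0 1) (?g s)))
       holomorphic_on ball 0 1"
    using assms by (intro holomorphic_intros E_int_holomorphic_order) auto
  then show ?thesis
    by (rule holomorphic_transform)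
      (simp add: E_cont_eq_E_path assms E_path_def contour_integral_integral mult.commute)
qed

section \<open>Dependence of the continuation on the angle of the slit\<close>

text \<open>Turning counterclockwise from the ray at the larger angle b, the half-plane
  \<open>H\<close> sweeps the arguments between b and b + pi. It avoids both slits, contains the
  negative axis as b < pi, and still meets the right half-plane as b > pi/2, where both
  continuations equal \<open>E_int\<close>.\<close>

lemma E_cont_same_side:
  assumes "\<phi> \<in> {pi/2<..<pi}" "\<phi>' \<in> {pi/2<..<pi}" "x > 0"
  shows "E_cont \<phi> r (- of_real x) = E_cont \<phi>' r (- of_real x)"
proof -
  define b where "b = max \<phi> \<phi>'"
  define H where "H = {z. Im (z * cis (- b)) > 0}"
  have b: "pi/2 < b" "b < pi" using assms by (auto simp: b_def)
  have cosneg: "cos \<theta> < 0" if "\<theta> \<in> {pi/2<..<pi}" for \<theta>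
    using that cos_lt_zero_pi[of \<theta>] by auto
  have H: "H = {z. cos b * Im z > sin b * Re z}"
    by (auto simp: H_def algebra_simps)
  have sub: "H \<subseteq> slit_plane \<theta>" if "\<theta> \<in> {pi/2<..<pi}" "\<theta> \<le> b" for \<theta>
  proof
    fix z assume z: "z \<in> H"
    show "z \<in> slit_plane \<theta>"
      unfolding slit_plane_def
    proof safe
      fix x assume "z = of_real x * cis \<theta>" "x \<ge> 0"
      then have "Im (z * cis (- b)) = x * sin (\<theta> - b)"
        by (simp add: sin_diff algebra_simps)
      moreover have "sin (b - \<theta>) \<ge> 0" using that b by (intro sin_ge_zero) auto
      then have "sin (\<theta> - b) \<le> 0" using sin_minus[of "b - \<theta>"] by simp
      ultimately have "Im (z * cis (- b)) \<le> 0"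
        using \<open>x \<ge> 0\<close> by (simp only: mult_nonneg_nonpos)
      with z show False by (simp add: H_def)
    qed
  qed
  have "H = {z. Complex (- sin b) (cos b) \<bullet> z > 0}"
    by (auto simp: H inner_complex_def)
  then have opn: "open H" and conv: "convex H"
    by (simp_all add: open_halfspace_gt convex_halfspace_gt)
  show ?thesis
  proof (rule analytic_continuation_open[of "H \<inter> {z. Re z > 0}" H "E_cont \<phi> r" "E_cont \<phi>' r"])
    have "- cos b > 0" "sin b > 0" using cosneg[of b] b by (auto intro: sin_gt_zero)
    \<comment> \<open>The point \<open>- cis b\<close> has positive real part but lies on the
      boundary line of \<open>H\<close>; doubling its negative imaginary part pushes it
      inside.\<close>
    then have "Complex (- cos b) (- 2 * sin b) \<in> H"
      by (simp add: H algebra_simps)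
    with \<open>- cos b > 0\<close> have "Complex (- cos b) (- 2 * sin b) \<in> H \<inter> {z. Re z > 0}" by simp
    then show "H \<inter> {z. Re z > 0} \<noteq> {}" by blast
    show "- of_real x \<in> H" using \<open>x > 0\<close> \<open>sin b > 0\<close> by (simp add: H)
    show "E_cont \<phi> r holomorphic_on H" "E_cont \<phi>' r holomorphic_on H"
      using assms cosneg sub[of \<phi>] sub[of \<phi>']
      by (simp_all add: holomorphic_on_subset[OF E_cont_holomorphic] b_def)
  qed (use assms cosneg opn conv in
      \<open>auto simp: E_cont_eq_E_int open_halfspace_Re_gt intro: convex_connected\<close>)
qed

lemma cnj_E_int: "cnj (E_int (of_real r) z) = E_int (of_real r) (cnj z)"
  unfolding E_int_def
  by (subst integral_cnj) (auto intro!: integral_cong simp: exp_cnj cnj_powr)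

text \<open>Schwarz reflection. Conjugation exchanges the slits at \<phi> and 2 pi - \<phi>, and as
  r is real it commutes with the defining integral, so the conjugated function is the other
  continuation.\<close>

lemma E_cont_reflect:
  assumes "cos \<phi> < 0" "z \<in> slit_plane \<phi>"
  shows "E_cont (2 * pi - \<phi>) (of_real r) (cnj z) = cnj (E_cont \<phi> (of_real r) z)"
proof -
  have iff: "cnj z \<in> slit_plane \<phi> \<longleftrightarrow> z \<in> slit_plane (2 * pi - \<phi>)" for z
  proof -
    have "cnj z = of_real x * cis \<phi> \<longleftrightarrow> z = of_real x * cis (2 * pi - \<phi>)" for x
      by (auto simp: complex_eq_iff cos_diff sin_diff)
    then show ?thesis by (auto simp: slit_plane_def)
  qed
  have "E_cont (2 * pi - \<phi>) (of_real r) (cnj z) = (cnj \<circ> E_cont \<phi> (of_real r) \<circ> cnj) (cnj z)"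
  proof (rule E_cont_eqI)
    have "cnj ` slit_plane (2 * pi - \<phi>) = slit_plane \<phi>"
      using iff[of "cnj _"] by (force simp: image_iff)
    then show "(cnj \<circ> E_cont \<phi> (of_real r) \<circ> cnj) holomorphic_on slit_plane (2 * pi - \<phi>)"
      using E_cont_holomorphic[OF assms(1)]
      by (subst holomorphic_on_compose_cnj_cnj) (auto simp: open_slit_plane)
  qed (use assms iff[of "cnj z"] in \<open>auto simp: E_cont_eq_E_int cnj_E_int cos_diff\<close>)
  then show ?thesis by simp
qed

lemma Re_E_cont_angle_independent:
  assumes "\<phi> \<in> admissible_angles" "\<phi>' \<in> admissible_angles" "x > 0"
  shows "Re (E_cont \<phi> (of_real r) (- of_real x)) = Re (E_cont \<phi>' (of_real r) (- of_real x))"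
proof -
  have *: "\<exists>\<theta>\<in>{pi/2<..<pi}. Re (E_cont \<phi> (of_real r) (- of_real x)) = Re (E_cont \<theta> (of_real r) (- of_real x))"
    if \<phi>: "\<phi> \<in> admissible_angles" for \<phi>
  proof (cases "\<phi> < pi")
    \<comment> \<open>Angles above pi are reflected into the second quadrant. The point is real, so
      the reflection only conjugates the value and keeps its real part.\<close>
    case False
    then have "2 * pi - \<phi> \<in> {pi/2<..<pi}" using \<phi> by (auto simp: admissible_angles_def)
    then have c: "cos (2 * pi - \<phi>) < 0"
      using cos_lt_zero_pi[of "2 * pi - \<phi>"] by auto
    have "- of_real x \<in> slit_plane (2 * pi - \<phi>)"
    proof -
      have "- of_real x \<noteq> of_real y * cis (2 * pi - \<phi>)" if "y \<ge> 0" for y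
      proof -
        have "sin (2 * pi - \<phi>) > 0"
          using \<open>2 * pi - \<phi> \<in> _\<close> by (intro sin_gt_zero) auto
        then show ?thesis using \<open>x > 0\<close> by (auto simp: complex_eq_iff)
      qed
      then show ?thesis unfolding slit_plane_def by blast
    qed
    from E_cont_reflect[OF c this, of r] show ?thesis
      using \<open>2 * pi - \<phi> \<in> _\<close> by (intro bexI[of _ "2 * pi - \<phi>"]) auto
  qed (use \<phi> in \<open>auto simp: admissible_angles_def\<close>)
  from *[OF assms(1)] *[OF assms(2)] show ?thesis
    using E_cont_same_side[OF _ _ assms(3)] by metis
qed

lemma cos_admissible_neg:
  assumes "\<phi> \<in> admissible_angles"
  shows "cos \<phi> < 0"
proof -
  have "cos (\<phi> - pi) > 0"
    using assms by (intro cos_gt_zero_pi) (auto simp: admissible_angles_def)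
  then show ?thesis by simp
qed

lemma negative_real_in_slit_plane:
  assumes "\<phi> \<in> admissible_angles" "x > 0"
  shows "- of_real x \<in> slit_plane \<phi>"
proof -
  have "sin (\<phi> - pi) \<noteq> 0"
    using assms sin_gt_zero[of "\<phi> - pi"] sin_gt_zero[of "pi - \<phi>"]
    by (cases "\<phi> > pi") (auto simp: admissible_angles_def)
  then have "sin \<phi> \<noteq> 0" by simp
  then have "- of_real x \<noteq> of_real y * cis \<phi>" for y
    using assms(2) by (auto simp: complex_eq_iff)
  then show ?thesis unfolding slit_plane_def by blast
qed

section \<open>Hermitian spaces\<close>

lemma herm_0_left [simp]: "herm 0 y = 0"
  using herm_add_left[of 0 0 y] by simp

lemma scaleC_0_left [simp]: "0 *\<^sub>C x = (0::'v::hermitian_space)"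
  using scaleC_of_real[of 0 x] by simp

lemma scaleC_1 [simp]: "1 *\<^sub>C x = (x::'v::hermitian_space)"
  using scaleC_of_real[of 1 x] by simp

lemma scaleC_0_right [simp]: "a *\<^sub>C (0::'v::hermitian_space) = 0"
  using scaleC_add_right[of a 0 0] by simp

lemma scaleC_minus1: "(- 1) *\<^sub>C x = - (x::'v::hermitian_space)"
  using scaleC_of_real[of "-1" x] by simp

lemma herm_minus_left [simp]: "herm (- x) y = - herm x y"
  using herm_scaleC_left[of "-1" x y] by (simp add: scaleC_minus1)

lemma herm_diff_left: "herm (x - y) z = herm x z - herm y z"
  using herm_add_left[of x "- y" z] by simp

lemma herm_sum_left: "herm (\<Sum>i\<in>A. x i) y = (\<Sum>i\<in>A. herm (x i) y)"
  by (induction A rule: infinite_finite_induct) (auto simp: herm_add_left)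

lemma herm_scaleC_right: "herm x (a *\<^sub>C y) = cnj a * herm x y"
  by (subst herm_commute) (simp add: herm_scaleC_left herm_commute[of x y])

lemma herm_diff_right: "herm x (y - z) = herm x y - herm x z"
  by (subst herm_commute) (simp add: herm_diff_left herm_commute[of x y] herm_commute[of x z])

lemma herm_sum_right: "herm x (\<Sum>i\<in>A. y i) = (\<Sum>i\<in>A. herm x (y i))"
  by (subst herm_commute) (simp add: herm_sum_left herm_commute[of x])

lemma scaleC_sum_left: "(\<Sum>i\<in>A. a i) *\<^sub>C x = (\<Sum>i\<in>A. a i *\<^sub>C (x::'v::hermitian_space))"
  by (induction A rule: infinite_finite_induct) (auto simp: scaleC_add_left)

lemma scaleC_sum_right: "a *\<^sub>C (\<Sum>i\<in>A. x i) = (\<Sum>i\<in>A. a *\<^sub>C (x i::'v::hermitian_space))"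
  by (induction A rule: infinite_finite_induct) (auto simp: scaleC_add_right)

text \<open>The class provides homogeneity of the norm for real scalars only; for complex ones it
  comes from \<open>herm_self\<close>.\<close>

lemma norm_scaleC: "norm (a *\<^sub>C x) = cmod a * norm (x::'v::hermitian_space)"
proof -
  have "herm (a *\<^sub>C x) (a *\<^sub>C x) = (a * cnj a) * herm x x"
    by (simp add: herm_scaleC_left herm_scaleC_right)
  then have "complex_of_real ((norm (a *\<^sub>C x))\<^sup>2) = of_real ((cmod a * norm x)\<^sup>2)"
    unfolding herm_self complex_norm_square[symmetric] by (simp add: power_mult_distrib)
  then have "(norm (a *\<^sub>C x))\<^sup>2 = (cmod a * norm x)\<^sup>2" by (simp only: of_real_eq_iff)
  then show ?thesis by (simp add: power2_eq_iff_nonneg)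
qed

text \<open>Cauchy-Schwarz: a y is the orthogonal projection of x to the line of y, and the squared
  norm of x - a y is nonnegative.\<close>

lemma norm_herm_le: "cmod (herm x y) \<le> norm x * norm y"
proof (cases "y = 0")
  case True
  then show ?thesis using herm_commute[of 0 x] by simp
next
  case False
  define a where "a = herm x y / of_real ((norm y)\<^sup>2)"
  have ny: "norm y \<noteq> 0" using False by simp
  have "of_real ((norm (x - a *\<^sub>C y))\<^sup>2) = herm (x - a *\<^sub>C y) x - cnj a * herm (x - a *\<^sub>C y) y"
    unfolding herm_self[symmetric] by (simp only: herm_diff_right herm_scaleC_right)
  also have "herm (x - a *\<^sub>C y) y = 0"
    using ny by (simp add: herm_diff_left herm_scaleC_left herm_self a_def)
  also have "herm (x - a *\<^sub>C y) x = of_real ((norm x)\<^sup>2) - of_real ((cmod (herm x y))\<^sup>2 / (norm y)\<^sup>2)"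
    by (simp add: herm_diff_left herm_scaleC_left herm_self a_def herm_commute[of y x]
        complex_norm_square del: of_real_power)
  finally have "complex_of_real ((norm (x - a *\<^sub>C y))\<^sup>2) = of_real ((norm x)\<^sup>2 - (cmod (herm x y))\<^sup>2 / (norm y)\<^sup>2)"
    by simp
  then have "(norm (x - a *\<^sub>C y))\<^sup>2 = (norm x)\<^sup>2 - (cmod (herm x y))\<^sup>2 / (norm y)\<^sup>2"
    by (simp only: of_real_eq_iff)
  then have "(norm x)\<^sup>2 - (cmod (herm x y))\<^sup>2 / (norm y)\<^sup>2 \<ge> 0"
    by (metis zero_le_power2)
  then have "(cmod (herm x y))\<^sup>2 \<le> (norm x * norm y)\<^sup>2"
    using ny by (simp add: field_simps power_mult_distrib)
  then show ?thesis by (rule power2_le_imp_le) simp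
qed

lemma bounded_linear_herm_left: "bounded_linear (\<lambda>x. herm x y)"
proof (rule bounded_linear_intro[where K = "norm y"])
  show "herm (r *\<^sub>R x) y = r *\<^sub>R herm x y" for r x
    using herm_scaleC_left[of "of_real r" x y] by (simp add: scaleC_of_real scaleR_conv_of_real)
qed (auto simp: herm_add_left norm_herm_le)

lemma bounded_linear_scaleC_left: "bounded_linear (\<lambda>a. a *\<^sub>C (x::'v::hermitian_space))"
proof (rule bounded_linear_intro[where K = "norm x"])
  show "(r *\<^sub>R a) *\<^sub>C x = r *\<^sub>R a *\<^sub>C x" for r a
    by (simp add: scaleC_of_real[symmetric] scaleC_scaleC scaleR_conv_of_real)
qed (auto simp: scaleC_add_left norm_scaleC)

section \<open>Orthonormal bases\<close>

definition orthonormal_basis :: "'v::hermitian_space set \<Rightarrow> bool" where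
  "orthonormal_basis E \<longleftrightarrow> finite E \<and> (\<forall>e\<in>E. \<forall>e'\<in>E. herm e e' = (if e = e' then 1 else 0))
     \<and> (\<forall>x. x = (\<Sum>e\<in>E. herm x e *\<^sub>C e))"

text \<open>Gram-Schmidt as an induction on B: a nonzero residue of the new vector, normalised,
  joins the system. Vectors treated earlier are combinations of the old system, hence orthogonal to
  the new member, and their expansions survive.\<close>

lemma orthonormal_extend:
  fixes E :: "'v::hermitian_space set"
  assumes "finite E" "\<forall>e\<in>E. \<forall>e'\<in>E. herm e e' = (if e = e' then 1 else 0)" "finite B"
  shows "\<exists>E'. finite E' \<and> E \<subseteq> E' \<and> (\<forall>e\<in>E'. \<forall>e'\<in>E'. herm e e' = (if e = e' then 1 else 0))
     \<and> (\<forall>b\<in>B. b = (\<Sum>e\<in>E'. herm b e *\<^sub>C e))"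
  using assms(3)
proof (induction B rule: finite_induct)
  case empty
  then show ?case using assms by blast
next
  case (insert b B)
  then obtain E' where E': "finite E'" "E \<subseteq> E'"
    and on: "\<And>e e'. e \<in> E' \<Longrightarrow> e' \<in> E' \<Longrightarrow> herm e e' = (if e = e' then 1 else 0)"
    and B: "\<And>b. b \<in> B \<Longrightarrow> b = (\<Sum>e\<in>E'. herm b e *\<^sub>C e)"
    by blast
  define r where "r = b - (\<Sum>e\<in>E'. herm b e *\<^sub>C e)"
  show ?case
  proof (cases "r = 0")
    case True
    then show ?thesis using E' on B by (intro exI[of _ E']) (auto simp: r_def)
  next
    case False
    define u where "u = of_real (1 / norm r) *\<^sub>C r"
    have re: "herm r e = 0" if "e \<in> E'" for e
    proof -
      have "herm r e = herm b e - (\<Sum>e'\<in>E'. herm b e' * (if e' = e then 1 else 0))"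
        by (simp add: r_def herm_diff_left herm_sum_left herm_scaleC_left on that)
      also have "(\<Sum>e'\<in>E'. herm b e' * (if e' = e then 1 else 0)) = (\<Sum>e'\<in>E'. if e' = e then herm b e' else 0)"
        by (intro sum.cong) auto
      also have "\<dots> = herm b e" using E' that by simp
      finally show ?thesis by simp
    qed
    have ue: "herm u e = 0" "herm e u = 0" if "e \<in> E'" for e
      using re[OF that] herm_commute[of e r] by (auto simp: u_def herm_scaleC_left herm_scaleC_right)
    have uu: "herm u u = 1"
      using False by (simp add: u_def herm_self norm_scaleC norm_divide)
    have "u \<notin> E'" using ue uu by force
    have "b = r + (\<Sum>e\<in>E'. herm b e *\<^sub>C e)" by (simp add: r_def)
    also have "r = of_real (norm r) *\<^sub>C u"
      using False by (simp add: u_def scaleC_scaleC)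
    also have "of_real (norm r) = herm b u"
    proof -
      have "herm b u = herm (r + (\<Sum>e\<in>E'. herm b e *\<^sub>C e)) u" by (simp add: r_def)
      also have "\<dots> = herm r u"
        using ue by (simp add: herm_add_left herm_sum_left herm_scaleC_left)
      also have "\<dots> = of_real (norm r)"
        using False by (simp add: u_def herm_scaleC_right herm_self power2_eq_square)
      finally show ?thesis ..
    qed
    finally have b: "b = (\<Sum>e\<in>insert u E'. herm b e *\<^sub>C e)"
      using E' \<open>u \<notin> E'\<close> by simp
    have Bu: "b' = (\<Sum>e\<in>insert u E'. herm b' e *\<^sub>C e)" if "b' \<in> B" for b'
    proof -
      have "herm b' u = herm (\<Sum>e\<in>E'. herm b' e *\<^sub>C e) u"
        using B[OF that] by simp
      also have "\<dots> = 0" using ue by (simp add: herm_sum_left herm_scaleC_left)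
      finally show ?thesis
        using E' \<open>u \<notin> E'\<close> B[OF that] by simp
    qed
    have on': "\<forall>e\<in>insert u E'. \<forall>e'\<in>insert u E'. herm e e' = (if e = e' then 1 else 0)"
      using on ue uu \<open>u \<notin> E'\<close> by auto
    show ?thesis
      using E' on' b Bu by (intro exI[of _ "insert u E'"] conjI) blast+
  qed
qed

lemma orthonormal_basis_exists: "\<exists>E::'v::hermitian_space set. orthonormal_basis E"
proof -
  obtain B :: "'v set" where B: "finite B" "\<And>x. \<exists>c. x = (\<Sum>b\<in>B. c b *\<^sub>C b)"
    using finite_dimensional by blast
  obtain E where E: "finite E" "\<forall>e\<in>E. \<forall>e'\<in>E. herm e e' = (if e = e' then 1 else 0)"
    "\<And>b. b \<in> B \<Longrightarrow> b = (\<Sum>e\<in>E. herm b e *\<^sub>C e)"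
    using orthonormal_extend[of "{}" B] B(1) by auto
  have "x = (\<Sum>e\<in>E. herm x e *\<^sub>C e)" for x
  proof -
    obtain c where c: "x = (\<Sum>b\<in>B. c b *\<^sub>C b)" using B(2) by blast
    have "(\<Sum>e\<in>E. herm x e *\<^sub>C e) = (\<Sum>e\<in>E. \<Sum>b\<in>B. c b *\<^sub>C (herm b e *\<^sub>C e))"
      by (simp add: c herm_sum_left scaleC_sum_left herm_scaleC_left scaleC_scaleC)
    also have "\<dots> = (\<Sum>b\<in>B. c b *\<^sub>C (\<Sum>e\<in>E. herm b e *\<^sub>C e))"
      by (subst sum.swap) (simp add: scaleC_sum_right)
    also have "\<dots> = (\<Sum>b\<in>B. c b *\<^sub>C b)"
      by (intro sum.cong refl) (simp only: E(3)[symmetric])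
    also have "\<dots> = x" using c ..
    finally show ?thesis ..
  qed
  then show ?thesis using E(1,2) unfolding orthonormal_basis_def by blast
qed

lemma herm_orthonormal_basis:
  assumes "orthonormal_basis E"
  shows "herm x y = (\<Sum>e\<in>E. herm x e * cnj (herm y e))"
proof -
  have "y = (\<Sum>e\<in>E. herm y e *\<^sub>C e)" using assms unfolding orthonormal_basis_def by blast
  then have "herm x y = herm x (\<Sum>e\<in>E. herm y e *\<^sub>C e)" by (rule arg_cong)
  also have "\<dots> = (\<Sum>e\<in>E. herm x e * cnj (herm y e))"
    by (simp add: herm_sum_right herm_scaleC_right mult.commute)
  finally show ?thesis .
qed

lemma herm_eq_0_iff: "herm x x = 0 \<longleftrightarrow> x = 0"
  by (simp add: herm_self)

section \<open>Translations and a common period\<close>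

text \<open>The lift of the translation by n with root 1 of c \<tau> + d = 1, so that slashing with
  it involves no automorphy factor.\<close>

definition translation :: "int \<Rightarrow> (int^2^2) \<times> (complex \<Rightarrow> complex)" where
  "translation n = (vector [vector [1, n], vector [0, 1]], \<lambda>\<tau>\<in>\<bbbH>. 1)"

lemma translation_in_Mp2Z: "translation n \<in> carrier Mp2Z"
  by (auto simp: translation_def Mp2Z_def det_2 automorphy_def cong: holomorphic_cong)

lemma weakly_holomorphic_translation:
  assumes "unitary_representation \<rho>" "f \<in> weakly_holomorphic_forms k \<rho>" "\<tau> \<in> \<bbbH>"
  shows "f (\<tau> + of_int n) = \<rho> (translation n) (f \<tau>)"
proof -
  have "slash k \<rho> f (translation n) \<tau> = f \<tau>"
    using assms translation_in_Mp2Z by (auto simp: weakly_holomorphic_forms_def)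
  then have *: "inv_into UNIV (\<rho> (translation n)) (f (\<tau> + of_int n)) = f \<tau>"
    using assms(3) by (simp add: slash_def translation_def moebius_map_def)
  have "\<rho> (translation n) \<in> carrier Aut"
    using assms(1) translation_in_Mp2Z unfolding unitary_representation_def hom_def by auto
  then have "surj (\<rho> (translation n))" by (auto simp: Aut_def bij_def)
  then show ?thesis using * by (metis surj_f_inv_f)
qed

lemma herm_weakly_holomorphic_periodic:
  assumes "unitary_representation \<rho>" "f \<in> weakly_holomorphic_forms k \<rho>"
    "g \<in> weakly_holomorphic_forms k \<rho>" "\<tau> \<in> \<bbbH>"
  shows "herm (f (\<tau> + of_int n)) (g (\<tau> + of_int n)) = herm (f \<tau>) (g \<tau>)"
  using assms translation_in_Mp2Z
  by (simp add: weakly_holomorphic_translation unitary_representation_def)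

text \<open>Pigeonhole: two translations i < j lie in one of the finitely many cosets of N, on which
  rho is trivial, so rho takes the same value at both. Comparing f at the two translates of \<tau> -
  i gives the period j - i, which depends on rho alone and hence serves f and g together.\<close>

lemma weakly_holomorphic_common_period:
  fixes \<rho> :: "(int^2^2) \<times> (complex \<Rightarrow> complex) \<Rightarrow> 'v::hermitian_space \<Rightarrow> 'v"
  assumes "unitary_representation \<rho>" "factors_through_finite_quotient \<rho>"
  shows "\<exists>P::nat. P > 0 \<and> (\<forall>k. \<forall>f\<in>weakly_holomorphic_forms k \<rho>. \<forall>\<tau>\<in>\<bbbH>. f (\<tau> + of_nat P) = f \<tau>)"
proof -
  obtain N where N: "N \<lhd> Mp2Z" "finite (carrier (Mp2Z Mod N))" "\<And>\<gamma>. \<gamma> \<in> N \<Longrightarrow> \<rho> \<gamma> = id"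
    using assms(2) by (auto simp: factors_through_finite_quotient_def)
  interpret Mp: group Mp2Z by (rule group_Mp2Z)
  interpret N: normal N Mp2Z by (rule N(1))
  let ?c = "\<lambda>n::nat. N #>\<^bsub>Mp2Z\<^esub> translation (int n)"
  have "range ?c \<subseteq> carrier (Mp2Z Mod N)"
    using translation_in_Mp2Z by (auto simp: FactGroup_def RCOSETS_def)
  then have "finite (range ?c)" using N(2) finite_subset by blast
  then have "\<not> inj ?c" using finite_imageD infinite_UNIV_nat by blast
  then obtain i j where ij: "i < j" "?c i = ?c j"
    unfolding inj_def by (metis linorder_neqE_nat)
  have "translation (int j) \<in> N #>\<^bsub>Mp2Z\<^esub> translation (int i)"
    using Mp.rcos_self[OF translation_in_Mp2Z N.subgroup_axioms] ij by simp
  then obtain \<gamma> where \<gamma>: "\<gamma> \<in> N" "translation (int j) = \<gamma> \<otimes>\<^bsub>Mp2Z\<^esub> translation (int i)"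
    by (auto simp: r_coset_def)
  have "\<rho> (translation (int j)) = \<rho> \<gamma> \<otimes>\<^bsub>Aut\<^esub> \<rho> (translation (int i))"
    using assms(1) \<gamma> translation_in_Mp2Z N.subset
    by (auto simp: unitary_representation_def hom_def)
  then have \<rho>: "\<rho> (translation (int j)) = \<rho> (translation (int i))"
    using N(3)[OF \<gamma>(1)] by (simp add: Aut_def)
  show ?thesis
  proof (intro exI[of _ "j - i"] conjI allI ballI)
    fix f k \<tau> assume f: "f \<in> weakly_holomorphic_forms k \<rho>" and \<tau>: "\<tau> \<in> \<bbbH>"
    have \<tau>': "\<tau> - of_nat i \<in> \<bbbH>" using \<tau> by (simp add: upper_half_plane_def)
    have "f (\<tau> - of_nat i + of_int (int j)) = f (\<tau> - of_nat i + of_int (int i))"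
      unfolding weakly_holomorphic_translation[OF assms(1) f \<tau>'] \<rho> ..
    then show "f (\<tau> + of_nat (j - i)) = f \<tau>"
      using ij by (simp add: of_nat_diff algebra_simps)
  qed (use ij in simp)
qed

lemma holomorphic_herm:
  assumes "vector_holomorphic_on f \<bbbH>"
  shows "(\<lambda>\<tau>. herm (f \<tau>) e) holomorphic_on \<bbbH>"
  unfolding holomorphic_on_def field_differentiable_def
proof
  fix z assume "z \<in> \<bbbH>"
  then obtain D where D: "(f has_derivative (\<lambda>h. h *\<^sub>C D)) (at z within \<bbbH>)"
    using assms by (auto simp: vector_holomorphic_on_def)
  have "((\<lambda>\<tau>. herm (f \<tau>) e) has_derivative (\<lambda>h. herm (h *\<^sub>C D) e)) (at z within \<bbbH>)"
    by (rule bounded_linear.has_derivative[OF bounded_linear_herm_left D])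
  then show "\<exists>f'. ((\<lambda>\<tau>. herm (f \<tau>) e) has_field_derivative f') (at z within \<bbbH>)"
    by (intro exI[of _ "herm D e"])
      (simp add: has_field_derivative_def herm_scaleC_left mult_commute_abs)
qed

section \<open>Expansions of periodic functions at the cusp\<close>

lemma periodic_of_int:
  fixes F :: "complex \<Rightarrow> 'a" and P :: real
  assumes "\<And>\<tau>. \<tau> \<in> \<bbbH> \<Longrightarrow> F (\<tau> + of_real P) = F \<tau>" "\<tau> \<in> \<bbbH>"
  shows "F (\<tau> + of_int n * of_real P) = F \<tau>"
proof -
  have nat: "F (\<tau> + of_nat m * of_real P) = F \<tau>" if "\<tau> \<in> \<bbbH>" for \<tau> m
  proof (induction m)
    case (Suc m)
    have "\<tau> + of_nat m * of_real P \<in> \<bbbH>" using that by (simp add: upper_half_plane_def)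
    from assms(1)[OF this] Suc show ?case by (simp add: algebra_simps)
  qed simp
  show ?thesis
  proof (cases n rule: int_cases2)
    case (nonneg m)
    then show ?thesis using nat[OF assms(2)] by simp
  next
    case (nonpos m)
    have "\<tau> - of_nat m * of_real P \<in> \<bbbH>" using assms(2) by (simp add: upper_half_plane_def)
    from nat[OF this, of m] show ?thesis using nonpos by simp
  qed
qed

text \<open>F descends to a function of q = exp(2 pi i \<tau> / P) on the punctured unit disc. The
  growth bound says exactly that q^K F stays bounded near 0, so the singularity is removable and the
  Taylor series of the extension is the expansion.\<close>

lemma periodic_q_expansion:
  fixes F :: "complex \<Rightarrow> complex" and P v0 B :: real and K :: nat
  assumes "P > 0" and hol: "F holomorphic_on \<bbbH>"
    and per: "\<And>\<tau>. \<tau> \<in> \<bbbH> \<Longrightarrow> F (\<tau> + of_real P) = F \<tau>"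
    and bound: "\<And>\<tau>. Im \<tau> \<ge> v0 \<Longrightarrow> \<tau> \<in> \<bbbH> \<Longrightarrow> cmod (F \<tau>) \<le> B * exp (2 * pi * K / P * Im \<tau>)"
  shows "\<exists>a :: nat \<Rightarrow> complex. \<forall>\<tau>\<in>\<bbbH>. (\<lambda>m. a m * exp (2 * pi * \<i> * \<tau> / P) ^ m) sums (exp (2 * pi * \<i> * \<tau> / P) ^ K * F \<tau>)"
proof -
  \<comment> \<open>The inverse of \<tau> \<mapsto> 2 pi i \<tau> / P, so \<open>t (Ln q)\<close> is
    a preimage of q. By \<open>F_t\<close> the choice of logarithm does not affect F.\<close>
  define t where "t a = complex_of_real P * a / (2 * pi * \<i>)" for a
  have Im_t: "Im (t a) = - P * Re a / (2 * pi)" for a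
    by (simp add: t_def Im_divide power2_eq_square field_simps)
  have t_H: "t a \<in> \<bbbH>" if "Re a < 0" for a
    using that \<open>P > 0\<close> by (simp add: upper_half_plane_def Im_t field_simps mult_pos_neg)
  have F_t: "F (t a) = F (t b)" if "exp a = exp b" "Re a < 0" for a b
  proof -
    obtain n :: int where "a = b + of_int (2 * n) * pi * \<i>"
      using \<open>exp a = exp b\<close> by (auto simp: exp_eq)
    then have "t a = t b + of_int n * of_real P"
      by (simp add: t_def field_simps)
    moreover have "Re b < 0"
      using that by (metis exp_less_one_iff norm_exp_eq_Re)
    ultimately show ?thesis
      using periodic_of_int[of F P "t b" n] per t_H by auto
  qed
  define \<psi> where "\<psi> q = q ^ K * F (t (Ln q))" for q
  have Ln_neg: "Re (Ln q) < 0" if "q \<in> ball 0 1 - {0}" for q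
    using that by (simp add: Re_Ln)
  have "(\<lambda>q. F (t (Ln q))) field_differentiable at q0" if q0: "q0 \<in> ball 0 1 - {0}" for q0
  proof -
    \<comment> \<open>\<open>Ln\<close> jumps across its cut, so near q0 the branch
      \<open>?l\<close> is used instead. On this ball Re (q / q0) > 0, which keeps q / q0 off the
      cut.\<close>
    define S where "S = ball q0 (norm q0) \<inter> (ball 0 1 - {0})"
    let ?l = "\<lambda>q. Ln (q / q0) + Ln q0"
    have l: "exp (?l q) = q" "Re (?l q) < 0" "q / q0 \<notin> \<real>\<^sub>\<le>\<^sub>0" if "q \<in> S" for q
    proof -
      have nz: "q \<noteq> 0" "q0 \<noteq> 0" using that q0 by (auto simp: S_def)
      then show e: "exp (?l q) = q" by (simp add: exp_add)
      have "exp (Re (?l q)) = norm q" using e by (metis norm_exp_eq_Re)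
      then show "Re (?l q) < 0" using that by (metis DiffD1 IntD2 S_def dist_0_norm exp_less_one_iff mem_ball)
      have "norm (q - q0) < norm q0" using that by (simp add: S_def dist_norm norm_minus_commute)
      then have "norm (q / q0 - 1) < 1"
        using nz by (simp add: diff_divide_distrib[symmetric] norm_divide divide_simps flip: diff_divide_eq_iff)
      then have "Re (q / q0) > 0"
        using abs_Re_le_cmod[of "q / q0 - 1"] by simp
      then show "q / q0 \<notin> \<real>\<^sub>\<le>\<^sub>0" by (auto simp: complex_nonpos_Reals_iff)
    qed
    have "(\<lambda>q. F (t (?l q))) holomorphic_on S"
    proof (rule holomorphic_on_compose_gen[OF _ hol, unfolded o_def])
      show "(\<lambda>q. t (?l q)) holomorphic_on S"
        unfolding t_def using l by (intro holomorphic_intros) auto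
    qed (use l t_H in auto)
    then have "(\<lambda>q. F (t (Ln q))) holomorphic_on S"
    proof (rule holomorphic_transform)
      fix q assume "q \<in> S"
      then show "F (t (?l q)) = F (t (Ln q))"
        using l by (intro F_t) (auto simp: S_def)
    qed
    moreover have "open S" "q0 \<in> S" using q0 by (auto simp: S_def)
    ultimately show ?thesis
      using holomorphic_on_imp_differentiable_at by blast
  qed
  then have "\<psi> holomorphic_on ball 0 1 - {0}"
    unfolding \<psi>_def[abs_def]
    by (intro holomorphic_intros) (auto simp: holomorphic_on_def field_differentiable_at_within)
  moreover have "\<exists>B. eventually (\<lambda>q. norm (\<psi> q) \<le> B) (at 0)"
  proof (intro exI)
    \<comment> \<open>|q| below exp(-2 pi v0 / P) means height above v0, where the bound applies;
      the 1 keeps q in the disc.\<close>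
    define r where "r = min 1 (exp (- 2 * pi * v0 / P))"
    have "r > 0" by (simp add: r_def)
    then have "eventually (\<lambda>q. q \<in> ball 0 r - {0}) (at (0::complex))"
      by (intro eventually_at_in_open) auto
    then show "eventually (\<lambda>q. norm (\<psi> q) \<le> B) (at 0)"
    proof eventually_elim
      case (elim q)
      then have q: "q \<noteq> 0" "norm q < 1" "norm q < exp (- 2 * pi * v0 / P)" by (auto simp: r_def)
      then have "ln (norm q) < - 2 * pi * v0 / P"
        by (metis exp_less_mono exp_ln norm_eq_zero not_less_iff_gr_or_eq zero_less_norm_iff linorder_not_le)
      then have "Im (t (Ln q)) \<ge> v0"
        using \<open>P > 0\<close> q by (simp add: Im_t Re_Ln field_simps)
      moreover have "t (Ln q) \<in> \<bbbH>" using q by (intro t_H Ln_neg) auto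
      ultimately have "cmod (F (t (Ln q))) \<le> B * exp (2 * pi * K / P * Im (t (Ln q)))"
        by (intro bound) auto
      also have "2 * pi * K / P * Im (t (Ln q)) = - (real K * ln (norm q))"
        using \<open>P > 0\<close> q by (simp add: Im_t Re_Ln field_simps)
      also have "exp \<dots> = 1 / norm q ^ K"
        using q by (simp add: exp_minus exp_of_nat_mult divide_inverse)
      finally show ?case
        using q by (simp add: \<psi>_def norm_mult norm_power pos_le_divide_eq mult.commute)
    qed
  qed
  ultimately obtain g where g: "g holomorphic_on ball 0 1" "\<And>q. q \<in> ball 0 1 - {0} \<Longrightarrow> g q = \<psi> q"
    using holomorphic_on_extend_bounded[of \<psi> "ball 0 1" 0] by auto
  show ?thesis
  proof (intro exI ballI)
    fix \<tau> assume \<tau>: "\<tau> \<in> \<bbbH>"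
    let ?q = "exp (2 * pi * \<i> * \<tau> / P)"
    have q: "?q \<in> ball 0 1 - {0}"
    proof -
      have "cmod ?q = exp (- (2 * pi * Im \<tau> / P))" by simp
      also have "\<dots> < 1"
        using \<tau> \<open>P > 0\<close> by (simp add: upper_half_plane_def)
      finally show ?thesis by simp
    qed
    have "(\<lambda>m. (deriv ^^ m) g 0 / fact m * (?q - 0) ^ m) sums g ?q"
      by (rule holomorphic_power_series[OF g(1)]) (use q in simp)
    also have "g ?q = ?q ^ K * F (t (Ln ?q))"
      using g(2)[OF q] by (simp add: \<psi>_def)
    also have "F (t (Ln ?q)) = F (t (2 * pi * \<i> * \<tau> / P))"
      by (rule F_t) (use Ln_neg[OF q] in auto)
    also have "t (2 * pi * \<i> * \<tau> / P) = \<tau>"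
      using \<open>P > 0\<close> by (simp add: t_def)
    finally show "(\<lambda>m. (deriv ^^ m) g 0 / fact m * ?q ^ m) sums (?q ^ K * F \<tau>)"
      by simp
  qed
qed

text \<open>At half the height |q| is strictly larger, and a power series converging at one point
  converges absolutely at every point of smaller modulus.\<close>

lemma power_series_in_disc_summable:
  fixes a :: "nat \<Rightarrow> complex"
  assumes "\<And>\<tau>. \<tau> \<in> \<bbbH> \<Longrightarrow> summable (\<lambda>m. a m * exp (2 * pi * \<i> * \<tau> / P) ^ m)" "P > 0" "\<tau> \<in> \<bbbH>"
  shows "summable (\<lambda>m. norm (a m * exp (2 * pi * \<i> * \<tau> / of_real P) ^ m))"
proof -
  define \<tau>' where "\<tau>' = \<i> * of_real (Im \<tau> / 2)"
  have "\<tau>' \<in> \<bbbH>" using assms by (simp add: \<tau>'_def upper_half_plane_def)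
  show ?thesis
    by (rule powser_insidea[OF assms(1)[OF \<open>\<tau>' \<in> \<bbbH>\<close>]])
      (use assms in \<open>simp add: \<tau>'_def upper_half_plane_def field_simps\<close>)
qed

section \<open>Uniqueness and existence of Fourier coefficients\<close>

lemma has_sum_of_sums:
  fixes f :: "'i \<Rightarrow> 'a \<Rightarrow> 'b::{topological_comm_monoid_add}"
  assumes "\<And>i. i \<in> I \<Longrightarrow> (f i has_sum s i) A"
  shows "((\<lambda>x. \<Sum>i\<in>I. f i x) has_sum (\<Sum>i\<in>I. s i)) A"
  using assms by (induction I rule: infinite_finite_induct) (auto intro: has_sum_add)

text \<open>The geometric sum stays bounded by 2 / |z - 1|, whatever M is.\<close>

lemma unit_power_average_tendsto_0:
  fixes z :: complex
  assumes "norm z = 1" "z \<noteq> 1"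
  shows "(\<lambda>M. (\<Sum>m<M. z ^ m) / of_nat M) \<longlonglongrightarrow> 0"
proof (rule Lim_null_comparison)
  have "norm ((\<Sum>m<M. z ^ m) / of_nat M) \<le> (2 / norm (z - 1)) / of_nat M" for M
  proof -
    have "(\<Sum>m<M. z ^ m) = (z ^ M - 1) / (z - 1)"
      using assms by (simp add: geometric_sum)
    moreover have "norm (z ^ M - 1) \<le> 2"
      using norm_triangle_ineq4[of "z ^ M" 1] assms by (simp add: norm_power)
    ultimately show ?thesis
      by (simp add: norm_divide norm_mult divide_right_mono flip: divide_divide_eq_left)
  qed
  then show "\<forall>\<^sub>F M in sequentially. norm ((\<Sum>m<M. z ^ m) / of_nat M) \<le> (2 / norm (z - 1)) / of_nat M"
    by simp
  show "(\<lambda>M. (2 / norm (z - 1)) / of_nat M) \<longlonglongrightarrow> 0"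
    by (rule lim_const_over_n)
qed

text \<open>Sampling at the translates by multiples of an irrational \<open>x\<close> separates the rational frequencies.\<close>

lemma complex_of_real_of_rat: "complex_of_real (of_rat n) = of_rat n"
  by (cases n) (simp add: of_rat_rat)

lemma rational_frequencies_unique:
  fixes a :: "rat \<Rightarrow> complex"
  assumes "\<And>\<tau>. \<tau> \<in> \<bbbH> \<Longrightarrow> ((\<lambda>n. exp (2 * pi * \<i> * of_rat n * \<tau>) * a n) has_sum 0) UNIV"
  shows "a n0 = 0"
proof -
  \<comment> \<open>For rational n \<noteq> n0 the number (n - n0) x is irrational, hence no
    integer, and so \<open>z n\<close> is never 1 except at n0. One step x works for all
    denominators at once.\<close>
  obtain x :: real where x: "x \<notin> \<rat>"
    using countable_rat uncountable_UNIV_real by (metis UNIV_eq_I)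
  \<comment> \<open>\<open>b n\<close> is the term at \<tau> = i. Moving to i + m x multiplies it by
    a phase, which becomes \<open>z n ^ m\<close> after division by the phase of n0; the sum remains
    0 for every m.\<close>
  define b where "b n = exp (2 * pi * \<i> * of_rat n * \<i>) * a n" for n
  define z where "z n = exp (2 * pi * \<i> * (of_rat n - of_rat n0) * of_real x)" for n
  have norm_z: "norm (z n) = 1" for n
  proof -
    have "2 * pi * \<i> * (of_rat n - of_rat n0) * of_real x = \<i> * of_real (2 * pi * of_rat (n - n0) * x)"
      by (simp add: of_rat_diff complex_of_real_of_rat)
    then show ?thesis unfolding z_def by (simp only: norm_exp_i_times)
  qed
  have z_neq: "z n \<noteq> 1" if "n \<noteq> n0" for n
  proof
    assume "z n = 1"
    have eq: "2 * pi * \<i> * (of_rat n - of_rat n0) * of_real x = \<i> * of_real (2 * pi * of_rat (n - n0) * x)"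
      by (simp add: of_rat_diff complex_of_real_of_rat)
    from \<open>z n = 1\<close> obtain j :: int where "2 * pi * of_rat (n - n0) * x = of_int (2 * j) * pi"
      unfolding z_def eq exp_eq_1 by auto
    then have "x = of_int j / of_rat (n - n0)"
      using that by (simp add: field_simps)
    then have "x = of_rat (of_int j / (n - n0))"
      by (simp add: of_rat_divide)
    with x show False by simp
  qed
  have "(b has_sum 0) UNIV"
    using assms[of \<i>] by (simp add: b_def[abs_def] upper_half_plane_def)
  then have "b summable_on UNIV" by (auto simp: summable_on_def)
  then have int_b: "integrable (count_space UNIV) b"
    unfolding summable_on_iff_abs_summable_on_complex abs_summable_equivalent
    by (simp add: Infinite_Set_Sum.abs_summable_on_def)
  have int_bz: "integrable (count_space UNIV) (\<lambda>n. b n * z n ^ m)" for m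
    by (rule Bochner_Integration.integrable_bound[OF int_b]) (auto simp: norm_mult norm_power norm_z)
  have zero: "(LINT n|count_space UNIV. b n * z n ^ m) = 0" for m
  proof -
    have "((\<lambda>n. exp (2 * pi * \<i> * of_rat n * (\<i> + of_nat m * of_real x)) * a n) has_sum 0) UNIV"
      by (rule assms) (simp add: upper_half_plane_def)
    then have "((\<lambda>n. exp (- (2 * pi * \<i> * of_rat n0 * (of_nat m * of_real x))) *
        (exp (2 * pi * \<i> * of_rat n * (\<i> + of_nat m * of_real x)) * a n)) has_sum 0) UNIV"
      using has_sum_cmult_right by fastforce
    also have "(\<lambda>n. exp (- (2 * pi * \<i> * of_rat n0 * (of_nat m * of_real x))) *
        (exp (2 * pi * \<i> * of_rat n * (\<i> + of_nat m * of_real x)) * a n)) = (\<lambda>n. b n * z n ^ m)"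
    proof
      fix n
      have "- (2 * pi * \<i> * of_rat n0 * (of_nat m * of_real x)) + 2 * pi * \<i> * of_rat n * (\<i> + of_nat m * of_real x)
          = 2 * pi * \<i> * of_rat n * \<i> + of_nat m * (2 * pi * \<i> * (of_rat n - of_rat n0) * of_real x)"
        by (simp add: algebra_simps)
      then have "exp (- (2 * pi * \<i> * of_rat n0 * (of_nat m * of_real x))) *
          exp (2 * pi * \<i> * of_rat n * (\<i> + of_nat m * of_real x))
          = exp (2 * pi * \<i> * of_rat n * \<i>) * z n ^ m"
        unfolding z_def exp_of_nat_mult[symmetric] exp_add[symmetric] by (rule arg_cong)
      then show "exp (- (2 * pi * \<i> * of_rat n0 * (of_nat m * of_real x))) *
        (exp (2 * pi * \<i> * of_rat n * (\<i> + of_nat m * of_real x)) * a n) = b n * z n ^ m"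
        unfolding b_def mult.assoc[symmetric] by (simp add: mult_ac)
    qed
    finally have "infsum (\<lambda>n. b n * z n ^ m) UNIV = 0" by (rule infsumI)
    then show ?thesis
      using int_bz[of m] infsetsum_infsum[of "\<lambda>n. b n * z n ^ m" UNIV]
      by (simp add: infsetsum_def Infinite_Set_Sum.abs_summable_on_def)
  qed
  \<comment> \<open>Averaging over m < M kills every frequency but n0 in the limit. The averages are
    bounded by 1 and b is absolutely summable, so dominated convergence for the counting measure
    isolates \<open>b n0\<close>.\<close>
  define A where "A M n = (\<Sum>m<M. z n ^ m) / of_nat M" for M n
  have A_zero: "(LINT n|count_space UNIV. b n * A M n) = 0" for M
  proof -
    have "(LINT n|count_space UNIV. b n * A M n) = (LINT n|count_space UNIV. (\<Sum>m<M. b n * z n ^ m) / of_nat M)"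
      by (simp add: A_def sum_distrib_left)
    also have "\<dots> = (\<Sum>m<M. LINT n|count_space UNIV. b n * z n ^ m) / of_nat M"
      using int_bz by simp
    finally show ?thesis by (simp add: zero)
  qed
  have "(\<lambda>M. LINT n|count_space UNIV. b n * A M n)
      \<longlonglongrightarrow> (LINT n|count_space UNIV. b n * (if n = n0 then 1 else 0))"
  proof (rule integral_dominated_convergence)
    show "integrable (count_space UNIV) (\<lambda>n. norm (b n))" using int_b by simp
    have "(\<lambda>M. A M n) \<longlonglongrightarrow> (if n = n0 then 1 else 0)" for n
    proof (cases "n = n0")
      case True
      have "\<forall>\<^sub>F M in sequentially. A M n = 1"
        using eventually_gt_at_top[of 0] by eventually_elim (auto simp: A_def z_def True)
      then show ?thesis using True by (simp add: tendsto_eventually)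
    next
      case False
      then show ?thesis
        using unit_power_average_tendsto_0[OF norm_z z_neq] by (simp add: A_def)
    qed
    then show "AE n in count_space UNIV. (\<lambda>M. b n * A M n) \<longlonglongrightarrow> b n * (if n = n0 then 1 else 0)"
      by (intro AE_I2 tendsto_mult tendsto_const)
    have "norm (A M n) \<le> 1" for M n
    proof -
      have "norm (\<Sum>m<M. z n ^ m) \<le> of_nat M"
        using sum_norm_le[of "{..<M}" "\<lambda>m. z n ^ m" "\<lambda>_. 1"] by (simp add: norm_power norm_z)
      then show ?thesis by (cases "M = 0") (auto simp: A_def norm_divide)
    qed
    then show "AE n in count_space UNIV. norm (b n * A M n) \<le> norm (b n)" for M
      by (intro AE_I2) (simp add: norm_mult mult_left_le)
  qed auto
  then have "(LINT n|count_space UNIV. b n * (if n = n0 then 1 else 0)) = 0"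
    unfolding A_zero by (simp add: LIMSEQ_const_iff)
  also have "(LINT n|count_space UNIV. b n * (if n = n0 then 1 else 0))
      = (LINT n|count_space UNIV. indicator {n0} n *\<^sub>R b n)"
    by (intro Bochner_Integration.integral_cong) (auto simp: indicator_def)
  also have "\<dots> = b n0"
    by (subst lebesgue_integral_count_space_finite_support)
      (auto simp: indicator_def Collect_conv_if intro: finite_subset[of _ "{n0}"])
  finally show ?thesis by (simp add: b_def)
qed

text \<open>The exponent of q in the m-th term of a power series in q^(1/P) after multiplication by
  q^(-K/P); the shift by K makes room for the polar terms.\<close>

definition frac_index :: "nat \<Rightarrow> nat \<Rightarrow> nat \<Rightarrow> rat" where
  "frac_index P K m = (of_nat m - of_nat K) / of_nat P"

lemma inj_frac_index: "P > 0 \<Longrightarrow> inj (frac_index P K)"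
  by (auto simp: inj_def frac_index_def)

lemma of_rat_frac_index:
  "(of_rat (frac_index P K m) :: 'a::field_char_0) = (of_nat m - of_nat K) / of_nat P"
  by (simp add: frac_index_def of_rat_divide of_rat_diff)

text \<open>Two expansions are compared after pairing with the fixed vector
  \<open>c' n0 - c n0\<close>. Scalar uniqueness then makes the n0-th coefficient of the difference,
  which is the squared norm of that vector, vanish.\<close>

lemma fourier_coeff_unique:
  fixes f :: "complex \<Rightarrow> 'v::hermitian_space"
  assumes "finite {n. n < 0 \<and> c n \<noteq> 0}"
    and c: "\<And>\<tau>. \<tau> \<in> \<bbbH> \<Longrightarrow> ((\<lambda>n. exp (2 * pi * \<i> * of_rat n * \<tau>) *\<^sub>C c n) has_sum f \<tau>) UNIV"
  shows "fourier_coeff f = c"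
  unfolding fourier_coeff_def
proof (rule the_equality)
  fix c' assume c': "finite {n. n < 0 \<and> c' n \<noteq> 0} \<and>
    (\<forall>\<tau>\<in>\<bbbH>. ((\<lambda>n. exp (2 * pi * \<i> * of_rat n * \<tau>) *\<^sub>C c' n) has_sum f \<tau>) UNIV)"
  show "c' = c"
  proof
    fix n0
    let ?w = "c' n0 - c n0"
    have "herm (c' n0 - c n0) ?w = 0"
    proof (rule rational_frequencies_unique[of "\<lambda>n. herm (c' n - c n) (c' n0 - c n0)"])
      fix \<tau> assume "\<tau> \<in> \<bbbH>"
      have *: "((\<lambda>n. exp (2 * pi * \<i> * of_rat n * \<tau>) * herm (d n) ?w) has_sum herm (f \<tau>) ?w) UNIV"
        if "((\<lambda>n. exp (2 * pi * \<i> * of_rat n * \<tau>) *\<^sub>C d n) has_sum f \<tau>) UNIV" for d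
        using has_sum_bounded_linear[OF bounded_linear_herm_left that, of ?w]
        by (simp add: herm_scaleC_left)
      have "((\<lambda>n. - (exp (2 * pi * \<i> * of_rat n * \<tau>) * herm (c n) ?w)) has_sum - herm (f \<tau>) ?w) UNIV"
        using *[of c] c \<open>\<tau> \<in> \<bbbH>\<close> by (simp add: has_sum_uminus)
      from has_sum_add[OF *[of c'] this] c' \<open>\<tau> \<in> \<bbbH>\<close>
      show "((\<lambda>n. exp (2 * pi * \<i> * of_rat n * \<tau>) * herm (c' n - c n) ?w) has_sum 0) UNIV"
        by (simp add: herm_diff_left right_diff_distrib)
    qed
    then show "c' n0 = c n0" by (simp add: herm_eq_0_iff)
  qed
qed (use assms in blast)

lemma orthonormal_basis_expand:
  assumes "orthonormal_basis E"
  shows "(\<Sum>e\<in>E. herm x e *\<^sub>C e) = x"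
  using assms unfolding orthonormal_basis_def by (elim conjE allE[of _ x]) (erule sym)

definition q_param :: "nat \<Rightarrow> complex \<Rightarrow> complex" where
  "q_param P \<tau> = exp (2 * pi * \<i> * \<tau> / of_real (real P))"

lemma q_param_nonzero [simp]: "q_param P \<tau> \<noteq> 0"
  by (simp add: q_param_def)

lemma exp_frac_index:
  "exp (2 * pi * \<i> * of_rat (frac_index P K m) * \<tau>) = q_param P \<tau> ^ m / q_param P \<tau> ^ K"
  unfolding q_param_def of_rat_frac_index exp_of_nat_mult[symmetric] exp_diff[symmetric]
  by (rule arg_cong[where f = exp]) (simp add: diff_divide_distrib algebra_simps)

text \<open>The factor \<open>q_param P \<tau> ^ K\<close> has modulus exp(-2 pi K v / P) and
  absorbs the growth exp(C v) once K \<ge> C P / (2 pi). All large K are allowed so that f and g can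
  later share one.\<close>

lemma coordinate_q_expansion:
  fixes f :: "complex \<Rightarrow> 'v::hermitian_space" and P :: nat
  assumes f: "f \<in> weakly_holomorphic_forms k \<rho>" and "P > 0"
    and per: "\<And>\<tau>. \<tau> \<in> \<bbbH> \<Longrightarrow> f (\<tau> + of_nat P) = f \<tau>"
  shows "\<exists>K0. \<forall>K\<ge>K0. \<forall>e. \<exists>a. \<forall>\<tau>\<in>\<bbbH>.
    (\<lambda>m. a m * q_param P \<tau> ^ m) sums (q_param P \<tau> ^ K * herm (f \<tau>) e)"
proof -
  obtain C where "(\<lambda>\<tau>. norm (f \<tau>)) \<in> O[filtercomap Im at_top](\<lambda>\<tau>. exp (C * Im \<tau>))"
    using f by (auto simp: weakly_holomorphic_forms_def)
  then obtain B where B: "B > 0" "\<forall>\<^sub>F \<tau> in filtercomap Im at_top. norm (norm (f \<tau>)) \<le> B * norm (exp (C * Im \<tau>))"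
    by (rule landau_o.bigE)
  then obtain v0 where v0: "\<And>\<tau>. Im \<tau> \<ge> v0 \<Longrightarrow> norm (f \<tau>) \<le> B * exp (C * Im \<tau>)"
    by (auto simp: eventually_filtercomap_at_top_linorder)
  have "\<exists>a. \<forall>\<tau>\<in>\<bbbH>. (\<lambda>m. a m * q_param P \<tau> ^ m) sums (q_param P \<tau> ^ K * herm (f \<tau>) e)"
    if "K \<ge> nat \<lceil>C * P / (2 * pi)\<rceil>" for K e
  proof -
    have "C * P / (2 * pi) \<le> K" using that by linarith
    then have CK: "C \<le> 2 * pi * K / P" using \<open>P > 0\<close> by (simp add: field_simps)
    have bd: "cmod (herm (f \<tau>) e) \<le> (B * norm e) * exp (2 * pi * K / P * Im \<tau>)"
      if "v0 \<le> Im \<tau>" "\<tau> \<in> \<bbbH>" for \<tau>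
    proof -
      have "C * Im \<tau> \<le> 2 * pi * K / P * Im \<tau>"
        using CK that(2) by (intro mult_right_mono) (auto simp: upper_half_plane_def)
      then have "norm (f \<tau>) \<le> B * exp (2 * pi * K / P * Im \<tau>)"
        using B by (intro order_trans[OF v0[OF that(1)]] mult_left_mono) auto
      then have "norm (f \<tau>) * norm e \<le> B * exp (2 * pi * K / P * Im \<tau>) * norm e"
        by (rule mult_right_mono) simp
      with norm_herm_le[of "f \<tau>" e] show ?thesis by (simp only: mult_ac)
    qed
    have hol: "(\<lambda>\<tau>. herm (f \<tau>) e) holomorphic_on \<bbbH>"
      using f by (intro holomorphic_herm) (simp add: weakly_holomorphic_forms_def)
    have per': "herm (f (\<tau> + of_real (real P))) e = herm (f \<tau>) e" if "\<tau> \<in> \<bbbH>" for \<tau>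
      using per[OF that] by simp
    have P: "real P > 0" using \<open>P > 0\<close> by simp
    have "\<exists>a. \<forall>\<tau>\<in>\<bbbH>. (\<lambda>m. a m * exp (complex_of_real (2 * pi) * \<i> * \<tau> / complex_of_real (real P)) ^ m)
        sums (exp (complex_of_real (2 * pi) * \<i> * \<tau> / complex_of_real (real P)) ^ K * herm (f \<tau>) e)"
      by (rule periodic_q_expansion[OF P hol]) (fact per', fact bd)
    then show ?thesis by (simp add: q_param_def)
  qed
  then show ?thesis by blast
qed

text \<open>The coordinate series in an orthonormal basis are reassembled into vectors
  \<open>d m\<close>, extended by 0 to the remaining rationals; uniqueness identifies the result
  with \<open>fourier_coeff\<close>.\<close>

lemma fourier_coeff_expansion:
  fixes f :: "complex \<Rightarrow> 'v::hermitian_space" and P :: nat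
  assumes f: "f \<in> weakly_holomorphic_forms k \<rho>" and "P > 0"
    and per: "\<And>\<tau>. \<tau> \<in> \<bbbH> \<Longrightarrow> f (\<tau> + of_nat P) = f \<tau>"
  shows "\<exists>K0. \<forall>K\<ge>K0. (\<forall>n. n \<notin> range (frac_index P K) \<longrightarrow> fourier_coeff f n = 0) \<and>
      (\<forall>\<tau>\<in>\<bbbH>. ((\<lambda>m. (q_param P \<tau> ^ m / q_param P \<tau> ^ K) *\<^sub>C fourier_coeff f (frac_index P K m))
        has_sum f \<tau>) UNIV)"
proof -
  obtain E :: "'v set" where E: "orthonormal_basis E" using orthonormal_basis_exists by blast
  obtain K0 where K0: "\<And>K e. K \<ge> K0 \<Longrightarrow> \<exists>a. \<forall>\<tau>\<in>\<bbbH>.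
      (\<lambda>m. a m * q_param P \<tau> ^ m) sums (q_param P \<tau> ^ K * herm (f \<tau>) e)"
    using coordinate_q_expansion[OF assms] by blast
  have "(\<forall>n. n \<notin> range (frac_index P K) \<longrightarrow> fourier_coeff f n = 0) \<and>
      (\<forall>\<tau>\<in>\<bbbH>. ((\<lambda>m. (q_param P \<tau> ^ m / q_param P \<tau> ^ K) *\<^sub>C fourier_coeff f (frac_index P K m))
        has_sum f \<tau>) UNIV)" if K: "K \<ge> K0" for K
  proof -
    from K0[OF K] have "\<forall>e. \<exists>a. \<forall>\<tau>\<in>\<bbbH>.
        (\<lambda>m. a m * q_param P \<tau> ^ m) sums (q_param P \<tau> ^ K * herm (f \<tau>) e)" ..
    then obtain a where a': "\<forall>e. \<forall>\<tau>\<in>\<bbbH>.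
        (\<lambda>m. a e m * q_param P \<tau> ^ m) sums (q_param P \<tau> ^ K * herm (f \<tau>) e)"
      unfolding choice_iff ..
    have a: "(\<lambda>m. a e m * q_param P \<tau> ^ m) sums (q_param P \<tau> ^ K * herm (f \<tau>) e)"
      if "\<tau> \<in> \<bbbH>" for e \<tau>
      using a' that by simp
    define d where "d m = (\<Sum>e\<in>E. a e m *\<^sub>C e)" for m
    have d: "((\<lambda>m. (q_param P \<tau> ^ m / q_param P \<tau> ^ K) *\<^sub>C d m) has_sum f \<tau>) UNIV"
      if \<tau>: "\<tau> \<in> \<bbbH>" for \<tau>
    proof -
      have "((\<lambda>m. \<Sum>e\<in>E. (a e m * q_param P \<tau> ^ m / q_param P \<tau> ^ K) *\<^sub>C e) has_sum
          (\<Sum>e\<in>E. (q_param P \<tau> ^ K * herm (f \<tau>) e / q_param P \<tau> ^ K) *\<^sub>C e)) UNIV"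
      proof (intro has_sum_of_sums has_sum_bounded_linear[OF bounded_linear_scaleC_left]
          has_sum_bounded_linear[OF bounded_linear_divide])
        fix e
        have "summable (\<lambda>m. a e m * q_param P \<tau>' ^ m)" if "\<tau>' \<in> \<bbbH>" for \<tau>'
          using a[OF that] by (rule sums_summable)
        then have "summable (\<lambda>m. norm (a e m * q_param P \<tau> ^ m))"
          unfolding q_param_def using \<open>P > 0\<close> by (intro power_series_in_disc_summable \<tau>) auto
        then show "((\<lambda>m. a e m * q_param P \<tau> ^ m) has_sum q_param P \<tau> ^ K * herm (f \<tau>) e) UNIV"
          by (rule norm_summable_imp_has_sum) (rule a[OF \<tau>])
      qed
      also have "(\<lambda>m. \<Sum>e\<in>E. (a e m * q_param P \<tau> ^ m / q_param P \<tau> ^ K) *\<^sub>C e)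
          = (\<lambda>m. (q_param P \<tau> ^ m / q_param P \<tau> ^ K) *\<^sub>C d m)"
        unfolding d_def scaleC_sum_right scaleC_scaleC by (simp add: mult.commute)
      also have "(\<Sum>e\<in>E. (q_param P \<tau> ^ K * herm (f \<tau>) e / q_param P \<tau> ^ K) *\<^sub>C e) = (\<Sum>e\<in>E. herm (f \<tau>) e *\<^sub>C e)"
        by simp
      also have "\<dots> = f \<tau>" by (rule orthonormal_basis_expand[OF E])
      finally show ?thesis .
    qed
    define c where "c n = (if n \<in> range (frac_index P K) then d (inv_into UNIV (frac_index P K) n) else 0)" for n
    have inj: "inj (frac_index P K)" by (rule inj_frac_index[OF \<open>P > 0\<close>])
    have c_idx: "c (frac_index P K m) = d m" for m
      using inj by (simp add: c_def)
    have c_0: "c n = 0" if "n \<notin> range (frac_index P K)" for n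
      using that by (simp add: c_def)
    have fc: "fourier_coeff f = c"
    proof (rule fourier_coeff_unique)
      have "n \<in> frac_index P K ` {..<K}" if n: "n < 0" "c n \<noteq> 0" for n
      proof -
        obtain m where "n = frac_index P K m" using c_0 n by blast
        with n show ?thesis using \<open>P > 0\<close> by (auto simp: frac_index_def divide_less_0_iff)
      qed
      then have "{n. n < 0 \<and> c n \<noteq> 0} \<subseteq> frac_index P K ` {..<K}" by blast
      then show "finite {n. n < 0 \<and> c n \<noteq> 0}" by (rule finite_subset) simp
      fix \<tau> assume \<tau>: "\<tau> \<in> \<bbbH>"
      have "((\<lambda>n. exp (2 * pi * \<i> * of_rat n * \<tau>) *\<^sub>C c n) has_sum f \<tau>) (range (frac_index P K))"
        using d[OF \<tau>] unfolding has_sum_reindex[OF inj] o_def c_idx exp_frac_index .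
      also have "?this \<longleftrightarrow> ((\<lambda>n. exp (2 * pi * \<i> * of_rat n * \<tau>) *\<^sub>C c n) has_sum f \<tau>) UNIV"
        by (rule has_sum_cong_neutral) (auto simp: c_0)
      finally show "((\<lambda>n. exp (2 * pi * \<i> * of_rat n * \<tau>) *\<^sub>C c n) has_sum f \<tau>) UNIV" .
    qed
    show ?thesis unfolding fc c_idx using c_0 d by blast
  qed
  then show ?thesis by blast
qed

section \<open>Mean values along horizontal lines\<close>

text \<open>The majorant |A m| C makes the convergence uniform on the interval, which yields
  continuity and termwise integration together.\<close>

lemma
  fixes A :: "nat \<Rightarrow> complex" and b :: "nat \<Rightarrow> real \<Rightarrow> complex"
  assumes A: "summable (\<lambda>m. norm (A m))"
    and cont: "\<And>m. continuous_on {s..t} (b m)" and bound: "\<And>m u. u \<in> {s..t} \<Longrightarrow> norm (b m u) \<le> C"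
  shows continuous_on_dominated_series: "continuous_on {s..t} (\<lambda>u. \<Sum>m. A m * b m u)"
    and integral_dominated_series:
      "(\<lambda>m. A m * integral {s..t} (b m)) sums integral {s..t} (\<lambda>u. \<Sum>m. A m * b m u)"
proof -
  have lim: "uniform_limit {s..t} (\<lambda>n u. \<Sum>m<n. A m * b m u) (\<lambda>u. \<Sum>m. A m * b m u) sequentially"
    using A bound
    by (intro Weierstrass_m_test[where M = "\<lambda>m. norm (A m) * C"] summable_mult2)
      (auto simp: norm_mult intro!: mult_left_mono)
  have c: "continuous_on {s..t} (\<lambda>u. \<Sum>m<n. A m * b m u)" for n
    by (intro continuous_intros cont)
  show "continuous_on {s..t} (\<lambda>u. \<Sum>m. A m * b m u)"
    using lim by (rule uniform_limit_theorem[rotated]) (simp, intro always_eventually allI c)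
  obtain I J where IJ: "\<And>n. ((\<lambda>u. \<Sum>m<n. A m * b m u) has_integral I n) {s..t}"
    "((\<lambda>u. \<Sum>m. A m * b m u) has_integral J) {s..t}" "I \<longlonglongrightarrow> J"
    using uniform_limit_integral[OF lim c] by auto
  have "I n = (\<Sum>m<n. A m * integral {s..t} (b m))" for n
  proof -
    have "((\<lambda>u. \<Sum>m<n. A m * b m u) has_integral (\<Sum>m<n. A m * integral {s..t} (b m))) {s..t}"
      by (intro has_integral_sum has_integral_mult_right integrable_integral
          integrable_continuous_interval cont) auto
    with IJ(1) show ?thesis by (rule has_integral_unique)
  qed
  then have "I = (\<lambda>n. \<Sum>m<n. A m * integral {s..t} (b m))" ..
  then show "(\<lambda>m. A m * integral {s..t} (b m)) sums integral {s..t} (\<lambda>u. \<Sum>m. A m * b m u)"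
    using IJ(3) integral_unique[OF IJ(2)] by (simp add: sums_def)
qed

lemma integral_exp_full_period:
  fixes P s :: real and j :: int
  assumes "P > 0"
  shows "integral {s..s + P} (\<lambda>u. exp (2 * pi * \<i> * of_int j * u / P)) = (if j = 0 then P else 0)"
proof (cases "j = 0")
  case False
  define c where "c = 2 * pi * \<i> * of_int j / P"
  have "c \<noteq> 0" using False assms by (simp add: c_def)
  have int: "((\<lambda>u. exp (c * of_real u)) has_integral (exp (c * of_real (s + P)) / c - exp (c * of_real s) / c)) {s..s + P}"
  proof (rule fundamental_theorem_of_calculus)
    fix u assume "u \<in> {s..s + P}"
    have "((\<lambda>u. exp (c * u) / c) has_field_derivative exp (c * of_real u) * (c * 1) / c) (at (of_real u))"
      by (intro DERIV_cdivide DERIV_fun_exp DERIV_cmult DERIV_ident)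
    then have "((\<lambda>u. exp (c * u) / c) has_field_derivative exp (c * of_real u)) (at (of_real u))"
      using \<open>c \<noteq> 0\<close> by simp
    from has_vector_derivative_real_field[OF this]
    show "((\<lambda>u. exp (c * of_real u) / c) has_vector_derivative exp (c * of_real u)) (at u within {s..s + P})"
      by (rule has_vector_derivative_at_within)
  qed (use assms in simp)
  have "exp (c * of_real (s + P)) = exp (c * of_real s)"
  proof -
    have "c * of_real P = 2 * pi * \<i> * of_int j" using assms by (simp add: c_def)
    then have "exp (c * of_real P) = 1" by (auto simp: exp_eq_1)
    then show ?thesis by (simp add: distrib_left exp_add)
  qed
  then have "integral {s..s + P} (\<lambda>u. exp (c * of_real u)) = 0"
    using integral_unique[OF int] by simp
  moreover have "2 * pi * \<i> * of_int j * complex_of_real u / P = c * of_real u" for u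
    by (simp add: c_def)
  ultimately show ?thesis
    using False by simp
qed (use assms in \<open>simp add: scaleR_conv_of_real\<close>)

text \<open>The phase of \<open>q_param\<close> to the m-th power along a horizontal line. The
  modulus depends on the height only and is moved into the coefficients.\<close>

definition circle_char :: "real \<Rightarrow> nat \<Rightarrow> real \<Rightarrow> complex" where
  "circle_char P m u = exp (2 * pi * \<i> * of_nat m * u / P)"

lemma norm_circle_char [simp]: "norm (circle_char P m u) = 1"
  by (simp add: circle_char_def)

lemma circle_char_unit: "circle_char P m u * cnj (circle_char P m u) = 1"
  using complex_norm_square[of "circle_char P m u"] by simp

lemma continuous_on_circle_char [continuous_intros]:
  "P > 0 \<Longrightarrow> continuous_on S (circle_char P m)"
  unfolding circle_char_def by (intro continuous_intros) auto

text \<open>Termwise integration is used twice: in the series of B against one fixed character,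
  where orthogonality leaves the index m, and then in the series of A.\<close>

lemma parseval:
  fixes A B :: "nat \<Rightarrow> complex" and P s :: real
  assumes A: "summable (\<lambda>m. norm (A m))" and B: "summable (\<lambda>m. norm (B m))" and "P > 0"
  defines "w \<equiv> circle_char P"
  shows "(\<lambda>m. of_real P * (A m * cnj (B m))) sums
    integral {s..s + P} (\<lambda>u. (\<Sum>m. A m * w m u) * cnj (\<Sum>m. B m * w m u))"
    and "continuous_on {s..s + P} (\<lambda>u. (\<Sum>m. A m * w m u) * cnj (\<Sum>m. B m * w m u))"
proof -
  let ?I = "{s..s + P}"
  have w_cont: "continuous_on ?I (w m)" for m
    unfolding w_def using \<open>P > 0\<close> by (intro continuous_intros)
  have w_norm: "norm (w m u) = 1" for m u
    by (simp add: w_def)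
  have G_cont: "continuous_on ?I (\<lambda>u. \<Sum>m. B m * w m u)"
    by (rule continuous_on_dominated_series[OF B w_cont, where C = 1]) (simp add: w_norm)
  have G_bound: "norm (\<Sum>m. B m * w m u) \<le> (\<Sum>m. norm (B m))" for u
    using B summable_norm[of "\<lambda>m. B m * w m u"] by (simp add: norm_mult w_norm)
  have G_summable: "summable (\<lambda>m. B m * w m u)" for u
    using B by (intro summable_norm_cancel[of "\<lambda>m. B m * w m u"]) (simp add: norm_mult w_norm)
  have coeff: "integral ?I (\<lambda>u. w m u * cnj (\<Sum>l. B l * w l u)) = of_real P * cnj (B m)" for m
  proof -
    have eq: "w m u * cnj (\<Sum>l. B l * w l u) = (\<Sum>l. cnj (B l) * (w m u * cnj (w l u)))" for u
    proof -
      have "(\<lambda>l. w m u * cnj (B l * w l u)) sums (w m u * cnj (\<Sum>l. B l * w l u))"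
        using G_summable[of u] by (intro sums_mult) (simp only: sums_cnj summable_sums)
      then show ?thesis by (simp add: sums_iff mult_ac)
    qed
    have ww: "w m u * cnj (w l u) = exp (2 * pi * \<i> * of_int (int m - int l) * u / P)" for l u
      by (simp add: w_def circle_char_def exp_cnj exp_add[symmetric] diff_divide_distrib ring_distribs)
    have "(\<lambda>l. cnj (B l) * integral ?I (\<lambda>u. w m u * cnj (w l u))) sums
        integral ?I (\<lambda>u. \<Sum>l. cnj (B l) * (w m u * cnj (w l u)))"
      using B by (intro integral_dominated_series[where C = 1])
        (auto simp: norm_mult w_norm intro!: continuous_intros w_cont)
    moreover have "cnj (B l) * integral ?I (\<lambda>u. w m u * cnj (w l u)) = (if l = m then of_real P * cnj (B m) else 0)" for l
      unfolding ww integral_exp_full_period[OF \<open>P > 0\<close>] by simp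
    ultimately show ?thesis
      unfolding eq using sums_single[of m "\<lambda>l. of_real P * cnj (B m)"] by (simp add: sums_unique2)
  qed
  have eq: "(\<Sum>m. A m * w m u) * cnj (\<Sum>m. B m * w m u) = (\<Sum>m. A m * (w m u * cnj (\<Sum>l. B l * w l u)))" for u
  proof -
    have "summable (\<lambda>m. A m * w m u)"
      using A by (intro summable_norm_cancel[of "\<lambda>m. A m * w m u"]) (simp add: norm_mult w_norm)
    from suminf_mult2[OF this] show ?thesis by (simp add: mult.assoc)
  qed
  have bc: "continuous_on ?I (\<lambda>u. w m u * cnj (\<Sum>l. B l * w l u))"
    and bb: "norm (w m u * cnj (\<Sum>l. B l * w l u)) \<le> (\<Sum>m. norm (B m))" for m u
    using G_bound by (auto intro!: continuous_intros w_cont G_cont simp: norm_mult w_norm)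
  show "continuous_on ?I (\<lambda>u. (\<Sum>m. A m * w m u) * cnj (\<Sum>m. B m * w m u))"
    unfolding eq by (rule continuous_on_dominated_series[OF A bc bb])
  show "(\<lambda>m. of_real P * (A m * cnj (B m))) sums
    integral ?I (\<lambda>u. (\<Sum>m. A m * w m u) * cnj (\<Sum>m. B m * w m u))"
    unfolding eq using integral_dominated_series[OF A bc bb] unfolding coeff by (simp add: mult_ac)
qed

lemma integral_periodic:
  fixes h :: "real \<Rightarrow> complex"
  assumes "continuous_on UNIV h" "\<And>u. h (u + 1) = h u"
  shows "integral {s..s + real P} h = of_nat P * integral {s..s + 1} h"
proof (induction P)
  case (Suc P)
  have int: "h integrable_on {a..b}" for a b
    by (rule integrable_continuous_interval) (rule continuous_on_subset[OF assms(1)], simp)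
  have per: "h (u + real P) = h u" for u
  proof (induction P)
    case (Suc P)
    then show ?case using assms(2)[of "u + real P"] by (simp add: add_ac)
  qed simp
  have "integral {s..s + real (Suc P)} h = integral {s..s + real P} h + integral {s + real P..s + real (Suc P)} h"
    by (rule Henstock_Kurzweil_Integration.integral_combine[symmetric]) (auto intro: int)
  also have "integral {s + real P..s + real (Suc P)} h = integral {s..s + 1} h"
    using integral_shift_real_ivl[of "s + real P" "real P" "s + 1 + real P" h] by (simp add: per add_ac)
  finally show ?case using Suc by (simp add: algebra_simps)
qed simp

section \<open>Means of the product of two forms\<close>

definition horizontal_mean :: "(complex \<Rightarrow> 'v::hermitian_space) \<Rightarrow> (complex \<Rightarrow> 'v) \<Rightarrow> real \<Rightarrow> complex" where
  "horizontal_mean f g v = integral {-1/2..1/2} (\<lambda>u. herm (f (Complex u v)) (g (Complex u v)))"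

lemma continuous_on_herm:
  assumes "vector_holomorphic_on f \<bbbH>" "vector_holomorphic_on g \<bbbH>"
  shows "continuous_on \<bbbH> (\<lambda>\<tau>. herm (f \<tau>) (g \<tau>))"
proof -
  obtain E :: "'a set" where E: "orthonormal_basis E" using orthonormal_basis_exists by blast
  have c: "continuous_on \<bbbH> (\<lambda>\<tau>. herm (f \<tau>) e)" "continuous_on \<bbbH> (\<lambda>\<tau>. herm (g \<tau>) e)" for e
    by (rule holomorphic_on_imp_continuous_on[OF holomorphic_herm[OF assms(1)]])
      (rule holomorphic_on_imp_continuous_on[OF holomorphic_herm[OF assms(2)]])
  show ?thesis
    by (subst herm_orthonormal_basis[OF E]) (intro continuous_intros c)
qed

text \<open>Parseval is applied in each coordinate of an orthonormal basis. The common phase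
  \<open>cnj (?w K u)\<close> left by the shift has modulus 1 and cancels between f and the
  conjugate of g; the moduli \<open>r m\<close> of both forms multiply to exp(-4 pi n v).\<close>

lemma horizontal_mean_sums:
  fixes f g :: "complex \<Rightarrow> 'v::hermitian_space" and P K :: nat
  assumes f: "f \<in> weakly_holomorphic_forms k \<rho>" and g: "g \<in> weakly_holomorphic_forms k \<rho>"
    and rep: "unitary_representation \<rho>" and "P > 0" "v > 0"
    and exp_f: "\<And>\<tau>. \<tau> \<in> \<bbbH> \<Longrightarrow>
      ((\<lambda>m. (q_param P \<tau> ^ m / q_param P \<tau> ^ K) *\<^sub>C c m) has_sum f \<tau>) UNIV"
    and exp_g: "\<And>\<tau>. \<tau> \<in> \<bbbH> \<Longrightarrow>
      ((\<lambda>m. (q_param P \<tau> ^ m / q_param P \<tau> ^ K) *\<^sub>C d m) has_sum g \<tau>) UNIV"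
  shows "(\<lambda>m. herm (c m) (d m) * exp (- 4 * pi * (real m - real K) / P * v)) sums horizontal_mean f g v"
    and "summable (\<lambda>m. norm (herm (c m) (d m) * exp (- 4 * pi * (real m - real K) / P * v)))"
proof -
  obtain E :: "'v set" where E: "orthonormal_basis E" using orthonormal_basis_exists by blast
  let ?w = "circle_char (real P)"
  define r where "r m = exp (- 2 * pi * (real m - real K) / P * v)" for m :: nat
  have q_eq: "q_param P (Complex u v) ^ m / q_param P (Complex u v) ^ K
      = of_real (r m) * (?w m u * cnj (?w K u))" for u m
  proof -
    have "complex_of_real (r m) * (?w m u * cnj (?w K u))
        = exp (of_real (- 2 * pi * (real m - real K) / P * v) +
            (2 * pi * \<i> * of_nat m * u / P + cnj (2 * pi * \<i> * of_nat K * u / P)))"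
      unfolding r_def circle_char_def exp_cnj exp_add exp_of_real by simp
    also have "of_real (- 2 * pi * (real m - real K) / P * v) +
            (2 * pi * \<i> * of_nat m * u / P + cnj (2 * pi * \<i> * of_nat K * u / P))
        = of_nat m * (2 * pi * \<i> * Complex u v / P) - of_nat K * (2 * pi * \<i> * Complex u v / P)"
      using \<open>P > 0\<close> by (simp add: complex_eq_iff field_simps)
    finally show ?thesis
      unfolding q_param_def exp_of_nat_mult[symmetric] exp_diff[symmetric] by simp
  qed
  have coord: "summable (\<lambda>m. norm (herm (c m) e * of_real (r m)))"
    "herm (f (Complex u v)) e = cnj (?w K u) * (\<Sum>m. (herm (c m) e * of_real (r m)) * ?w m u)"
    if ex: "\<And>\<tau>. \<tau> \<in> \<bbbH> \<Longrightarrow> ((\<lambda>m. (q_param P \<tau> ^ m / q_param P \<tau> ^ K) *\<^sub>C c m) has_sum f \<tau>) UNIV"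
    for f :: "complex \<Rightarrow> 'v" and c e u
  proof -
    have hs: "((\<lambda>m. cnj (?w K u) * ((herm (c m) e * of_real (r m)) * ?w m u)) has_sum herm (f (Complex u v)) e) UNIV" for u
    proof -
      have "Complex u v \<in> \<bbbH>" using \<open>v > 0\<close> by (simp add: upper_half_plane_def)
      from has_sum_bounded_linear[OF bounded_linear_herm_left ex[OF this], of e]
      show ?thesis unfolding q_eq by (simp add: herm_scaleC_left mult_ac)
    qed
    have "(\<lambda>m. norm (cnj (?w K 0) * ((herm (c m) e * of_real (r m)) * ?w m 0))) summable_on UNIV"
      using hs[of 0] by (simp add: summable_on_iff_abs_summable_on_complex[symmetric] has_sum_imp_summable)
    then show "summable (\<lambda>m. norm (herm (c m) e * of_real (r m)))"
      by (simp add: norm_mult summable_on_imp_summable)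
    then have "summable (\<lambda>m. (herm (c m) e * of_real (r m)) * ?w m u)"
      by (intro summable_norm_cancel[of "\<lambda>m. (herm (c m) e * of_real (r m)) * ?w m u"]) (simp add: norm_mult)
    from suminf_mult[OF this, of "cnj (?w K u)"]
    show "herm (f (Complex u v)) e = cnj (?w K u) * (\<Sum>m. (herm (c m) e * of_real (r m)) * ?w m u)"
      using has_sum_imp_sums[OF hs[of u]] by (simp add: sums_iff)
  qed
  define F where "F e u = (\<Sum>m. (herm (c m) e * of_real (r m)) * ?w m u)" for e u
  define G where "G e u = (\<Sum>m. (herm (d m) e * of_real (r m)) * ?w m u)" for e u
  have FG_coord: "herm (f (Complex u v)) e = cnj (?w K u) * F e u"
    "herm (g (Complex u v)) e = cnj (?w K u) * G e u" for e u
    unfolding F_def G_def by (rule coord(2)[OF exp_f] coord(2)[OF exp_g], assumption)+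
  have herm_FG: "herm (f (Complex u v)) (g (Complex u v)) = (\<Sum>e\<in>E. F e u * cnj (G e u))" for u
  proof -
    have "herm (f (Complex u v)) (g (Complex u v)) =
        (\<Sum>e\<in>E. (cnj (?w K u) * F e u) * cnj (cnj (?w K u) * G e u))"
      unfolding FG_coord[symmetric] by (rule herm_orthonormal_basis[OF E])
    also have "\<dots> = (\<Sum>e\<in>E. (?w K u * cnj (?w K u)) * (F e u * cnj (G e u)))"
      by (intro sum.cong refl) (simp only: complex_cnj_mult complex_cnj_cnj mult_ac)
    finally show ?thesis unfolding circle_char_unit by simp
  qed
  let ?s = "- 1 / 2 :: real"
  let ?p = "\<lambda>m. herm (c m) (d m) * exp (- 4 * pi * (real m - real K) / P * v)"
  have P: "real P > 0" using \<open>P > 0\<close> by simp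
  have p_eq: "(\<Sum>e\<in>E. (herm (c m) e * of_real (r m)) * cnj (herm (d m) e * of_real (r m))) = ?p m" for m
  proof -
    have "r m * r m = exp (- 4 * pi * (real m - real K) / P * v)"
      unfolding r_def exp_add[symmetric] by (simp add: field_simps)
    then have "complex_of_real (exp (- 4 * pi * (real m - real K) / P * v)) = of_real (r m) * of_real (r m)"
      by (simp only: of_real_mult[symmetric])
    then show ?thesis
      by (subst herm_orthonormal_basis[OF E, of "c m" "d m"]) (simp add: sum_distrib_left sum_distrib_right mult_ac)
  qed
  have FG_int: "(\<lambda>m. of_real P * ((herm (c m) e * of_real (r m)) * cnj (herm (d m) e * of_real (r m)))) sums
      integral {?s..?s + P} (\<lambda>u. F e u * cnj (G e u))"
    and FG_cont: "continuous_on {?s..?s + P} (\<lambda>u. F e u * cnj (G e u))" for e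
    unfolding F_def G_def
    by (rule parseval[OF coord(1)[OF exp_f] coord(1)[OF exp_g] P], assumption, assumption)+
  have "(\<lambda>m. \<Sum>e\<in>E. of_real P * ((herm (c m) e * of_real (r m)) * cnj (herm (d m) e * of_real (r m)))) sums
      (\<Sum>e\<in>E. integral {?s..?s + P} (\<lambda>u. F e u * cnj (G e u)))"
    by (intro sums_sum FG_int)
  also have "(\<Sum>e\<in>E. integral {?s..?s + P} (\<lambda>u. F e u * cnj (G e u)))
      = integral {?s..?s + P} (\<lambda>u. herm (f (Complex u v)) (g (Complex u v)))"
    unfolding herm_FG using E
    by (subst integral_sum) (unfold orthonormal_basis_def, elim conjE, assumption,
        rule integrable_continuous_interval, rule FG_cont, rule refl)
  \<comment> \<open>Parseval needs the period P of the single forms, but their product has period 1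
    because rho is unitary.\<close>
  also have "\<dots> = of_nat P * integral {?s..?s + 1} (\<lambda>u. herm (f (Complex u v)) (g (Complex u v)))"
  proof (rule integral_periodic)
    fix u
    have H: "Complex u v \<in> \<bbbH>" using \<open>v > 0\<close> by (simp add: upper_half_plane_def)
    have eq: "Complex u v + of_int 1 = Complex (u + 1) v" by (simp add: complex_eq_iff)
    show "herm (f (Complex (u + 1) v)) (g (Complex (u + 1) v)) = herm (f (Complex u v)) (g (Complex u v))"
      using herm_weakly_holomorphic_periodic[OF rep f g H, of 1] unfolding eq .
  next
    show "continuous_on UNIV (\<lambda>u. herm (f (Complex u v)) (g (Complex u v)))"
    proof (rule continuous_on_compose2[OF continuous_on_herm[of f g]])
      show "continuous_on UNIV (\<lambda>u. Complex u v)"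
        unfolding Complex_eq by (intro continuous_intros)
    qed (use \<open>v > 0\<close> f g in \<open>simp_all add: weakly_holomorphic_forms_def upper_half_plane_def image_subset_iff\<close>)
  qed
  also have "\<dots> = of_real P * horizontal_mean f g v"
    by (simp add: horizontal_mean_def)
  finally have "(\<lambda>m. of_real P * ?p m) sums (of_real P * horizontal_mean f g v)"
    unfolding sum_distrib_left[symmetric] p_eq .
  then show "?p sums horizontal_mean f g v"
    using P by (subst (asm) sums_mult_iff) auto
  \<comment> \<open>The factor from g is bounded by its full absolute sum, so the absolute
    summability for f is enough.\<close>
  show "summable (\<lambda>m. norm (?p m))"
    unfolding p_eq[symmetric]
  proof (rule summable_comparison_test')
    show "summable (\<lambda>m. \<Sum>e\<in>E. norm (herm (c m) e * of_real (r m)) * (\<Sum>m. norm (herm (d m) e * of_real (r m))))"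
      by (intro summable_sum summable_mult2 coord(1)[OF exp_f])
    fix m
    have "norm (herm (d m) e * of_real (r m)) \<le> (\<Sum>m. norm (herm (d m) e * of_real (r m)))" for e
      using sum_le_suminf[OF coord(1)[OF exp_g, of e], of "{m}"] by simp
    then show "norm (norm (\<Sum>e\<in>E. (herm (c m) e * of_real (r m)) * cnj (herm (d m) e * of_real (r m))))
      \<le> (\<Sum>e\<in>E. norm (herm (c m) e * of_real (r m)) * (\<Sum>m. norm (herm (d m) e * of_real (r m))))"
      unfolding real_norm_def abs_norm_cancel
      by (intro order_trans[OF norm_sum] sum_mono)
        (subst norm_mult, subst complex_mod_cnj, rule mult_left_mono, blast, rule norm_ge_zero)
  qed
qed

text \<open>All exponents lie in the multiples of 1/P, so the positive ones are at least 1/P. This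
  gap gives the rate \<delta> = 4 pi / P, uniformly over the infinitely many remaining
  terms.\<close>

lemma horizontal_mean_decay:
  fixes f g :: "complex \<Rightarrow> 'v::hermitian_space"
  assumes f: "f \<in> weakly_holomorphic_forms k \<rho>" and g: "g \<in> weakly_holomorphic_forms k \<rho>"
    and rep: "unitary_representation \<rho>" and fin: "factors_through_finite_quotient \<rho>"
  shows "\<exists>N C \<delta>. finite N \<and> N \<subseteq> {0..} \<and> (\<forall>n\<ge>0. n \<notin> N \<longrightarrow> polar_product f g n = 0) \<and> \<delta> > 0 \<and>
    (\<forall>v\<ge>1. norm (horizontal_mean f g v - (\<Sum>n\<in>N. polar_product f g n * of_real (exp (4 * pi * of_rat n * v))))
      \<le> C * exp (- \<delta> * v))"
proof -
  from weakly_holomorphic_common_period[OF rep fin] obtain P :: nat where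
    P: "P > 0 \<and> (\<forall>k. \<forall>f\<in>weakly_holomorphic_forms k \<rho>. \<forall>\<tau>\<in>\<bbbH>. f (\<tau> + of_nat P) = f \<tau>)" ..
  then have "P > 0" by (rule conjunct1)
  from P have per: "f (\<tau> + of_nat P) = f \<tau>" if "f \<in> weakly_holomorphic_forms k \<rho>" "\<tau> \<in> \<bbbH>" for f k \<tau>
    using that by simp_all
  from fourier_coeff_expansion[OF f \<open>P > 0\<close> per[OF f]] obtain Kf where
    Kf: "\<forall>K\<ge>Kf. (\<forall>n. n \<notin> range (frac_index P K) \<longrightarrow> fourier_coeff f n = 0) \<and>
      (\<forall>\<tau>\<in>\<bbbH>. ((\<lambda>m. (q_param P \<tau> ^ m / q_param P \<tau> ^ K) *\<^sub>C fourier_coeff f (frac_index P K m))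
        has_sum f \<tau>) UNIV)" ..
  from fourier_coeff_expansion[OF g \<open>P > 0\<close> per[OF g]] obtain Kg where
    Kg: "\<forall>K\<ge>Kg. (\<forall>n. n \<notin> range (frac_index P K) \<longrightarrow> fourier_coeff g n = 0) \<and>
      (\<forall>\<tau>\<in>\<bbbH>. ((\<lambda>m. (q_param P \<tau> ^ m / q_param P \<tau> ^ K) *\<^sub>C fourier_coeff g (frac_index P K m))
        has_sum g \<tau>) UNIV)" ..
  define K where "K = max Kf Kg"
  have exp_f: "((\<lambda>m. (q_param P \<tau> ^ m / q_param P \<tau> ^ K) *\<^sub>C fourier_coeff f (frac_index P K m)) has_sum f \<tau>) UNIV"
    and exp_g: "((\<lambda>m. (q_param P \<tau> ^ m / q_param P \<tau> ^ K) *\<^sub>C fourier_coeff g (frac_index P K m)) has_sum g \<tau>) UNIV"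
    if "\<tau> \<in> \<bbbH>" for \<tau>
    using Kf[rule_format, of K, THEN conjunct2] Kg[rule_format, of K, THEN conjunct2] that
    by (simp_all add: K_def)
  have zero: "fourier_coeff f n = 0" if "n \<notin> range (frac_index P K)" for n
    using Kf[rule_format, of K, THEN conjunct1] that by (simp add: K_def)
  define p where "p m = herm (fourier_coeff f (frac_index P K m)) (fourier_coeff g (frac_index P K m))" for m
  define t where "t v m = p m * exp (- 4 * pi * (real m - real K) / P * v)" for v :: real and m
  have sums_t: "t v sums horizontal_mean f g v" and summable_t: "summable (\<lambda>m. norm (t v m))" if "v > 0" for v
    unfolding t_def p_def
    by (rule horizontal_mean_sums[OF f g rep \<open>P > 0\<close> that exp_f exp_g]; assumption)+
  \<comment> \<open>Indices m \<le> K are the exponents \<le> 0, with m = K the constant term; the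
    sign is changed because \<open>polar_product\<close> takes the coefficients at -n.\<close>
  define N where "N = (\<lambda>m. - frac_index P K m) ` {..K}"
  define \<delta> where "\<delta> = 4 * pi / P"
  have "\<delta> > 0" using \<open>P > 0\<close> by (simp add: \<delta>_def)
  have N_nonneg: "N \<subseteq> {0..}"
    by (auto simp: N_def frac_index_def divide_nonpos_nonneg)
  have polar_0: "polar_product f g n = 0" if n: "n \<ge> 0" "n \<notin> N" for n
  proof -
    have "- n \<noteq> frac_index P K m" for m
    proof
      assume eq: "- n = frac_index P K m"
      then have "frac_index P K m \<le> 0" using n by simp
      then have "m \<le> K" using \<open>P > 0\<close> by (simp add: frac_index_def divide_le_0_iff)
      then show False using n eq by (auto simp: N_def intro!: image_eqI[of _ _ m])
    qed
    then have "- n \<notin> range (frac_index P K)" by blast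
    then show ?thesis using zero by (simp add: polar_product_def)
  qed
  have N_sum: "(\<Sum>n\<in>N. polar_product f g n * of_real (exp (4 * pi * of_rat n * v))) = (\<Sum>m\<le>K. t v m)" for v
  proof -
    have "inj_on (\<lambda>m. - frac_index P K m) {..K}"
      using inj_frac_index[OF \<open>P > 0\<close>, of K] by (auto simp: inj_def inj_on_def)
    then show ?thesis
      unfolding N_def
      by (simp add: sum.reindex t_def p_def polar_product_def of_rat_minus of_rat_frac_index)
  qed
  define S where "S = (\<Sum>j. norm (t 1 (j + Suc K)))"
  have "norm (horizontal_mean f g v - (\<Sum>n\<in>N. polar_product f g n * of_real (exp (4 * pi * of_rat n * v))))
      \<le> (S * exp \<delta>) * exp (- \<delta> * v)" if "v \<ge> 1" for v
  proof -
    have v: "v > 0" using that by simp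
    have "(\<lambda>j. t v (j + Suc K)) sums (horizontal_mean f g v - (\<Sum>m<Suc K. t v m))"
      using sums_t[OF v] by (subst sums_iff_shift) simp
    then have eq: "horizontal_mean f g v - (\<Sum>n\<in>N. polar_product f g n * of_real (exp (4 * pi * of_rat n * v)))
        = (\<Sum>j. t v (j + Suc K))"
      unfolding N_sum lessThan_Suc_atMost by (simp add: sums_iff)
    have sm: "summable (\<lambda>j. norm (t v (j + Suc K)))" if "v > 0" for v :: real
      using summable_ignore_initial_segment[OF summable_t[OF that], of "Suc K"] .
    \<comment> \<open>Here the exponent is (j + 1) / P. Passing from height 1 to v multiplies the
      term by exp(-\<delta> (j + 1) (v - 1)), which is weakened to a factor independent of
      j.\<close>
    have "norm (t v (j + Suc K)) \<le> exp (- \<delta> * (v - 1)) * norm (t 1 (j + Suc K))" for j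
    proof -
      have "- 4 * pi * (real (j + Suc K) - real K) / P * v
          = - (\<delta> * (real j + 1) * (v - 1)) + - 4 * pi * (real (j + Suc K) - real K) / P * 1"
        using \<open>P > 0\<close> by (simp add: \<delta>_def field_simps)
      also have "\<dots> \<le> - \<delta> * (v - 1) + - 4 * pi * (real (j + Suc K) - real K) / P * 1"
      proof -
        have "\<delta> * 1 * (v - 1) \<le> \<delta> * (real j + 1) * (v - 1)"
          using \<open>\<delta> > 0\<close> that by (intro mult_right_mono mult_left_mono) auto
        then show ?thesis by simp
      qed
      finally have "exp (- 4 * pi * (real (j + Suc K) - real K) / P * v)
          \<le> exp (- \<delta> * (v - 1)) * exp (- 4 * pi * (real (j + Suc K) - real K) / P * 1)"
        unfolding exp_add[symmetric] by simp
      from mult_left_mono[OF this, of "norm (p (j + Suc K))"] show ?thesis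
        unfolding t_def norm_mult norm_of_real abs_exp_cancel by (simp only: mult_ac norm_ge_zero)
    qed
    then have "(\<Sum>j. norm (t v (j + Suc K))) \<le> (\<Sum>j. exp (- \<delta> * (v - 1)) * norm (t 1 (j + Suc K)))"
      by (intro suminf_le sm v summable_mult) simp_all
    also have "\<dots> = exp (- \<delta> * (v - 1)) * S"
      unfolding S_def by (rule suminf_mult) (rule sm, simp)
    also have "exp (- \<delta> * (v - 1)) = exp \<delta> * exp (- \<delta> * v)"
      unfolding exp_add[symmetric] by (simp add: algebra_simps)
    finally show ?thesis
      unfolding eq using summable_norm[OF sm[OF v]] by (simp add: mult_ac)
  qed
  then show ?thesis
    using \<open>\<delta> > 0\<close> N_nonneg polar_0
    by (intro exI[of _ N] exI[of _ "S * exp \<delta>"] exI[of _ \<delta>]) (simp add: N_def)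
qed

section \<open>Constant term at a simple pole\<close>

text \<open>For \<open>a = 0\<close> the polar term has constant term \<open>0\<close>, which agrees with \<open>c / 0 = 0\<close>.\<close>

lemma laurent_constant_term_simple_pole:
  fixes h :: "complex \<Rightarrow> complex"
  assumes "h holomorphic_on ball 0 1" "\<And>s. s \<in> ball 0 1 \<Longrightarrow> I s = h s + c / (a + s)"
  shows "fls_nth (laurent_expansion I 0) 0 = h 0 + c / a"
proof -
  have "h analytic_on {0}"
    using assms(1) by (auto simp: analytic_at intro: exI[of _ "ball 0 1"])
  then have h: "h has_laurent_expansion fps_to_fls (fps_expansion h 0)"
    by (intro has_laurent_expansion_fps analytic_at_imp_has_fps_expansion_0)
  have h0: "fls_nth (fps_to_fls (fps_expansion h 0)) 0 = h 0"
    by (simp add: fps_expansion_def)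
  have "\<exists>F. (\<lambda>s. c / (a + s)) has_laurent_expansion F \<and> fls_nth F 0 = c / a"
  proof (cases "a = 0")
    case True
    have "(\<lambda>s. c * inverse s) has_laurent_expansion fls_const c * fls_X_inv"
      by (intro laurent_expansion_intros)
    then show ?thesis using True
      by (intro exI[of _ "fls_const c * fls_X_inv"]) (simp add: divide_inverse)
  next
    case False
    have "(\<lambda>s. c / (a + s)) holomorphic_on ball 0 (norm a)"
      by (intro holomorphic_intros) (auto simp: add_eq_0_iff)
    then have "(\<lambda>s. c / (a + s)) analytic_on {0}"
      using False by (auto simp: analytic_at intro!: exI[of _ "ball 0 (norm a)"])
    then have "(\<lambda>s. c / (a + s)) has_laurent_expansion fps_to_fls (fps_expansion (\<lambda>s. c / (a + s)) 0)"
      by (intro has_laurent_expansion_fps analytic_at_imp_has_fps_expansion_0)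
    then show ?thesis
      by (intro exI[of _ "fps_to_fls (fps_expansion (\<lambda>s. c / (a + s)) 0)"] conjI)
        (assumption, simp add: fps_expansion_def)
  qed
  then obtain F where F: "(\<lambda>s. c / (a + s)) has_laurent_expansion F" "fls_nth F 0 = c / a" by blast
  have "(\<lambda>s. h s + c / (a + s)) has_laurent_expansion fps_to_fls (fps_expansion h 0) + F"
    using h F(1) by (rule has_laurent_expansion_add)
  moreover have "eventually (\<lambda>s. h s + c / (a + s) = I s) (at 0)"
    using eventually_at_in_open'[of "ball 0 1" "0::complex"] assms(2)
    by (auto elim!: eventually_mono)
  ultimately have "I has_laurent_expansion fps_to_fls (fps_expansion h 0) + F"
    by (subst has_laurent_expansion_cong[OF _ refl, symmetric])
  then have "laurent_expansion I 0 = fps_to_fls (fps_expansion h 0) + F"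
    by (intro laurent_expansion_eqI) simp
  then show ?thesis by (simp only: fls_plus_nth h0 F(2))
qed

section \<open>The regularised integral\<close>

definition pairing_kernel :: "real \<Rightarrow> (complex \<Rightarrow> 'v::hermitian_space) \<Rightarrow> (complex \<Rightarrow> 'v) \<Rightarrow> complex \<Rightarrow> complex \<Rightarrow> complex" where
  "pairing_kernel k f g s \<tau> = herm (f \<tau>) (g \<tau>) * of_real (Im \<tau>) powr (of_real k - s) / of_real ((Im \<tau>)\<^sup>2)"

section \<open>Splitting the fundamental domain at height 1\<close>

text \<open>The conditions force (Im \<tau>)^2 \<ge> 3/4. The cruder closed bound 1/2 suffices to
  replace the open condition Im \<tau> > 0 and make the set compact.\<close>

lemma truncated_domain_1:
  "truncated_domain 1 = {\<tau>. \<bar>Re \<tau>\<bar> \<le> 1/2 \<and> cmod \<tau> \<ge> 1 \<and> 1/2 \<le> Im \<tau> \<and> Im \<tau> \<le> 1}"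
proof -
  have "1/2 \<le> Im \<tau>" if "Im \<tau> > 0" "\<bar>Re \<tau>\<bar> \<le> 1/2" "cmod \<tau> \<ge> 1" for \<tau>
  proof (rule ccontr)
    assume "\<not> 1/2 \<le> Im \<tau>"
    then have "(Im \<tau>)\<^sup>2 \<le> (1/2)\<^sup>2" "(Re \<tau>)\<^sup>2 \<le> (1/2)\<^sup>2"
      using that abs_le_square_iff[of "Re \<tau>" "1/2"] abs_le_square_iff[of "Im \<tau>" "1/2"] by auto
    moreover have "1 \<le> (Re \<tau>)\<^sup>2 + (Im \<tau>)\<^sup>2"
      using that(3) cmod_power2[of \<tau>] one_le_power[of "cmod \<tau>" 2] by simp
    ultimately show False by (simp add: power2_eq_square)
  qed
  then show ?thesis by (auto simp: truncated_domain_def upper_half_plane_def)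
qed

lemma compact_truncated_domain_1: "compact (truncated_domain 1)"
proof -
  have "truncated_domain 1 = cbox (Complex (-1/2) (1/2)) (Complex (1/2) 1) \<inter> {\<tau>. cmod \<tau> \<ge> 1}"
    by (auto simp: truncated_domain_1 in_cbox_complex_iff)
  then show ?thesis
    by (auto intro!: compact_Int_closed closed_Collect_le continuous_intros)
qed

lemma truncated_domain_1_subset: "truncated_domain 1 \<subseteq> \<bbbH>"
  by (auto simp: truncated_domain_def)

lemma truncated_domain_split:
  assumes "t \<ge> 1"
  shows "truncated_domain t = truncated_domain 1 \<union> cbox (Complex (-1/2) 1) (Complex (1/2) t)"
proof -
  have "cmod \<tau> \<ge> 1" if "Im \<tau> \<ge> 1" for \<tau>
    using abs_Im_le_cmod[of \<tau>] that by simp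
  then show ?thesis
    using assms by (auto simp: truncated_domain_def in_cbox_complex_iff upper_half_plane_def)
qed

text \<open>Fubini, transported along the volume-preserving map from pairs (v, u) to u + i v. The
  imaginary part comes first so that v is the outer variable.\<close>

lemma has_integral_complex_cbox:
  fixes \<Phi> :: "complex \<Rightarrow> complex"
  assumes "continuous_on (cbox (Complex a c) (Complex b d)) \<Phi>"
  shows "(\<Phi> has_integral integral {c..d} (\<lambda>v. integral {a..b} (\<lambda>u. \<Phi> (Complex u v))))
    (cbox (Complex a c) (Complex b d))"
proof -
  let ?h = "\<lambda>p::real \<times> real. Complex (snd p) (fst p)" and ?g = "\<lambda>\<tau>. (Im \<tau>, Re \<tau>)"
  have im_h: "?h ` cbox (c, a) (d, b) = cbox (Complex a c) (Complex b d)" for a b c d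
    by (force simp: in_cbox_complex_iff image_iff cbox_Pair_eq complex_eq_iff)
  have im_g: "?g ` cbox u v = cbox (Im u, Re u) (Im v, Re v)" for u v
  proof
    show "cbox (Im u, Re u) (Im v, Re v) \<subseteq> ?g ` cbox u v"
    proof
      fix p assume "p \<in> cbox (Im u, Re u) (Im v, Re v)"
      then show "p \<in> ?g ` cbox u v"
        by (intro image_eqI[of _ _ "?h p"]) (auto simp: in_cbox_complex_iff cbox_Pair_eq)
    qed
  qed (auto simp: in_cbox_complex_iff cbox_Pair_eq)
  have cont: "continuous_on (cbox (c, a) (d, b)) (\<lambda>p. \<Phi> (?h p))"
  proof (rule continuous_on_compose2[OF assms])
    show "continuous_on (cbox (c, a) (d, b)) ?h"
      unfolding Complex_eq by (intro continuous_intros)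
  qed (use im_h in blast)
  have "((\<lambda>p. \<Phi> (?h p)) has_integral integral (cbox (c, a) (d, b)) (\<lambda>p. \<Phi> (?h p))) (cbox (c, a) (d, b))"
    by (intro integrable_integral integrable_continuous cont)
  then have "((\<lambda>\<tau>. \<Phi> (?h (?g \<tau>))) has_integral (1 / 1) *\<^sub>R integral (cbox (c, a) (d, b)) (\<lambda>p. \<Phi> (?h p)))
      (?h ` cbox (c, a) (d, b))"
  proof (rule has_integral_twiddle[rotated -1])
    show "measure lborel (?g ` cbox u v) = 1 * measure lborel (cbox u v)" for u v
      unfolding im_g content_Pair
      by (cases "cbox u v = {}")
        (auto simp: content_cbox_if Basis_complex_def box_eq_empty inner_complex_def prod.insert)
    show "\<exists>w z. ?g ` cbox u v = cbox w z" for u v using im_g by blast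
    show "\<exists>w z. ?h ` cbox u v = cbox w z" for u v using im_h by (cases u; cases v) blast
    show "continuous (at x) ?g" for x
      by (intro continuous_Pair isCont_Re isCont_Im continuous_ident)
  qed auto
  moreover have "integral (cbox (c, a) (d, b)) (\<lambda>p. \<Phi> (?h p))
      = integral {c..d} (\<lambda>v. integral {a..b} (\<lambda>u. \<Phi> (Complex u v)))"
    using integral_prod_continuous[OF cont] by simp
  ultimately show ?thesis unfolding im_h by simp
qed

lemma integral_truncated_domain:
  fixes \<Phi> :: "complex \<Rightarrow> complex"
  assumes "continuous_on \<bbbH> \<Phi>" "t \<ge> 1"
  shows "integral (truncated_domain t) \<Phi> = integral (truncated_domain 1) \<Phi>
    + integral {1..t} (\<lambda>v. integral {-1/2..1/2} (\<lambda>u. \<Phi> (Complex u v)))"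
proof -
  let ?R = "cbox (Complex (-1/2) 1) (Complex (1/2) t)"
  have "set_integrable lborel (truncated_domain 1) \<Phi>"
    unfolding set_integrable_def
    by (intro borel_integrable_compact compact_truncated_domain_1
        continuous_on_subset[OF assms(1) truncated_domain_1_subset])
  then have 1: "(\<Phi> has_integral integral (truncated_domain 1) \<Phi>) (truncated_domain 1)"
    by (intro integrable_integral set_borel_integral_eq_integral)
  have "?R \<subseteq> \<bbbH>" by (auto simp: in_cbox_complex_iff upper_half_plane_def)
  then have 2: "(\<Phi> has_integral integral {1..t} (\<lambda>v. integral {-1/2..1/2} (\<lambda>u. \<Phi> (Complex u v)))) ?R"
    by (intro has_integral_complex_cbox continuous_on_subset[OF assms(1)])
  \<comment> \<open>The two pieces meet only in the line at height 1.\<close>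
  have "negligible (truncated_domain 1 \<inter> ?R)"
  proof (rule negligible_subset)
    show "negligible {\<tau>::complex. \<tau> \<bullet> \<i> = 1}"
      by (rule negligible_standard_hyperplane) (simp add: Basis_complex_def)
    show "truncated_domain 1 \<inter> ?R \<subseteq> {\<tau>. \<tau> \<bullet> \<i> = 1}"
      by (auto simp: in_cbox_complex_iff truncated_domain_1 inner_complex_def)
  qed
  from integral_unique[OF has_integral_Un[OF 1 2 this]] show ?thesis
    by (simp only: truncated_domain_split[OF assms(2)])
qed

lemma continuous_on_horizontal_mean:
  assumes "vector_holomorphic_on f \<bbbH>" "vector_holomorphic_on g \<bbbH>"
  shows "continuous_on {0<..} (horizontal_mean f g)"
proof -
  have "continuous_on ({0<..} \<times> cbox (-1/2) (1/2)) (\<lambda>(v, u). herm (f (Complex u v)) (g (Complex u v)))"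
    unfolding split_def
  proof (rule continuous_on_compose2[OF continuous_on_herm[OF assms]])
    show "continuous_on ({0<..} \<times> cbox (-1/2) (1/2)) (\<lambda>p. Complex (snd p) (fst p))"
      unfolding Complex_eq by (intro continuous_intros)
  qed (auto simp: upper_half_plane_def)
  from integral_continuous_on_param[OF this] show ?thesis
    by (simp add: horizontal_mean_def[abs_def])
qed

lemma continuous_on_pairing_kernel:
  assumes "vector_holomorphic_on f \<bbbH>" "vector_holomorphic_on g \<bbbH>"
  shows "continuous_on \<bbbH> (pairing_kernel k f g s)"
  unfolding pairing_kernel_def
  by (intro continuous_intros continuous_on_herm assms) (auto simp: upper_half_plane_def complex_nonpos_Reals_iff)

lemma powr_minus_2:
  assumes "v > 0"
  shows "complex_of_real v powr (a - 2) = of_real v powr a / of_real (v\<^sup>2)"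
  using assms by (simp add: powr_diff powr_numeral)

lemma integral_pairing_kernel_row:
  assumes "v > 0"
  shows "integral {-1/2..1/2} (\<lambda>u. pairing_kernel k f g s (Complex u v))
    = of_real v powr (of_real k - 2 - s) * horizontal_mean f g v"
proof -
  have "pairing_kernel k f g s (Complex u v) = of_real v powr (of_real k - 2 - s) * herm (f (Complex u v)) (g (Complex u v))" for u
    using powr_minus_2[OF assms, of "of_real k - s"] by (simp add: pairing_kernel_def algebra_simps)
  then show ?thesis by (simp add: horizontal_mean_def)
qed

text \<open>The sum runs over all n \<ge> 0 and not over a chosen finite support, so that the
  symmetry in f and g can be read off.\<close>

definition remainder :: "(complex \<Rightarrow> 'v::hermitian_space) \<Rightarrow> (complex \<Rightarrow> 'v) \<Rightarrow> real \<Rightarrow> complex" where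
  "remainder f g v = horizontal_mean f g v
     - (\<Sum>\<^sub>\<infinity>n\<in>{0..}. polar_product f g n * of_real (exp (4 * pi * of_rat n * v)))"

text \<open>The limit in \<open>I_reg\<close>, written with convergent integrals only.\<close>

definition regular_part :: "real \<Rightarrow> (complex \<Rightarrow> 'v::hermitian_space) \<Rightarrow> (complex \<Rightarrow> 'v) \<Rightarrow> complex \<Rightarrow> complex" where
  "regular_part k f g s = integral (truncated_domain 1) (pairing_kernel k f g s)
     + (LINT v|lborel. indicator {1..} v *\<^sub>R (of_real v powr (of_real k - 2 - s) * remainder f g v))"

section \<open>Existence and holomorphy of the limit\<close>

context
  fixes k :: real and f g :: "complex \<Rightarrow> 'v::hermitian_space" and N :: "rat set" and C \<delta> :: real
  assumes vf: "vector_holomorphic_on f \<bbbH>" and vg: "vector_holomorphic_on g \<bbbH>"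
    and finN: "finite N" and N_nonneg: "N \<subseteq> {0..}"
    and polar_0: "\<And>n. n \<ge> 0 \<Longrightarrow> n \<notin> N \<Longrightarrow> polar_product f g n = 0"
    and \<delta>: "\<delta> > 0"
    and decay: "\<And>v. v \<ge> 1 \<Longrightarrow>
      norm (horizontal_mean f g v - (\<Sum>n\<in>N. polar_product f g n * of_real (exp (4 * pi * of_rat n * v))))
        \<le> C * exp (- \<delta> * v)"
begin

lemma polar_infsum: "(\<Sum>\<^sub>\<infinity>n\<in>{0..}. polar_product f g n * X n) = (\<Sum>n\<in>N. polar_product f g n * X n)"
proof -
  have "(\<Sum>\<^sub>\<infinity>n\<in>{0..}. polar_product f g n * X n) = (\<Sum>\<^sub>\<infinity>n\<in>N. polar_product f g n * X n)"
    using N_nonneg polar_0 by (intro infsum_cong_neutral) auto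
  then show ?thesis using finN by simp
qed

lemma remainder_eq:
  "remainder f g v = horizontal_mean f g v - (\<Sum>n\<in>N. polar_product f g n * of_real (exp (4 * pi * of_rat n * v)))"
  unfolding remainder_def polar_infsum ..

lemma continuous_on_remainder: "continuous_on {1..} (remainder f g)"
  unfolding remainder_eq[abs_def]
  by (intro continuous_intros continuous_on_subset[OF continuous_on_horizontal_mean[OF vf vg]]) auto

lemma remainder_integrand_continuous:
  "continuous_on {1..} (\<lambda>v. of_real v powr (of_real k - 2 - s) * remainder f g v)"
  by (intro continuous_intros continuous_on_remainder) (auto simp: complex_nonpos_Reals_iff)

lemma remainder_integrand_measurable [measurable]:
  "(\<lambda>v. indicator {1..} v *\<^sub>R (of_real v powr (of_real k - 2 - s) * remainder f g v)) \<in> borel_measurable borel"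
  by (intro borel_measurable_continuous_on_indicator remainder_integrand_continuous) auto

lemma norm_remainder_integrand_le:
  assumes "v \<ge> 1"
  shows "norm (of_real v powr (of_real k - 2 - s) * remainder f g v) \<le> C * (v powr (k - 2 - Re s) * exp (- \<delta> * v))"
proof -
  have "norm (of_real v powr (of_real k - 2 - s) * remainder f g v)
      \<le> v powr (k - 2 - Re s) * (C * exp (- \<delta> * v))"
    using decay[OF assms] assms unfolding remainder_eq norm_mult
    by (intro mult_mono) (auto simp: norm_powr_real_powr)
  then show ?thesis by (simp only: mult_ac)
qed

lemma remainder_integrand_integrable:
  "integrable lborel (\<lambda>v. indicator {1..} v *\<^sub>R (of_real v powr (of_real k - 2 - s) * remainder f g v))"
proof (rule Bochner_Integration.integrable_bound)
  show "integrable lborel (\<lambda>v. C * (indicator {1..} v *\<^sub>R (v powr (k - 2 - Re s) * exp (- \<delta> * v))))"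
    using powr_exp_set_integrable[OF \<delta>, of "k - 2 - Re s"]
    by (intro integrable_mult_right) (simp add: set_integrable_def)
  show "AE v in lborel. norm (indicator {1..} v *\<^sub>R (of_real v powr (of_real k - 2 - s) * remainder f g v))
      \<le> norm (C * (indicator {1..} v *\<^sub>R (v powr (k - 2 - Re s) * exp (- \<delta> * v))))"
  proof (rule AE_I2)
    fix v
    show "norm (indicator {1..} v *\<^sub>R (of_real v powr (of_real k - 2 - s) * remainder f g v))
      \<le> norm (C * (indicator {1..} v *\<^sub>R (v powr (k - 2 - Re s) * exp (- \<delta> * v))))"
      using norm_remainder_integrand_le[of v s] by (cases "v \<ge> 1") (auto simp del: norm_mult)
  qed
qed measurable

text \<open>At finite t all integrands are continuous on compact sets, so the finite sum can be
  moved under the integral. The divergent parts cancel here, before any limit is taken.\<close>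

lemma truncated_difference_eq:
  assumes "t \<ge> 1"
  shows "integral (truncated_domain t) (pairing_kernel k f g s)
     - (\<Sum>\<^sub>\<infinity>n\<in>{0..}. polar_product f g n *
          integral {1..t} (\<lambda>v. of_real v powr (of_real k - 2 - s) * of_real (exp (4 * pi * of_rat n * v))))
   = integral (truncated_domain 1) (pairing_kernel k f g s)
     + integral {1..t} (\<lambda>v. of_real v powr (of_real k - 2 - s) * remainder f g v)"
proof -
  let ?w = "\<lambda>v. complex_of_real v powr (of_real k - 2 - s)"
  have w_cont: "continuous_on {1..t} ?w"
    by (intro continuous_intros) (auto simp: complex_nonpos_Reals_iff)
  have m_cont: "continuous_on {1..t} (horizontal_mean f g)"
    by (rule continuous_on_subset[OF continuous_on_horizontal_mean[OF vf vg]]) auto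
  have "integral {1..t} (\<lambda>v. integral {-1/2..1/2} (\<lambda>u. pairing_kernel k f g s (Complex u v)))
      = integral {1..t} (\<lambda>v. ?w v * horizontal_mean f g v)"
    by (intro integral_cong integral_pairing_kernel_row) auto
  moreover have "integral {1..t} (\<lambda>v. ?w v * remainder f g v)
      = integral {1..t} (\<lambda>v. ?w v * horizontal_mean f g v)
       - (\<Sum>n\<in>N. polar_product f g n * integral {1..t} (\<lambda>v. ?w v * of_real (exp (4 * pi * of_rat n * v))))"
  proof -
    have "integral {1..t} (\<lambda>v. ?w v * remainder f g v) = integral {1..t} (\<lambda>v. ?w v * horizontal_mean f g v
        - (\<Sum>n\<in>N. polar_product f g n * (?w v * of_real (exp (4 * pi * of_rat n * v)))))"
      unfolding remainder_eq right_diff_distrib sum_distrib_left by (simp only: mult.left_commute)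
    also have "\<dots> = integral {1..t} (\<lambda>v. ?w v * horizontal_mean f g v)
        - integral {1..t} (\<lambda>v. \<Sum>n\<in>N. polar_product f g n * (?w v * of_real (exp (4 * pi * of_rat n * v))))"
      by (intro integral_diff integrable_continuous_interval continuous_intros w_cont m_cont)
    also have "integral {1..t} (\<lambda>v. \<Sum>n\<in>N. polar_product f g n * (?w v * of_real (exp (4 * pi * of_rat n * v))))
        = (\<Sum>n\<in>N. integral {1..t} (\<lambda>v. polar_product f g n * (?w v * of_real (exp (4 * pi * of_rat n * v)))))"
      by (intro integral_sum finN integrable_continuous_interval continuous_intros w_cont)
    finally show ?thesis by simp
  qed
  ultimately show ?thesis
    unfolding polar_infsum integral_truncated_domain[OF continuous_on_pairing_kernel[OF vf vg] assms] by simp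
qed

text \<open>The exponential decay of the remainder beats every power of v, so the limit exists for
  every s, not only near 0.\<close>

lemma tendsto_regular_part:
  "((\<lambda>t. integral (truncated_domain t) (pairing_kernel k f g s)
     - (\<Sum>\<^sub>\<infinity>n\<in>{0..}. polar_product f g n *
          integral {1..t} (\<lambda>v. of_real v powr (of_real k - 2 - s) * of_real (exp (4 * pi * of_rat n * v)))))
    \<longlongrightarrow> regular_part k f g s) at_top"
proof -
  let ?F = "\<lambda>v. of_real v powr (of_real k - 2 - s) * remainder f g v"
  have "((\<lambda>t. LINT v|lborel. indicator {..t} v *\<^sub>R (indicator {1..} v *\<^sub>R ?F v))
      \<longlongrightarrow> (LINT v|lborel. indicator {1..} v *\<^sub>R ?F v)) at_top"
    by (intro tendsto_integral_at_top remainder_integrand_integrable) simp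
  moreover have "(LINT v|lborel. indicator {..t} v *\<^sub>R (indicator {1..} v *\<^sub>R ?F v)) = integral {1..t} ?F" for t
  proof -
    have "set_integrable lborel {1..t} ?F"
      unfolding set_integrable_def
      by (intro borel_integrable_compact continuous_on_subset[OF remainder_integrand_continuous]) auto
    from set_borel_integral_eq_integral(2)[OF this]
    have "integral {1..t} ?F = (LINT v|lborel. indicator {1..t} v *\<^sub>R ?F v)"
      by (simp add: set_lebesgue_integral_def)
    also have "\<dots> = (LINT v|lborel. indicator {..t} v *\<^sub>R (indicator {1..} v *\<^sub>R ?F v))"
      by (intro Bochner_Integration.integral_cong refl) (auto simp: indicator_def)
    finally show ?thesis ..
  qed
  ultimately have "((\<lambda>t. integral (truncated_domain 1) (pairing_kernel k f g s) + integral {1..t} ?F)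
      \<longlongrightarrow> regular_part k f g s) at_top"
    unfolding regular_part_def by (intro tendsto_add tendsto_const) simp
  then show ?thesis
  proof (rule Lim_transform_eventually)
    show "\<forall>\<^sub>F t in at_top. integral (truncated_domain 1) (pairing_kernel k f g s) + integral {1..t} ?F
      = integral (truncated_domain t) (pairing_kernel k f g s)
     - (\<Sum>\<^sub>\<infinity>n\<in>{0..}. polar_product f g n *
          integral {1..t} (\<lambda>v. of_real v powr (of_real k - 2 - s) * of_real (exp (4 * pi * of_rat n * v))))"
      using eventually_ge_at_top[of 1] by eventually_elim (rule truncated_difference_eq[symmetric])
  qed
qed

text \<open>Both integrals depend on s through exp(-s ln v). On the compact part ln v is continuous,
  hence harmless; on the ray the dominating factor exp(|ln v|) is v.\<close>

lemma regular_part_holomorphic: "regular_part k f g holomorphic_on ball 0 1"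
proof -
  let ?D = "truncated_domain 1"
  have pos: "Im \<tau> > 0" if "\<tau> \<in> ?D" for \<tau>
    using that by (simp add: truncated_domain_1)
  have "(\<lambda>s. LINT \<tau>|lborel. (indicator ?D \<tau> *\<^sub>R pairing_kernel k f g 0 \<tau>) * exp (- s * of_real (ln (Im \<tau>))))
      holomorphic_on ball 0 1"
  proof (rule exp_integral_holomorphic)
    show "(\<lambda>\<tau>. indicator ?D \<tau> *\<^sub>R pairing_kernel k f g 0 \<tau>) \<in> borel_measurable lborel"
      using borel_measurable_continuous_on_indicator[of ?D "pairing_kernel k f g 0"] compact_truncated_domain_1
        continuous_on_subset[OF continuous_on_pairing_kernel[OF vf vg] truncated_domain_1_subset]
      by (simp add: borel_compact)
    have "integrable lborel (\<lambda>\<tau>. indicator ?D \<tau> *\<^sub>R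
        (norm (pairing_kernel k f g 0 \<tau>) * exp (1 * norm (complex_of_real (ln (Im \<tau>))))))"
      by (intro borel_integrable_compact compact_truncated_domain_1 continuous_intros
          continuous_on_subset[OF continuous_on_pairing_kernel[OF vf vg] truncated_domain_1_subset])
        (auto dest: pos)
    also have "(\<lambda>\<tau>. indicator ?D \<tau> *\<^sub>R
        (norm (pairing_kernel k f g 0 \<tau>) * exp (1 * norm (complex_of_real (ln (Im \<tau>))))))
      = (\<lambda>\<tau>. norm (indicator ?D \<tau> *\<^sub>R pairing_kernel k f g 0 \<tau>) * exp (1 * norm (complex_of_real (ln (Im \<tau>)))))"
      by (auto simp: indicator_def)
    finally show "integrable lborel \<dots>" .
  qed auto
  also have "(\<lambda>s. LINT \<tau>|lborel. (indicator ?D \<tau> *\<^sub>R pairing_kernel k f g 0 \<tau>) * exp (- s * of_real (ln (Im \<tau>))))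
      = (\<lambda>s. integral ?D (pairing_kernel k f g s))"
  proof
    fix s
    have "set_integrable lborel ?D (pairing_kernel k f g s)"
      unfolding set_integrable_def
      by (intro borel_integrable_compact compact_truncated_domain_1
          continuous_on_subset[OF continuous_on_pairing_kernel[OF vf vg] truncated_domain_1_subset])
    from set_borel_integral_eq_integral(2)[OF this]
    have "integral ?D (pairing_kernel k f g s) = (LINT \<tau>|lborel. indicator ?D \<tau> *\<^sub>R pairing_kernel k f g s \<tau>)"
      by (simp add: set_lebesgue_integral_def)
    also have "\<dots> = (LINT \<tau>|lborel. (indicator ?D \<tau> *\<^sub>R pairing_kernel k f g 0 \<tau>) * exp (- s * of_real (ln (Im \<tau>))))"
    proof (intro Bochner_Integration.integral_cong refl)
      fix \<tau>
      show "indicator ?D \<tau> *\<^sub>R pairing_kernel k f g s \<tau>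
          = (indicator ?D \<tau> *\<^sub>R pairing_kernel k f g 0 \<tau>) * exp (- s * of_real (ln (Im \<tau>)))"
      proof (cases "\<tau> \<in> ?D")
        case True
        from pos[OF this] show ?thesis
          by (simp add: pairing_kernel_def powr_def Ln_of_real left_diff_distrib exp_diff exp_minus divide_inverse)
      qed simp
    qed
    finally show "(LINT \<tau>|lborel. (indicator ?D \<tau> *\<^sub>R pairing_kernel k f g 0 \<tau>) * exp (- s * of_real (ln (Im \<tau>))))
        = integral ?D (pairing_kernel k f g s)" ..
  qed
  finally have 1: "(\<lambda>s. integral ?D (pairing_kernel k f g s)) holomorphic_on ball 0 1" .
  let ?G = "\<lambda>s v. indicator {1..} v *\<^sub>R (of_real v powr (of_real k - 2 - s) * remainder f g v)"
  have "(\<lambda>s. LINT v|lborel. ?G 0 v * exp (- s * of_real (ln v))) holomorphic_on ball 0 1"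
  proof (rule exp_integral_holomorphic)
    \<comment> \<open>The factor v is the same as passing from s = 0 to s = -1, where integrability
      is already known.\<close>
    have "integrable lborel (\<lambda>v. norm (?G (-1) v))"
      by (rule integrable_norm[OF remainder_integrand_integrable])
    also have "(\<lambda>v. norm (?G (-1) v)) = (\<lambda>v. norm (?G 0 v) * exp (1 * norm (complex_of_real (ln v))))"
    proof
      fix v :: real
      show "norm (?G (-1) v) = norm (?G 0 v) * exp (1 * norm (complex_of_real (ln v)))"
      proof (cases "v \<ge> 1")
        case True
        then have "v powr (k - 1) = v powr (k - 2) * v" using powr_add[of v "k - 2" 1] by simp
        with True show ?thesis by (simp add: norm_mult norm_powr_real_powr)
      qed simp
    qed
    finally show "integrable lborel (\<lambda>v. norm (?G 0 v) * exp (1 * norm (complex_of_real (ln v))))" .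
  qed (use remainder_integrand_measurable[of 0] in auto)
  also have "(\<lambda>s. LINT v|lborel. ?G 0 v * exp (- s * of_real (ln v))) = (\<lambda>s. LINT v|lborel. ?G s v)"
  proof (intro ext Bochner_Integration.integral_cong refl)
    fix s v
    show "?G 0 v * exp (- s * of_real (ln v)) = ?G s v"
    proof (cases "v \<ge> 1")
      case True
      then show ?thesis
        by (simp add: powr_def Ln_of_real left_diff_distrib exp_diff exp_minus divide_inverse)
    qed simp
  qed
  finally show ?thesis
    unfolding regular_part_def[abs_def] using 1 by (intro holomorphic_on_add)
qed

end

section \<open>Hermitian symmetry of the pairing\<close>

lemma polar_product_commute: "polar_product g f n = cnj (polar_product f g n)"
  unfolding polar_product_def by (rule herm_commute)

lemma cnj_horizontal_mean: "cnj (horizontal_mean f g v) = horizontal_mean g f v"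
  unfolding horizontal_mean_def by (simp add: integral_cnj herm_commute[symmetric])

lemma cnj_remainder: "cnj (remainder f g v) = remainder g f v"
  unfolding remainder_def
  by (simp add: cnj_horizontal_mean polar_product_commute[of g f] flip: infsum_cnj)

lemma of_real_powr_of_real:
  "v > 0 \<Longrightarrow> complex_of_real v powr of_real a = of_real (v powr a)"
  by (simp add: powr_of_real)

text \<open>At s = 0 the powers of v are real because k is, so conjugation acts only on the product
  of the forms.\<close>

lemma cnj_regular_part: "cnj (regular_part k f g 0) = regular_part k g f 0"
proof -
  have "cnj (pairing_kernel k f g 0 \<tau>) = pairing_kernel k g f 0 \<tau>" if "\<tau> \<in> truncated_domain 1" for \<tau>
    using that
    by (simp add: pairing_kernel_def truncated_domain_1 of_real_powr_of_real herm_commute[of "g \<tau>" "f \<tau>"])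
  then have 1: "cnj (integral (truncated_domain 1) (pairing_kernel k f g 0)) = integral (truncated_domain 1) (pairing_kernel k g f 0)"
    unfolding integral_cnj by (rule integral_cong)
  have "cnj (indicator {1..} v *\<^sub>R (of_real v powr (of_real k - 2 - 0) * remainder f g v))
      = indicator {1..} v *\<^sub>R (of_real v powr (of_real k - 2 - 0) * remainder g f v)" for v
  proof (cases "v \<ge> 1")
    case True
    then show ?thesis
      using of_real_powr_of_real[of v "k - 2"] by (simp add: cnj_remainder)
  qed simp
  then have 2: "cnj (LINT v|lborel. indicator {1..} v *\<^sub>R (of_real v powr (of_real k - 2 - 0) * remainder f g v))
      = (LINT v|lborel. indicator {1..} v *\<^sub>R (of_real v powr (of_real k - 2 - 0) * remainder g f v))"
    by (simp only: Bochner_Integration.integral_cnj[symmetric])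
  show ?thesis unfolding regular_part_def complex_cnj_add 1 2 ..
qed

text \<open>The angle 3 pi / 4 is an arbitrary admissible representative, as only a real part
  enters. For k = 1 the last term is 0 by the convention for division.\<close>

definition pairing_value :: "real \<Rightarrow> (complex \<Rightarrow> 'v::hermitian_space) \<Rightarrow> (complex \<Rightarrow> 'v) \<Rightarrow> complex" where
  "pairing_value k f g = regular_part k f g 0
     + (\<Sum>\<^sub>\<infinity>n\<in>{0<..}. polar_product f g n *
          of_real (Re (E_cont (3 * pi / 4) (2 - of_real k) (- 4 * pi * of_rat n))))
     + polar_product f g 0 / of_real (1 - k)"

lemma cnj_pairing_value: "cnj (pairing_value k f g) = pairing_value k g f"
  unfolding pairing_value_def complex_cnj_add cnj_regular_part infsum_cnj[symmetric]
  by (simp add: polar_product_commute[of g f])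

lemma pairing_angle_eq_pairing_value:
  fixes f g :: "complex \<Rightarrow> 'v::hermitian_space"
  assumes f: "f \<in> weakly_holomorphic_forms k \<rho>" and g: "g \<in> weakly_holomorphic_forms k \<rho>"
    and rep: "unitary_representation \<rho>" and fin: "factors_through_finite_quotient \<rho>"
    and \<phi>: "\<phi> \<in> admissible_angles"
  shows "pairing_angle k \<phi> f g = pairing_value k f g"
proof -
  from horizontal_mean_decay[OF f g rep fin] obtain N C \<delta> where
    D: "finite N \<and> N \<subseteq> {0..} \<and> (\<forall>n\<ge>0. n \<notin> N \<longrightarrow> polar_product f g n = 0) \<and> \<delta> > 0 \<and>
    (\<forall>v\<ge>1. norm (horizontal_mean f g v - (\<Sum>n\<in>N. polar_product f g n * of_real (exp (4 * pi * of_rat n * v))))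
      \<le> C * exp (- \<delta> * v))"
    by (elim exE) (rule that)
  then have fN: "finite N" and N: "N \<subseteq> {0..}" and \<delta>: "\<delta> > 0"
    by blast+
  have p0: "polar_product f g n = 0" if "n \<ge> 0" "n \<notin> N" for n
    using D that by (elim conjE) simp
  have decay: "norm (horizontal_mean f g v - (\<Sum>n\<in>N. polar_product f g n * of_real (exp (4 * pi * of_rat n * v))))
      \<le> C * exp (- \<delta> * v)" if "v \<ge> 1" for v
    using D that by (elim conjE) simp
  have vf: "vector_holomorphic_on f \<bbbH>" and vg: "vector_holomorphic_on g \<bbbH>"
    using f g by (simp_all add: weakly_holomorphic_forms_def)
  note ctx = vf vg fN N p0 \<delta> decay
  have z: "- 4 * pi * of_rat n = - complex_of_real (4 * pi * of_rat n)" for n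
    by (simp add: complex_of_real_of_rat)
  define N' where "N' = N \<inter> {0<..}"
  have sum_N': "(\<Sum>\<^sub>\<infinity>n\<in>{0<..}. polar_product f g n * X n) = (\<Sum>n\<in>N'. polar_product f g n * X n)" for X
  proof -
    have "(\<Sum>\<^sub>\<infinity>n\<in>{0<..}. polar_product f g n * X n) = (\<Sum>\<^sub>\<infinity>n\<in>N'. polar_product f g n * X n)"
      using p0 by (intro infsum_cong_neutral) (auto simp: N'_def)
    then show ?thesis using fN by (simp add: N'_def)
  qed
  have slit: "- 4 * pi * of_rat n \<in> slit_plane \<phi>" if "n \<in> N'" for n
    unfolding z using that by (intro negative_real_in_slit_plane \<phi>) (simp add: N'_def)
  let ?E = "\<lambda>\<phi> s n. E_cont \<phi> (2 - of_real k + s) (- 4 * pi * of_rat n)"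
  \<comment> \<open>Everything except the term of the zeroth coefficients, whose pole s = k - 1 may
    be at 0.\<close>
  define h where "h s = regular_part k f g s + (\<Sum>n\<in>N'. polar_product f g n * ?E \<phi> s n)" for s
  have "h holomorphic_on ball 0 1"
    unfolding h_def[abs_def]
    by (intro holomorphic_intros regular_part_holomorphic[OF ctx] E_cont_holomorphic_order
        cos_admissible_neg \<phi> slit)
  moreover have "I_reg k \<phi> f g s = h s + polar_product f g 0 / (1 - of_real k + s)" for s
  proof -
    have "Lim at_top (\<lambda>t. integral (truncated_domain t) (pairing_kernel k f g s)
       - (\<Sum>\<^sub>\<infinity>n\<in>{0..}. polar_product f g n *
            integral {1..t} (\<lambda>v. of_real v powr (of_real k - 2 - s) * of_real (exp (4 * pi * of_rat n * v)))))
      = regular_part k f g s"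
      by (rule tendsto_Lim[OF _ tendsto_regular_part[OF ctx]]) simp
    then show ?thesis
      unfolding I_reg_def sum_N' h_def pairing_kernel_def[abs_def]
      by (simp add: exp_of_real[symmetric] complex_of_real_of_rat)
  qed
  ultimately have "fls_nth (laurent_expansion (I_reg k \<phi> f g) 0) 0 = h 0 + polar_product f g 0 / (1 - of_real k)"
    by (intro laurent_constant_term_simple_pole)
  then have "pairing_angle k \<phi> f g = regular_part k f g 0
      + (\<Sum>n\<in>N'. polar_product f g n * ?E \<phi> 0 n) + polar_product f g 0 / (1 - of_real k)
      - \<i> * (\<Sum>n\<in>N'. polar_product f g n * of_real (Im (?E \<phi> 0 n)))"
    unfolding pairing_angle_def sum_N' h_def by simp
  also have "\<dots> = regular_part k f g 0
      + (\<Sum>n\<in>N'. polar_product f g n * (?E \<phi> 0 n - \<i> * of_real (Im (?E \<phi> 0 n))))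
      + polar_product f g 0 / (1 - of_real k)"
    by (simp add: right_diff_distrib sum_subtractf sum_distrib_left mult.left_commute)
  also have "(\<Sum>n\<in>N'. polar_product f g n * (?E \<phi> 0 n - \<i> * of_real (Im (?E \<phi> 0 n))))
      = (\<Sum>n\<in>N'. polar_product f g n * of_real (Re (E_cont (3 * pi / 4) (2 - of_real k) (- 4 * pi * of_rat n))))"
  proof (intro sum.cong refl)
    fix n assume n: "n \<in> N'"
    have "Re (E_cont \<phi> (of_real (2 - k)) (- of_real (4 * pi * of_rat n)))
        = Re (E_cont (3 * pi / 4) (of_real (2 - k)) (- of_real (4 * pi * of_rat n)))"
      by (rule Re_E_cont_angle_independent[OF \<phi>]) (use n in \<open>auto simp: admissible_angles_def N'_def\<close>)
    then have "Re (?E \<phi> 0 n) = Re (E_cont (3 * pi / 4) (2 - of_real k) (- 4 * pi * of_rat n))"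
      unfolding z by simp
    moreover have "w - \<i> * of_real (Im w) = of_real (Re w)" for w
      by (simp add: complex_eq_iff)
    ultimately show "polar_product f g n * (?E \<phi> 0 n - \<i> * of_real (Im (?E \<phi> 0 n)))
      = polar_product f g n * of_real (Re (E_cont (3 * pi / 4) (2 - of_real k) (- 4 * pi * of_rat n)))"
      by simp
  qed
  finally show ?thesis
    unfolding pairing_value_def sum_N' by simp
qed

theorem theorem3p1:
  fixes k :: real
    and \<rho> :: "(int^2^2) \<times> (complex \<Rightarrow> complex) \<Rightarrow> 'v::hermitian_space \<Rightarrow> 'v"
    and f g :: "complex \<Rightarrow> 'v"
  assumes "2 * k \<in> \<int>"
    and "unitary_representation \<rho>"
    and "factors_through_finite_quotient \<rho>"
    and "f \<in> weakly_holomorphic_forms k \<rho>"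
    and "g \<in> weakly_holomorphic_forms k \<rho>"
  shows "(\<forall>\<phi>\<in>admissible_angles. \<forall>\<phi>'\<in>admissible_angles.
            pairing_angle k \<phi> f g = pairing_angle k \<phi>' f g)
         \<and> pairing k f g = cnj (pairing k g f)
         \<and> pairing k f f \<in> \<real>"
proof -
  have angle: "pairing_angle k \<phi> f' g' = pairing_value k f' g'"
    if "f' \<in> weakly_holomorphic_forms k \<rho>" "g' \<in> weakly_holomorphic_forms k \<rho>" "\<phi> \<in> admissible_angles" for f' g' \<phi>
    using pairing_angle_eq_pairing_value[OF that(1,2) assms(2,3) that(3)] .
  \<comment> \<open>One admissible angle is needed for the description in \<open>pairing\<close> to
    have a unique solution.\<close>
  have "3 * pi / 4 \<in> admissible_angles" by (simp add: admissible_angles_def)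
  then have pairing: "pairing k f' g' = pairing_value k f' g'"
    if "f' \<in> weakly_holomorphic_forms k \<rho>" "g' \<in> weakly_holomorphic_forms k \<rho>" for f' g'
    unfolding pairing_def using angle[OF that] by (intro the_equality) auto
  have "pairing k f g = cnj (pairing k g f)"
    using assms(4,5) by (simp add: pairing cnj_pairing_value)
  moreover have "pairing k f f \<in> \<real>"
    using assms(4) by (simp add: pairing cnj_pairing_value Reals_cnj_iff)
  ultimately show ?thesis
    using angle[OF assms(4,5)] by simp
qed

end
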